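(* Let $\Gamma$ be an artin algebra with $\operatorname{domdim}\Gamma\ge 2$, let $T_{\mathcal{C}}$ be the unique tilting module in $\mathcal{C}_\Gamma$, and let $B_{\mathcal{C}}=\operatorname{End}_\Gamma(T_{\mathcal{C}})^{op}$. Then $\operatorname{gldim}B_{\mathcal{C}}\le\operatorname{gldim}\Gamma$.
   Context: All modules are finitely generated left modules. For a minimal injective resolution $0\to{}_\Gamma\Gamma\to I_0\to I_1\to\cdots$, $\operatorname{domdim}\Gamma=\sup\{k\mid I_i\text{ is projective for all }0\le i<k\}$. Let $\widetilde{Q}$ be the direct sum of representatives of the isomorphism classes of all indecomposable projective-injective $\Gamma$-modules; $\mathcal{C}_\Gamma=(\operatorname{Gen}\widetilde{Q})\cap(\operatorname{Cogen}\widetilde{Q})$ is the full subcategory of modules $M$ that admit both an epimorphism $\widetilde{Q}^m\to M$ and a monomorphism $M\to\widetilde{Q}^{m'}$ for some $m,m'$. A basic $\Gamma$-module $T$ is tilting if (1) $\operatorname{projdim}T\le 1$, (2) $\operatorname{Ext}^1_\Gamma(T,T)=0$, (3) there is an exact sequence $0\to\Gamma\to T_0\to T_1\to 0$ with $T_0,T_1\in\operatorname{add}T$. When $\operatorname{domdim}\Gamma\ge 2$, there is a tilting module in $\mathcal{C}_\Gamma$, unique up to isomorphism; it is isomorphic to the direct sum of $\widetilde{Q}$ and the cokernels of the injective envelopes of representatives of the indecomposable projective non-injective modules. *)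

theory Defs
  imports "HOL-Library.Extended_Nat" "HOL-Algebra.Module" "HOL-Algebra.RingHom"
begin

section \<open>Left modules\<close>

text \<open>The locale \<^locale>\<open>module\<close> of HOL-Algebra only treats modules over commutative rings. We
  keep its record type and its axioms but drop commutativity of the ring. As in HOL-Algebra, the
  \<open>mult\<close> and \<open>one\<close> fields of a module record carry no meaning.\<close>

locale left_module = R?: ring R + M?: abelian_group M
  for R :: "('a, 'x) ring_scheme" (structure) and M :: "('a, 'm, 'y) module_scheme" (structure) +
  assumes smult_closed [simp, intro]:
      "\<lbrakk>a \<in> carrier R; x \<in> carrier M\<rbrakk> \<Longrightarrow> a \<odot>\<^bsub>M\<^esub> x \<in> carrier M"
    and smult_l_distr:
      "\<lbrakk>a \<in> carrier R; b \<in> carrier R; x \<in> carrier M\<rbrakk> \<Longrightarrow>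
      (a \<oplus> b) \<odot>\<^bsub>M\<^esub> x = a \<odot>\<^bsub>M\<^esub> x \<oplus>\<^bsub>M\<^esub> b \<odot>\<^bsub>M\<^esub> x"
    and smult_r_distr:
      "\<lbrakk>a \<in> carrier R; x \<in> carrier M; y \<in> carrier M\<rbrakk> \<Longrightarrow>
      a \<odot>\<^bsub>M\<^esub> (x \<oplus>\<^bsub>M\<^esub> y) = a \<odot>\<^bsub>M\<^esub> x \<oplus>\<^bsub>M\<^esub> a \<odot>\<^bsub>M\<^esub> y"
    and smult_assoc:
      "\<lbrakk>a \<in> carrier R; b \<in> carrier R; x \<in> carrier M\<rbrakk> \<Longrightarrow>
      (a \<otimes> b) \<odot>\<^bsub>M\<^esub> x = a \<odot>\<^bsub>M\<^esub> (b \<odot>\<^bsub>M\<^esub> x)"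
    and smult_one [simp]:
      "x \<in> carrier M \<Longrightarrow> \<one> \<odot>\<^bsub>M\<^esub> x = x"

lemma module_iff_left_module: "module R M \<longleftrightarrow> cring R \<and> left_module R M"
  unfolding module_def left_module_def module_axioms_def left_module_axioms_def
  by (auto simp: cring_def)

definition fg_module :: "('a, 'x) ring_scheme \<Rightarrow> ('a, 'm) module \<Rightarrow> bool" where
  "fg_module R M \<longleftrightarrow> left_module R M \<and>
     (\<exists>A. finite A \<and> A \<subseteq> carrier M \<and>
       (\<forall>x\<in>carrier M. \<exists>c. c \<in> A \<rightarrow> carrier R \<and> x = (\<Oplus>\<^bsub>M\<^esub>a\<in>A. c a \<odot>\<^bsub>M\<^esub> a)))"

definition is_zero_module :: "('a, 'm) module \<Rightarrow> bool" where
  "is_zero_module M \<longleftrightarrow> carrier M = {\<zero>\<^bsub>M\<^esub>}"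

definition left_module_hom ::
    "('a, 'x) ring_scheme \<Rightarrow> ('a, 'm) module \<Rightarrow> ('a, 'n) module \<Rightarrow> ('m \<Rightarrow> 'n) set" where
  "left_module_hom R M N = {f \<in> hom (add_monoid M) (add_monoid N).
     \<forall>r\<in>carrier R. \<forall>x\<in>carrier M. f (r \<odot>\<^bsub>M\<^esub> x) = r \<odot>\<^bsub>N\<^esub> f x}"

definition mono_hom ::
    "('a, 'x) ring_scheme \<Rightarrow> ('a, 'm) module \<Rightarrow> ('a, 'n) module \<Rightarrow> ('m \<Rightarrow> 'n) set" where
  "mono_hom R M N = {f \<in> left_module_hom R M N. inj_on f (carrier M)}"

definition epi_hom ::
    "('a, 'x) ring_scheme \<Rightarrow> ('a, 'm) module \<Rightarrow> ('a, 'n) module \<Rightarrow> ('m \<Rightarrow> 'n) set" where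
  "epi_hom R M N = {f \<in> left_module_hom R M N. f ` carrier M = carrier N}"

definition module_isomorphic ::
    "('a, 'x) ring_scheme \<Rightarrow> ('a, 'm) module \<Rightarrow> ('a, 'n) module \<Rightarrow> bool" where
  "module_isomorphic R M N \<longleftrightarrow> (\<exists>f. f \<in> mono_hom R M N \<and> f \<in> epi_hom R M N)"

text \<open>Every finitely generated left module over a ring with elements of type \<open>'a\<close> is isomorphic
  to one whose elements are of type \<open>'a list set\<close> (a quotient of some \<open>R\<^sup>n\<close>); see lemma
  \<open>fg_module_isomorphic_fgmod\<close> below. This type therefore serves as the universe whenever one has
  to quantify over all finitely generated modules.\<close>

type_synonym 'a fgmod = "('a, 'a list set) module"

definition regular_module :: "('a, 'x) ring_scheme \<Rightarrow> ('a, 'a) module" where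
  "regular_module R = \<lparr>carrier = carrier R, mult = mult R, one = \<one>\<^bsub>R\<^esub>, zero = \<zero>\<^bsub>R\<^esub>,
     add = add R, smult = mult R\<rparr>"

definition direct_sum :: "('a, 'm) module list \<Rightarrow> ('a, 'm list) module" where
  "direct_sum Ms = \<lparr>
     carrier = {xs. length xs = length Ms \<and> (\<forall>i<length Ms. xs ! i \<in> carrier (Ms ! i))},
     mult = undefined, one = undefined,
     zero = map (\<lambda>M. \<zero>\<^bsub>M\<^esub>) Ms,
     add = (\<lambda>xs ys. map (\<lambda>i. xs ! i \<oplus>\<^bsub>Ms ! i\<^esub> ys ! i) [0..<length Ms]),
     smult = (\<lambda>r xs. map (\<lambda>i. r \<odot>\<^bsub>Ms ! i\<^esub> xs ! i) [0..<length Ms])\<rparr>"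

abbreviation module_power :: "('a, 'm) module \<Rightarrow> nat \<Rightarrow> ('a, 'm list) module" where
  "module_power M n \<equiv> direct_sum (replicate n M)"

definition in_add :: "('a, 'x) ring_scheme \<Rightarrow> ('a, 'm) module \<Rightarrow> 'a fgmod \<Rightarrow> bool" where
  "in_add R T X \<longleftrightarrow> fg_module R X \<and>
     (\<exists>(Y :: 'a fgmod) n. fg_module R Y \<and>
        module_isomorphic R (direct_sum [X, Y]) (module_power T n))"

definition indecomposable :: "('a, 'x) ring_scheme \<Rightarrow> ('a, 'm) module \<Rightarrow> bool" where
  "indecomposable R M \<longleftrightarrow> fg_module R M \<and> \<not> is_zero_module M \<and>
     (\<forall>(X :: 'a fgmod) (Y :: 'a fgmod). fg_module R X \<longrightarrow> fg_module R Y \<longrightarrow>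
        module_isomorphic R M (direct_sum [X, Y]) \<longrightarrow> is_zero_module X \<or> is_zero_module Y)"

definition pairwise_nonisomorphic ::
    "('a, 'x) ring_scheme \<Rightarrow> ('a, 'm) module list \<Rightarrow> bool" where
  "pairwise_nonisomorphic R Xs \<longleftrightarrow>
     (\<forall>i<length Xs. \<forall>j<length Xs. i \<noteq> j \<longrightarrow> \<not> module_isomorphic R (Xs ! i) (Xs ! j))"

definition basic_module :: "('a, 'x) ring_scheme \<Rightarrow> ('a, 'm) module \<Rightarrow> bool" where
  "basic_module R M \<longleftrightarrow> fg_module R M \<and>
     (\<exists>Xs :: 'a fgmod list. (\<forall>X\<in>set Xs. indecomposable R X) \<and>
        pairwise_nonisomorphic R Xs \<and> module_isomorphic R M (direct_sum Xs))"

definition essential_submodule ::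
    "'m set \<Rightarrow> ('a, 'x) ring_scheme \<Rightarrow> ('a, 'm) module \<Rightarrow> bool" where
  "essential_submodule H R M \<longleftrightarrow> submodule H R M \<and>
     (\<forall>K. submodule K R M \<longrightarrow> K \<inter> H = {\<zero>\<^bsub>M\<^esub>} \<longrightarrow> K = {\<zero>\<^bsub>M\<^esub>})"


section \<open>Projective and injective modules, resolutions, homological dimensions\<close>

text \<open>Projectivity and injectivity are understood in the category of finitely generated
  modules.\<close>

definition projective_module :: "('a, 'x) ring_scheme \<Rightarrow> ('a, 'm) module \<Rightarrow> bool" where
  "projective_module R P \<longleftrightarrow> fg_module R P \<and>
     (\<forall>(X :: 'a fgmod) (Y :: 'a fgmod) p g. fg_module R X \<longrightarrow> fg_module R Y \<longrightarrow>
        p \<in> epi_hom R X Y \<longrightarrow> g \<in> left_module_hom R P Y \<longrightarrow>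
        (\<exists>h\<in>left_module_hom R P X. \<forall>x\<in>carrier P. p (h x) = g x))"

definition injective_module :: "('a, 'x) ring_scheme \<Rightarrow> ('a, 'm) module \<Rightarrow> bool" where
  "injective_module R I \<longleftrightarrow> fg_module R I \<and>
     (\<forall>(X :: 'a fgmod) (Y :: 'a fgmod) j g. fg_module R X \<longrightarrow> fg_module R Y \<longrightarrow>
        j \<in> mono_hom R X Y \<longrightarrow> g \<in> left_module_hom R X I \<longrightarrow>
        (\<exists>h\<in>left_module_hom R Y I. \<forall>x\<in>carrier X. h (j x) = g x))"

text \<open>\<open>\<dots> \<rightarrow> P 1 \<rightarrow> P 0 \<rightarrow> M \<rightarrow> 0\<close> with differentials \<open>d i : P (i + 1) \<rightarrow> P i\<close> and
  augmentation \<open>\<epsilon>\<close>.\<close>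

definition projective_resolution ::
    "('a, 'x) ring_scheme \<Rightarrow> ('a, 'm) module \<Rightarrow> (nat \<Rightarrow> 'a fgmod) \<Rightarrow>
      ('a list set \<Rightarrow> 'm) \<Rightarrow> (nat \<Rightarrow> 'a list set \<Rightarrow> 'a list set) \<Rightarrow> bool" where
  "projective_resolution R M P \<epsilon> d \<longleftrightarrow>
     (\<forall>i. projective_module R (P i)) \<and>
     \<epsilon> \<in> epi_hom R (P 0) M \<and>
     (\<forall>i. d i \<in> left_module_hom R (P (Suc i)) (P i)) \<and>
     d 0 ` carrier (P 1) = a_kernel (P 0) M \<epsilon> \<and>
     (\<forall>i. d (Suc i) ` carrier (P (Suc (Suc i))) = a_kernel (P (Suc i)) (P i) (d i))"

text \<open>\<open>0 \<rightarrow> M \<rightarrow> I 0 \<rightarrow> I 1 \<rightarrow> \<dots>\<close>; minimality means that \<open>I 0\<close> is an injective envelope of \<open>M\<close>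
  and \<open>I (i + 1)\<close> is an injective envelope of the image of \<open>d i : I i \<rightarrow> I (i + 1)\<close>.\<close>

definition minimal_injective_resolution ::
    "('a, 'x) ring_scheme \<Rightarrow> ('a, 'm) module \<Rightarrow> (nat \<Rightarrow> 'a fgmod) \<Rightarrow>
      ('m \<Rightarrow> 'a list set) \<Rightarrow> (nat \<Rightarrow> 'a list set \<Rightarrow> 'a list set) \<Rightarrow> bool" where
  "minimal_injective_resolution R M I \<eta> d \<longleftrightarrow>
     (\<forall>i. injective_module R (I i)) \<and>
     \<eta> \<in> mono_hom R M (I 0) \<and>
     (\<forall>i. d i \<in> left_module_hom R (I i) (I (Suc i))) \<and>
     \<eta> ` carrier M = a_kernel (I 0) (I 1) (d 0) \<and>
     (\<forall>i. d i ` carrier (I i) = a_kernel (I (Suc i)) (I (Suc (Suc i))) (d (Suc i))) \<and>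
     essential_submodule (\<eta> ` carrier M) R (I 0) \<and>
     (\<forall>i. essential_submodule (d i ` carrier (I i)) R (I (Suc i)))"

definition projdim :: "('a, 'x) ring_scheme \<Rightarrow> ('a, 'm) module \<Rightarrow> enat" where
  "projdim R M = Inf {enat n | n. \<exists>P \<epsilon> d. projective_resolution R M P \<epsilon> d \<and>
     (\<forall>i>n. is_zero_module (P i))}"

definition gldim :: "('a, 'x) ring_scheme \<Rightarrow> enat" where
  "gldim R = Sup {projdim R M | M :: 'a fgmod. fg_module R M}"

definition domdim :: "('a, 'x) ring_scheme \<Rightarrow> enat" where
  "domdim R = Sup {enat k | k. \<exists>I \<eta> d.
     minimal_injective_resolution R (regular_module R) I \<eta> d \<and>
     (\<forall>i<k. projective_module R (I i))}"

text \<open>\<open>Ext\<^sup>1(M, N)\<close> is the first cohomology of \<open>Hom(P, N)\<close> for a projective resolution \<open>P\<close> of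
  \<open>M\<close>. It vanishes iff every 1-cocycle \<open>P 1 \<rightarrow> N\<close> is a coboundary. Maps are compared on the
  carrier.\<close>

definition Ext1_cocycles ::
    "('a, 'x) ring_scheme \<Rightarrow> (nat \<Rightarrow> 'a fgmod) \<Rightarrow> (nat \<Rightarrow> 'a list set \<Rightarrow> 'a list set) \<Rightarrow>
      ('a, 'n) module \<Rightarrow> ('a list set \<Rightarrow> 'n) set" where
  "Ext1_cocycles R P d N = {f \<in> left_module_hom R (P 1) N. \<forall>x\<in>carrier (P 2). f (d 1 x) = \<zero>\<^bsub>N\<^esub>}"

definition Ext1_coboundaries ::
    "('a, 'x) ring_scheme \<Rightarrow> (nat \<Rightarrow> 'a fgmod) \<Rightarrow> (nat \<Rightarrow> 'a list set \<Rightarrow> 'a list set) \<Rightarrow>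
      ('a, 'n) module \<Rightarrow> ('a list set \<Rightarrow> 'n) set" where
  "Ext1_coboundaries R P d N = {f \<in> left_module_hom R (P 1) N.
     \<exists>g\<in>left_module_hom R (P 0) N. \<forall>x\<in>carrier (P 1). f x = g (d 0 x)}"

definition Ext1_vanishes ::
    "('a, 'x) ring_scheme \<Rightarrow> ('a, 'm) module \<Rightarrow> ('a, 'n) module \<Rightarrow> bool" where
  "Ext1_vanishes R M N \<longleftrightarrow> (\<exists>P \<epsilon> d. projective_resolution R M P \<epsilon> d \<and>
     Ext1_cocycles R P d N = Ext1_coboundaries R P d N)"


section \<open>Artin algebras, tilting modules, endomorphism rings\<close>

definition artinian_cring :: "('k, 'x) ring_scheme \<Rightarrow> bool" where
  "artinian_cring K \<longleftrightarrow> cring K \<and>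
     (\<forall>J :: nat \<Rightarrow> 'k set. (\<forall>n. ideal (J n) K \<and> J (Suc n) \<subseteq> J n) \<longrightarrow>
        (\<exists>N. \<forall>n\<ge>N. J n = J N))"

definition scalar_module ::
    "('k \<Rightarrow> 'a) \<Rightarrow> ('a, 'x) ring_scheme \<Rightarrow> ('k, 'a) module" where
  "scalar_module \<phi> R = \<lparr>carrier = carrier R, mult = mult R, one = \<one>\<^bsub>R\<^esub>, zero = \<zero>\<^bsub>R\<^esub>,
     add = add R, smult = (\<lambda>c x. \<phi> c \<otimes>\<^bsub>R\<^esub> x)\<rparr>"

text \<open>\<open>\<phi>\<close> is the structure map of the \<open>K\<close>-algebra \<open>R\<close>.\<close>

definition artin_algebra ::
    "('k, 'x) ring_scheme \<Rightarrow> ('k \<Rightarrow> 'a) \<Rightarrow> ('a, 'y) ring_scheme \<Rightarrow> bool" where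
  "artin_algebra K \<phi> R \<longleftrightarrow> artinian_cring K \<and> ring R \<and> \<phi> \<in> ring_hom K R \<and>
     (\<forall>c\<in>carrier K. \<forall>a\<in>carrier R. \<phi> c \<otimes>\<^bsub>R\<^esub> a = a \<otimes>\<^bsub>R\<^esub> \<phi> c) \<and>
     fg_module K (scalar_module \<phi> R)"

text \<open>\<open>Xs\<close> lists representatives of the isomorphism classes of all indecomposable
  projective-injective modules, each class exactly once.\<close>

definition proj_inj_representatives ::
    "('a, 'x) ring_scheme \<Rightarrow> 'a fgmod list \<Rightarrow> bool" where
  "proj_inj_representatives R Xs \<longleftrightarrow>
     (\<forall>X\<in>set Xs. indecomposable R X \<and> projective_module R X \<and> injective_module R X) \<and>
     pairwise_nonisomorphic R Xs \<and>
     (\<forall>X :: 'a fgmod. indecomposable R X \<and> projective_module R X \<and> injective_module R X \<longrightarrow>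
        (\<exists>Y\<in>set Xs. module_isomorphic R X Y))"

definition in_Gen :: "('a, 'x) ring_scheme \<Rightarrow> ('a, 'q) module \<Rightarrow> ('a, 'm) module \<Rightarrow> bool" where
  "in_Gen R Q M \<longleftrightarrow> fg_module R M \<and> (\<exists>m f. f \<in> epi_hom R (module_power Q m) M)"

definition in_Cogen :: "('a, 'x) ring_scheme \<Rightarrow> ('a, 'q) module \<Rightarrow> ('a, 'm) module \<Rightarrow> bool" where
  "in_Cogen R Q M \<longleftrightarrow> fg_module R M \<and> (\<exists>m f. f \<in> mono_hom R M (module_power Q m))"

text \<open>Here \<open>direct_sum Xs\<close> is the module \<open>Q\<close> with tilde; it is determined up to isomorphism, so the
  choice of \<open>Xs\<close> does not matter.\<close>

definition in_C :: "('a, 'x) ring_scheme \<Rightarrow> ('a, 'm) module \<Rightarrow> bool" where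
  "in_C R M \<longleftrightarrow> (\<exists>Xs. proj_inj_representatives R Xs \<and>
     in_Gen R (direct_sum Xs) M \<and> in_Cogen R (direct_sum Xs) M)"

definition tilting_module :: "('a, 'x) ring_scheme \<Rightarrow> ('a, 't) module \<Rightarrow> bool" where
  "tilting_module R T \<longleftrightarrow> basic_module R T \<and>
     projdim R T \<le> 1 \<and>
     Ext1_vanishes R T T \<and>
     (\<exists>(T0 :: 'a fgmod) (T1 :: 'a fgmod) f g. in_add R T T0 \<and> in_add R T T1 \<and>
        f \<in> mono_hom R (regular_module R) T0 \<and> g \<in> epi_hom R T0 T1 \<and>
        f ` carrier (regular_module R) = a_kernel T0 T1 g)"

text \<open>Endomorphisms are made extensional so that equality of ring elements is equality of maps on
  the carrier. The product \<open>f \<otimes> g\<close> is \<open>f\<close> after \<open>g\<close>.\<close>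

definition End_ring :: "('a, 'x) ring_scheme \<Rightarrow> ('a, 'm) module \<Rightarrow> ('m \<Rightarrow> 'm) ring" where
  "End_ring R M = \<lparr>
     carrier = left_module_hom R M M \<inter> extensional (carrier M),
     mult = compose (carrier M),
     one = (\<lambda>x\<in>carrier M. x),
     zero = (\<lambda>x\<in>carrier M. \<zero>\<^bsub>M\<^esub>),
     add = (\<lambda>f g. \<lambda>x\<in>carrier M. f x \<oplus>\<^bsub>M\<^esub> g x)\<rparr>"

definition op_ring :: "('a, 'x) ring_scheme \<Rightarrow> ('a, 'x) ring_scheme" where
  "op_ring R = R\<lparr>mult := (\<lambda>x y. y \<otimes>\<^bsub>R\<^esub> x)\<rparr>"

section \<open>Well-definedness of the constructions\<close>

text \<open>The constructions above yield modules and rings, and the type \<^typ>\<open>'a fgmod\<close> contains every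
  finitely generated module up to isomorphism.\<close>

lemma left_module_regular: "ring R \<Longrightarrow> left_module R (regular_module R)"
proof -
  assume "ring R"
  then interpret ring R .
  show ?thesis
    apply (intro left_module.intro left_module_axioms.intro)
        apply (rule ring_axioms)
       apply (rule abelian_groupI)
    apply (auto simp: regular_module_def a_ac l_distr r_distr m_assoc intro: l_neg)
    done
qed

lemma fg_module_regular: assumes "ring R" shows "fg_module R (regular_module R)"
proof -
  interpret R: ring R by fact
  have L: "left_module R (regular_module R)" using left_module_regular assms .
  have A: "abelian_monoid (regular_module R)"
    using L by (simp add: left_module_def abelian_group_def)
  have s: "(\<Oplus>\<^bsub>regular_module R\<^esub>a\<in>{\<one>\<^bsub>R\<^esub>}. x \<odot>\<^bsub>regular_module R\<^esub> a) = x"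
    if x: "x \<in> carrier R" for x
  proof -
    have "(\<lambda>a. x \<odot>\<^bsub>regular_module R\<^esub> a) \<in> {} \<rightarrow> carrier (regular_module R)" by simp
    moreover have u: "x \<odot>\<^bsub>regular_module R\<^esub> \<one>\<^bsub>R\<^esub> = x" using x by (simp add: regular_module_def)
    moreover have c: "x \<in> carrier (regular_module R)" using x by (simp add: regular_module_def)
    ultimately have "(\<Oplus>\<^bsub>regular_module R\<^esub>a\<in>{\<one>\<^bsub>R\<^esub>}. x \<odot>\<^bsub>regular_module R\<^esub> a) =
        x \<oplus>\<^bsub>regular_module R\<^esub> \<zero>\<^bsub>regular_module R\<^esub>"
      by (simp only: abelian_monoid.finsum_insert[OF A] abelian_monoid.finsum_empty[OF A]
          finite.emptyI empty_iff not_False_eq_True)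
    also have "\<dots> = x" by (rule abelian_monoid.r_zero[OF A c])
    finally show ?thesis .
  qed
  have "\<exists>c. c \<in> {\<one>\<^bsub>R\<^esub>} \<rightarrow> carrier R \<and>
      x = (\<Oplus>\<^bsub>regular_module R\<^esub>a\<in>{\<one>\<^bsub>R\<^esub>}. c a \<odot>\<^bsub>regular_module R\<^esub> a)"
    if "x \<in> carrier (regular_module R)" for x
    by (rule exI[of _ "\<lambda>_. x"]) (use that s in \<open>simp add: regular_module_def\<close>)
  moreover have "{\<one>\<^bsub>R\<^esub>} \<subseteq> carrier (regular_module R)" by (simp add: regular_module_def)
  ultimately show ?thesis unfolding fg_module_def using L by blast
qed

lemma left_module_direct_sum:
  assumes "ring R" "\<And>M. M \<in> set Ms \<Longrightarrow> left_module R M"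
  shows "left_module R (direct_sum Ms)"
proof -
  interpret ring R by fact
  have L: "left_module R (Ms ! i)" if "i < length Ms" for i using assms(2) that by simp
  have A: "abelian_group (Ms ! i)" if "i < length Ms" for i using L[OF that] by (simp add: left_module_def)
  note F = abelian_monoid.a_closed[OF abelian_group.axioms(1)[OF A]]
    abelian_monoid.zero_closed[OF abelian_group.axioms(1)[OF A]]
    abelian_monoid.a_assoc[OF abelian_group.axioms(1)[OF A]]
    abelian_monoid.a_comm[OF abelian_group.axioms(1)[OF A]]
    abelian_monoid.l_zero[OF abelian_group.axioms(1)[OF A]]
    left_module.smult_closed[OF L] left_module.smult_l_distr[OF L] left_module.smult_r_distr[OF L]
    left_module.smult_assoc[OF L] left_module.smult_one[OF L]
  show ?thesis
    apply (intro left_module.intro left_module_axioms.intro)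
        apply (rule ring_axioms)
       apply (rule abelian_groupI)
    subgoal by (auto simp: direct_sum_def F)
    subgoal by (auto simp: direct_sum_def F)
    subgoal by (auto simp: direct_sum_def abelian_monoid.a_assoc[OF abelian_group.axioms(1)[OF A]] F(1))
    subgoal by (auto simp: direct_sum_def abelian_monoid.a_comm[OF abelian_group.axioms(1)[OF A]])
    subgoal by (auto simp: direct_sum_def abelian_monoid.l_zero[OF abelian_group.axioms(1)[OF A]] intro!: nth_equalityI)
    subgoal for x
      apply (rule bexI[of _ "map (\<lambda>i. \<ominus>\<^bsub>Ms ! i\<^esub> x ! i) [0..<length Ms]"])
      by (auto simp: direct_sum_def intro!: nth_equalityI simp: abelian_group.l_neg[OF A] abelian_group.a_inv_closed[OF A])
    by (auto simp: direct_sum_def F(1,2) F(6-) intro!: nth_equalityI)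
qed

lemma ring_op_ring: assumes "ring R" shows "ring (op_ring R)"
proof -
  interpret R: ring R by fact
  have A: "abelian_group (op_ring R)"
  proof (rule abelian_groupI)
    fix x y assume "x \<in> carrier (op_ring R)" "y \<in> carrier (op_ring R)"
    then show "x \<oplus>\<^bsub>op_ring R\<^esub> y = y \<oplus>\<^bsub>op_ring R\<^esub> x"
      by (simp add: op_ring_def R.a_comm)
  qed (auto simp: op_ring_def R.a_assoc intro: R.l_neg)
  show ?thesis
  proof (rule ringI[OF A])
    show "monoid (op_ring R)"
      by (rule monoidI) (simp_all add: op_ring_def R.m_assoc)
  qed (simp_all add: op_ring_def R.l_distr R.r_distr)
qed

lemma ring_End_ring: assumes "left_module R M" shows "ring (End_ring R M)"
proof -
  interpret left_module R M by fact
  have H: "f x \<in> carrier M" "f (x \<oplus>\<^bsub>M\<^esub> y) = f x \<oplus>\<^bsub>M\<^esub> f y" "r \<in> carrier R \<Longrightarrow> f (r \<odot>\<^bsub>M\<^esub> x) = r \<odot>\<^bsub>M\<^esub> f x"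
    if "f \<in> left_module_hom R M M" "x \<in> carrier M" "y \<in> carrier M" for f x y r
    using that by (auto simp: left_module_hom_def hom_def)
  have z: "r \<in> carrier R \<Longrightarrow> r \<odot>\<^bsub>M\<^esub> \<zero>\<^bsub>M\<^esub> = \<zero>\<^bsub>M\<^esub>" for r
    by (metis M.add.r_cancel_one' M.zero_closed smult_closed smult_r_distr M.l_zero)
  have mm: "r \<in> carrier R \<Longrightarrow> x \<in> carrier M \<Longrightarrow> \<ominus>\<^bsub>M\<^esub> (r \<odot>\<^bsub>M\<^esub> x) = r \<odot>\<^bsub>M\<^esub> (\<ominus>\<^bsub>M\<^esub> x)" for r x
    by (metis M.add.inv_closed M.l_neg M.minus_equality smult_closed smult_r_distr z)
  have I: "f \<in> carrier (End_ring R M)" if "f \<in> extensional (carrier M)" "\<And>x. x \<in> carrier M \<Longrightarrow> f x \<in> carrier M"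
     "\<And>x y. x \<in> carrier M \<Longrightarrow> y \<in> carrier M \<Longrightarrow> f (x \<oplus>\<^bsub>M\<^esub> y) = f x \<oplus>\<^bsub>M\<^esub> f y"
     "\<And>r x. r \<in> carrier R \<Longrightarrow> x \<in> carrier M \<Longrightarrow> f (r \<odot>\<^bsub>M\<^esub> x) = r \<odot>\<^bsub>M\<^esub> f x" for f
    using that by (auto simp: End_ring_def left_module_hom_def hom_def)
  have D: "f \<in> carrier (End_ring R M) \<Longrightarrow> f \<in> left_module_hom R M M \<and> f \<in> extensional (carrier M)" for f
    by (auto simp: End_ring_def)
  have P: "mult (End_ring R M) = compose (carrier M)" "\<one>\<^bsub>End_ring R M\<^esub> = (\<lambda>x\<in>carrier M. x)"
    "\<zero>\<^bsub>End_ring R M\<^esub> = (\<lambda>x\<in>carrier M. \<zero>\<^bsub>M\<^esub>)" "add (End_ring R M) = (\<lambda>f g. \<lambda>x\<in>carrier M. f x \<oplus>\<^bsub>M\<^esub> g x)"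
    by (auto simp: End_ring_def)
  show ?thesis
    apply (rule ringI)
       apply (rule abelian_groupI)
    subgoal by (rule I) (auto simp: P dest!: D simp: H smult_r_distr M.a_ac)
    subgoal by (rule I) (auto simp: P z)
    subgoal by (rule extensionalityI[of _ "carrier M"]) (auto simp: P dest!: D simp: H M.a_ac)
    subgoal by (rule extensionalityI[of _ "carrier M"]) (auto simp: P dest!: D simp: H M.a_ac)
    subgoal by (rule extensionalityI[of _ "carrier M"]) (auto simp: P dest!: D simp: H M.a_ac)
    subgoal for f apply (rule bexI[of _ "\<lambda>x\<in>carrier M. \<ominus>\<^bsub>M\<^esub> f x"])
      subgoal by (rule extensionalityI[of _ "carrier M"]) (auto simp: P dest!: D simp: H M.l_neg)
      subgoal by (rule I) (auto simp: P dest!: D simp: H M.minus_add mm )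
      done
    subgoal apply (rule monoidI)
      subgoal by (rule I) (auto simp: P compose_def dest!: D simp: H)
      subgoal by (rule I) (auto simp: P)
      by (rule extensionalityI[of _ "carrier M"], auto simp: P compose_def dest!: D simp: H)+
    by (rule extensionalityI[of _ "carrier M"], auto simp: P compose_def dest!: D simp: H)+
qed

lemma fg_module_embeds:
  fixes M :: "('a, 'm) module"
  assumes "fg_module R M"
  obtains j :: "'m \<Rightarrow> 'a list set" where "inj_on j (carrier M)"
proof -
    obtain A where A: "finite A" "A \<subseteq> carrier M"
      "\<forall>x\<in>carrier M. \<exists>c. c \<in> A \<rightarrow> carrier R \<and> x = (\<Oplus>\<^bsub>M\<^esub>a\<in>A. c a \<odot>\<^bsub>M\<^esub> a)"
      using assms by (auto simp: fg_module_def)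
    interpret left_module R M using assms by (simp add: fg_module_def)
    obtain as where as: "set as = A" using A(1) finite_list by blast
    define j where "j x = {map c as | c. c \<in> A \<rightarrow> carrier R \<and> x = (\<Oplus>\<^bsub>M\<^esub>a\<in>A. c a \<odot>\<^bsub>M\<^esub> a)}" for x
    have "inj_on j (carrier M)"
    proof (rule inj_onI)
      fix x y assume x: "x \<in> carrier M" and "j x = j y"
      obtain c where c: "c \<in> A \<rightarrow> carrier R" "x = (\<Oplus>\<^bsub>M\<^esub>a\<in>A. c a \<odot>\<^bsub>M\<^esub> a)" using A(3) x by blast
      then have "map c as \<in> j y" using \<open>j x = j y\<close> unfolding j_def by blast
      then obtain c' where c': "map c as = map c' as" "c' \<in> A \<rightarrow> carrier R" "y = (\<Oplus>\<^bsub>M\<^esub>a\<in>A. c' a \<odot>\<^bsub>M\<^esub> a)" 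
        unfolding j_def by blast
      then have "\<forall>a\<in>A. c a = c' a" using as by (simp add: map_eq_conv)
      then show "x = y" unfolding c(2) c'(3) using A(2) c c' by (intro M.finsum_cong') (auto simp: Pi_iff)
    qed
    then show thesis by (rule that)
qed

lemma left_module_hom_finsum:
  assumes "left_module R M" "left_module R N" "f \<in> left_module_hom R M N" "finite A" "g \<in> A \<rightarrow> carrier M"
  shows "f (\<Oplus>\<^bsub>M\<^esub>a\<in>A. g a) = (\<Oplus>\<^bsub>N\<^esub>a\<in>A. f (g a))"
proof -
  interpret M: left_module R M by fact
  interpret N: left_module R N by fact
  have h: "f \<in> hom (add_monoid M) (add_monoid N)" using assms(3) by (simp add: left_module_hom_def)
  interpret group_hom "add_monoid M" "add_monoid N" f
    using h M.add.is_group N.add.is_group by (simp add: group_hom_def group_hom_axioms_def)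
  have c: "x \<in> carrier M \<Longrightarrow> f x \<in> carrier N" for x using h by (auto simp: hom_def)
  have add: "x \<in> carrier M \<Longrightarrow> y \<in> carrier M \<Longrightarrow> f (x \<oplus>\<^bsub>M\<^esub> y) = f x \<oplus>\<^bsub>N\<^esub> f y" for x y using h by (auto simp: hom_def)
  have z: "f \<zero>\<^bsub>M\<^esub> = \<zero>\<^bsub>N\<^esub>" using hom_one by simp
  show ?thesis using assms(4,5)
  proof (induction A)
    case empty then show ?case by (simp add: z)
  next
    case (insert a A)
    then show ?case using c by (auto simp: M.M.finsum_insert N.M.finsum_insert Pi_iff add M.M.finsum_closed)
  qed
qed

lemma fg_module_isomorphic_fgmod:
  fixes M :: "('a, 'm) module"
  assumes "fg_module R M"
  obtains N :: "'a fgmod" where "fg_module R N" "module_isomorphic R M N"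
proof -
  interpret left_module R M using assms by (simp add: fg_module_def)
  obtain j :: "'m \<Rightarrow> 'a list set" where j: "inj_on j (carrier M)" using fg_module_embeds[OF assms] .
  define k where "k = inv_into (carrier M) j"
  have k: "k (j x) = x" if "x \<in> carrier M" for x using that j by (simp add: k_def)
  define N :: "'a fgmod" where "N = \<lparr>carrier = j ` carrier M, mult = undefined, one = undefined,
    zero = j \<zero>\<^bsub>M\<^esub>, add = (\<lambda>x y. j (k x \<oplus>\<^bsub>M\<^esub> k y)), smult = (\<lambda>r x. j (r \<odot>\<^bsub>M\<^esub> k x))\<rparr>"
  have LN: "left_module R N"
    apply (intro left_module.intro left_module_axioms.intro)
        apply (rule R.ring_axioms)
       apply (rule abelian_groupI)
    subgoal by (auto simp: N_def k)
    subgoal by (auto simp: N_def k)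
    subgoal by (auto simp: N_def k M.a_ac)
    subgoal by (auto simp: N_def k M.a_ac)
    subgoal by (auto simp: N_def k)
    subgoal for x by (rule bexI[of _ "j (\<ominus>\<^bsub>M\<^esub> k x)"]) (auto simp: N_def k M.l_neg)
    by (auto simp: N_def k smult_l_distr smult_r_distr smult_assoc)
  have jh: "j \<in> left_module_hom R M N" by (auto simp: left_module_hom_def hom_def N_def k)
  obtain A where A: "finite A" "A \<subseteq> carrier M"
      "\<forall>x\<in>carrier M. \<exists>c. c \<in> A \<rightarrow> carrier R \<and> x = (\<Oplus>\<^bsub>M\<^esub>a\<in>A. c a \<odot>\<^bsub>M\<^esub> a)"
    using assms by (auto simp: fg_module_def)
  interpret N: left_module R N by fact
  have "fg_module R N" unfolding fg_module_def
  proof (intro conjI exI[of _ "j ` A"] LN ballI)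
    fix y assume "y \<in> carrier N"
    then obtain x where x: "x \<in> carrier M" "y = j x" by (auto simp: N_def)
    then obtain c where c: "c \<in> A \<rightarrow> carrier R" "x = (\<Oplus>\<^bsub>M\<^esub>a\<in>A. c a \<odot>\<^bsub>M\<^esub> a)" using A(3) by blast
    have jA: "inj_on j A" using j A(2) inj_on_subset by blast
    have "y = (\<Oplus>\<^bsub>N\<^esub>a\<in>A. j (c a \<odot>\<^bsub>M\<^esub> a))"
      unfolding x(2) c(2) by (rule left_module_hom_finsum[OF left_module_axioms LN jh A(1)]) (use c A in auto)
    also have "\<dots> = (\<Oplus>\<^bsub>N\<^esub>a\<in>A. c (k (j a)) \<odot>\<^bsub>N\<^esub> j a)"
      by (rule N.M.finsum_cong') (use A(2) c in \<open>auto simp: N_def k subset_iff Pi_iff\<close>)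
    also have "\<dots> = (\<Oplus>\<^bsub>N\<^esub>b\<in>j ` A. c (k b) \<odot>\<^bsub>N\<^esub> b)"
      by (rule N.M.finsum_reindex[symmetric, OF _ jA]) (use A(2) c in \<open>auto simp: N_def k subset_iff Pi_iff\<close>)
    finally show "\<exists>c. c \<in> j ` A \<rightarrow> carrier R \<and> y = (\<Oplus>\<^bsub>N\<^esub>a\<in>j ` A. c a \<odot>\<^bsub>N\<^esub> a)"
      using c A(2) by (intro exI[of _ "\<lambda>b. c (k b)"]) (auto simp: k subset_iff Pi_iff)
  qed (use A in \<open>auto simp: N_def\<close>)
  moreover have "module_isomorphic R M N"
    unfolding module_isomorphic_def mono_hom_def epi_hom_def using j jh by (auto simp: N_def)
  ultimately show thesis by (rule that)
qed

end

theory Submission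
  imports Defs
begin

text \<open>Write \<open>B\<close> for the opposite endomorphism ring of \<open>T\<close> and let \<open>n\<close> be the global dimension of the artin
  algebra, which may be assumed finite. A module \<open>Y\<close> generated by \<open>T\<close> is a quotient of a
  projective-injective module, whence \<open>Ext\<^sup>n(_, Y) = 0\<close> for \<open>n \<ge> 1\<close>: a homomorphism from the last syzygy of
  a projective resolution of length \<open>n\<close> to \<open>Y\<close> lifts to that module and then extends. The first syzygy
  of a \<open>B\<close>-module has the form \<open>Hom(T, X)\<close> with \<open>X\<close> generated by \<open>T\<close>. Kernels of right approximations
  by powers of \<open>T\<close> are again generated by \<open>T\<close>, and by dimension shifting the vanishing of
  \<open>Ext\<^sup>n(X, Y)\<close> for all \<open>Y\<close> generated by \<open>T\<close> makes such a resolution of \<open>X\<close> split after \<open>n - 1\<close>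
  steps. As \<open>Hom(T, _)\<close> turns it into a projective resolution, \<open>Hom(T, X)\<close> has projective dimension
  at most \<open>n - 1\<close>. For \<open>n = 0\<close> all sequences split.\<close>

section \<open>Modules and homomorphisms\<close>

text \<open>For any tilting module of projective dimension at most one, such an argument gives
  \<open>gldim R + 1\<close>: vanishing of Ext^(n+1) bounds the first syzygy of a
  \<open>B\<close>-module by n, and the syzygy itself costs one. The loss is recovered in the top
  degree n, where Ext^n(_, Y) is right exact in Y, so that its vanishing passes from injective
  modules to their quotients.

  The syzygy is the image of a map Hom(T, V) -> Hom(T, W) between powers V, W of T, induced by some
  g. It is Hom(T, V) modulo Hom(T, ker g), but ker g need not be generated by T. The trace S of T in
  ker g receives the same maps from T, and Ext^1(T, S) = 0, so the quotient is Hom(T, V/S). The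
  sequence 0 -> R -> T0 -> T1 -> 0 gives a converse: a module Y with Ext^1(T, Y) = 0 is generated by
  T, which keeps kernels of approximations in the class.

  Ext is never formed as a group; only its vanishing occurs, as the extension of homomorphisms from
  syzygies.\<close>

abbreviation Hom :: "('a, 'x) ring_scheme \<Rightarrow> ('a, 'm) module \<Rightarrow> ('a, 'n) module \<Rightarrow> ('m \<Rightarrow> 'n) set" where
  "Hom \<equiv> left_module_hom"

lemma left_moduleD:
  assumes "left_module R M"
  shows "ring R" "abelian_group M" "abelian_monoid M"
  using assms by (auto simp: left_module_def abelian_group_def)

lemma fg_moduleD: "fg_module R M \<Longrightarrow> left_module R M"
  by (simp add: fg_module_def)

section \<open>Differences in abelian groups and modules\<close>

context abelian_group
begin

lemma minus_add_cancel: "\<lbrakk>x \<in> carrier G; y \<in> carrier G\<rbrakk> \<Longrightarrow> (x \<ominus> y) \<oplus> y = x"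
  by (simp add: a_minus_def a_assoc l_neg)

lemma add_minus_cancel_right: "\<lbrakk>x \<in> carrier G; y \<in> carrier G\<rbrakk> \<Longrightarrow> (x \<oplus> y) \<ominus> y = x"
  by (simp add: a_minus_def a_assoc r_neg)

lemma add_minus_cancel_left: "\<lbrakk>x \<in> carrier G; y \<in> carrier G\<rbrakk> \<Longrightarrow> (y \<oplus> x) \<ominus> y = x"
  by (simp add: a_comm add_minus_cancel_right)

lemma minus_self: "x \<in> carrier G \<Longrightarrow> x \<ominus> x = \<zero>"
  by (simp add: a_minus_def r_neg)

lemma minus_zero_right: "x \<in> carrier G \<Longrightarrow> x \<ominus> \<zero> = x"
  by (simp add: a_minus_def)

lemma minus_eq_zeroD: "\<lbrakk>x \<ominus> y = \<zero>; x \<in> carrier G; y \<in> carrier G\<rbrakk> \<Longrightarrow> x = y"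
  using minus_add_cancel by fastforce

lemma add_diff_add:
  "\<lbrakk>a \<in> carrier G; b \<in> carrier G; c \<in> carrier G; d \<in> carrier G\<rbrakk> \<Longrightarrow>
    (a \<oplus> b) \<ominus> (c \<oplus> d) = (a \<ominus> c) \<oplus> (b \<ominus> d)"
  by (simp add: a_minus_def minus_add a_ac)

end

context left_module
begin

lemma smult_zero_right: "r \<in> carrier R \<Longrightarrow> r \<odot>\<^bsub>M\<^esub> \<zero>\<^bsub>M\<^esub> = \<zero>\<^bsub>M\<^esub>"
  by (metis M.add.r_cancel_one' M.zero_closed smult_closed smult_r_distr M.l_zero)

lemma smult_zero_left: "x \<in> carrier M \<Longrightarrow> \<zero> \<odot>\<^bsub>M\<^esub> x = \<zero>\<^bsub>M\<^esub>"
  by (metis M.add.r_cancel_one' R.zero_closed smult_closed smult_l_distr R.l_zero)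

lemma smult_uminus: "\<lbrakk>r \<in> carrier R; x \<in> carrier M\<rbrakk> \<Longrightarrow> r \<odot>\<^bsub>M\<^esub> (\<ominus>\<^bsub>M\<^esub> x) = \<ominus>\<^bsub>M\<^esub> (r \<odot>\<^bsub>M\<^esub> x)"
  by (metis M.add.inv_closed M.l_neg M.minus_equality smult_closed smult_r_distr smult_zero_right)

lemma smult_minus: "\<lbrakk>r \<in> carrier R; x \<in> carrier M; y \<in> carrier M\<rbrakk> \<Longrightarrow>
    r \<odot>\<^bsub>M\<^esub> (x \<ominus>\<^bsub>M\<^esub> y) = r \<odot>\<^bsub>M\<^esub> x \<ominus>\<^bsub>M\<^esub> r \<odot>\<^bsub>M\<^esub> y"
  by (simp add: a_minus_def smult_r_distr smult_uminus)

lemma uminus_eq_smult: "x \<in> carrier M \<Longrightarrow> \<ominus>\<^bsub>M\<^esub> x = (\<ominus>\<^bsub>R\<^esub> \<one>) \<odot>\<^bsub>M\<^esub> x"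
  by (metis M.minus_equality R.add.inv_closed R.l_neg R.one_closed smult_closed smult_l_distr
      smult_one smult_zero_left)

end

section \<open>Submodules\<close>

lemma submoduleI':
  assumes "left_module R M" "S \<subseteq> carrier M" "\<zero>\<^bsub>M\<^esub> \<in> S"
    and "\<And>x y. \<lbrakk>x \<in> S; y \<in> S\<rbrakk> \<Longrightarrow> x \<oplus>\<^bsub>M\<^esub> y \<in> S"
    and "\<And>r x. \<lbrakk>r \<in> carrier R; x \<in> S\<rbrakk> \<Longrightarrow> r \<odot>\<^bsub>M\<^esub> x \<in> S"
  shows "submodule S R M"
proof -
  interpret left_module R M by fact
  have "\<ominus>\<^bsub>M\<^esub> x \<in> S" if "x \<in> S" for x
    using that assms(2,5) uminus_eq_smult[of x] by auto
  then show ?thesis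
    unfolding submodule_def submodule_axioms_def subgroup_def
    using assms by (auto simp: a_inv_def)
qed

lemma submoduleD:
  assumes "submodule S R M"
  shows "S \<subseteq> carrier M" "\<zero>\<^bsub>M\<^esub> \<in> S" "\<lbrakk>x \<in> S; y \<in> S\<rbrakk> \<Longrightarrow> x \<oplus>\<^bsub>M\<^esub> y \<in> S"
    "\<lbrakk>r \<in> carrier R; x \<in> S\<rbrakk> \<Longrightarrow> r \<odot>\<^bsub>M\<^esub> x \<in> S" "x \<in> S \<Longrightarrow> \<ominus>\<^bsub>M\<^esub> x \<in> S"
    "\<lbrakk>x \<in> S; y \<in> S\<rbrakk> \<Longrightarrow> x \<ominus>\<^bsub>M\<^esub> y \<in> S"
  using assms unfolding submodule_def submodule_axioms_def subgroup_def
  by (auto simp: a_inv_def a_minus_def)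

lemma submodule_carrier: "left_module R M \<Longrightarrow> submodule (carrier M) R M"
  by (rule submoduleI') (auto simp: left_module.smult_closed abelian_monoid.zero_closed
      abelian_monoid.a_closed left_moduleD)

lemma submodule_inter: "submodule S R M \<Longrightarrow> submodule S' R M \<Longrightarrow> submodule (S \<inter> S') R M"
  unfolding submodule_def submodule_axioms_def subgroup_def by auto

lemma left_module_sub:
  assumes "left_module R M" "submodule S R M"
  shows "left_module R (M\<lparr>carrier := S\<rparr>)"
proof -
  interpret left_module R M by fact
  note S = submoduleD[OF assms(2)]
  show ?thesis
    apply (intro left_module.intro left_module_axioms.intro)
        apply (rule R.ring_axioms)
       apply (rule abelian_groupI)
    subgoal using S by auto
    subgoal using S by auto
    subgoal using S(1) by (auto simp: subset_iff M.a_ac)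
    subgoal using S(1) by (auto simp: subset_iff M.a_ac)
    subgoal using S(1) by (auto simp: subset_iff)
    subgoal for x by (rule bexI[of _ "\<ominus>\<^bsub>M\<^esub> x"]) (use S in \<open>auto simp: subset_iff M.l_neg\<close>)
    using S(1,4) by (auto simp: subset_iff smult_l_distr smult_r_distr smult_assoc)
qed

lemma submodule_of_sub:
  assumes "submodule S R M" "U \<subseteq> S" "left_module R M"
  shows "submodule U R (M\<lparr>carrier := S\<rparr>) \<longleftrightarrow> submodule U R M"
proof
  assume "submodule U R (M\<lparr>carrier := S\<rparr>)"
  from submoduleD[OF this] show "submodule U R M"
    using submoduleD(1)[OF assms(1)] assms(2,3) by (intro submoduleI') auto
next
  assume "submodule U R M"
  from submoduleD[OF this] show "submodule U R (M\<lparr>carrier := S\<rparr>)"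
    using left_module_sub[OF assms(3,1)] assms(2) by (intro submoduleI') auto
qed

section \<open>Homomorphisms, images and kernels\<close>

lemma HomI:
  assumes "\<And>x. x \<in> carrier M \<Longrightarrow> f x \<in> carrier N"
    "\<And>x y. \<lbrakk>x \<in> carrier M; y \<in> carrier M\<rbrakk> \<Longrightarrow> f (x \<oplus>\<^bsub>M\<^esub> y) = f x \<oplus>\<^bsub>N\<^esub> f y"
    "\<And>r x. \<lbrakk>r \<in> carrier R; x \<in> carrier M\<rbrakk> \<Longrightarrow> f (r \<odot>\<^bsub>M\<^esub> x) = r \<odot>\<^bsub>N\<^esub> f x"
  shows "f \<in> Hom R M N"
  using assms by (auto simp: left_module_hom_def hom_def)

lemma HomD:
  assumes "f \<in> Hom R M N"
  shows "x \<in> carrier M \<Longrightarrow> f x \<in> carrier N"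
    "\<lbrakk>x \<in> carrier M; y \<in> carrier M\<rbrakk> \<Longrightarrow> f (x \<oplus>\<^bsub>M\<^esub> y) = f x \<oplus>\<^bsub>N\<^esub> f y"
    "\<lbrakk>r \<in> carrier R; x \<in> carrier M\<rbrakk> \<Longrightarrow> f (r \<odot>\<^bsub>M\<^esub> x) = r \<odot>\<^bsub>N\<^esub> f x"
  using assms by (auto simp: left_module_hom_def hom_def)

lemma
  assumes "f \<in> Hom R M N" "left_module R M" "left_module R N"
  shows Hom_zero: "f \<zero>\<^bsub>M\<^esub> = \<zero>\<^bsub>N\<^esub>"
    and Hom_minus: "\<lbrakk>x \<in> carrier M; y \<in> carrier M\<rbrakk> \<Longrightarrow> f (x \<ominus>\<^bsub>M\<^esub> y) = f x \<ominus>\<^bsub>N\<^esub> f y"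
proof -
  interpret M: left_module R M by fact
  interpret N: left_module R N by fact
  note f = HomD[OF assms(1)]
  show z: "f \<zero>\<^bsub>M\<^esub> = \<zero>\<^bsub>N\<^esub>"
    by (metis M.M.zero_closed M.M.l_zero N.M.add.r_cancel_one' f(1,2))
  have u: "f (\<ominus>\<^bsub>M\<^esub> x) = \<ominus>\<^bsub>N\<^esub> f x" if "x \<in> carrier M" for x
    by (metis M.M.add.inv_closed M.M.l_neg N.M.minus_equality f(1,2) that z)
  show "\<lbrakk>x \<in> carrier M; y \<in> carrier M\<rbrakk> \<Longrightarrow> f (x \<ominus>\<^bsub>M\<^esub> y) = f x \<ominus>\<^bsub>N\<^esub> f y"
    by (simp add: a_minus_def f u)
qed

text \<open>Only the values on the carrier matter. This is needed whenever a map is replaced by its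
  restriction.\<close>

lemma Hom_cong: "\<lbrakk>f \<in> Hom R M N; \<And>x. x \<in> carrier M \<Longrightarrow> g x = f x; left_module R M\<rbrakk> \<Longrightarrow> g \<in> Hom R M N"
  by (rule HomI)
    (simp_all add: HomD left_module.smult_closed abelian_monoid.a_closed left_moduleD)

lemma Hom_id: "(\<lambda>x. x) \<in> Hom R M M"
  by (rule HomI) auto

lemma Hom_comp: "\<lbrakk>f \<in> Hom R M N; g \<in> Hom R N P\<rbrakk> \<Longrightarrow> (\<lambda>x. g (f x)) \<in> Hom R M P"
  by (rule HomI) (auto simp: HomD)

lemma Hom_const_zero: "left_module R N \<Longrightarrow> (\<lambda>x. \<zero>\<^bsub>N\<^esub>) \<in> Hom R M N"
  by (rule HomI) (auto simp: left_module.smult_zero_right abelian_monoid.zero_closed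
      abelian_monoid.l_zero left_moduleD)

lemma Hom_plus:
  assumes "left_module R N" "f \<in> Hom R M N" "g \<in> Hom R M N"
  shows "(\<lambda>x. f x \<oplus>\<^bsub>N\<^esub> g x) \<in> Hom R M N"
proof -
  interpret left_module R N by fact
  show ?thesis using HomD[OF assms(2)] HomD[OF assms(3)]
    by (intro HomI) (auto simp: M.a_ac smult_r_distr)
qed

lemma Hom_diff:
  assumes "left_module R N" "f \<in> Hom R M N" "g \<in> Hom R M N"
  shows "(\<lambda>x. f x \<ominus>\<^bsub>N\<^esub> g x) \<in> Hom R M N"
proof -
  interpret left_module R N by fact
  show ?thesis using HomD[OF assms(2)] HomD[OF assms(3)]
    by (intro HomI) (auto simp: M.add_diff_add smult_minus)
qed

lemma Hom_finsum:
  assumes "left_module R N" "finite A" "\<And>a. a \<in> A \<Longrightarrow> f a \<in> Hom R M N" "left_module R M"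
  shows "(\<lambda>x. \<Oplus>\<^bsub>N\<^esub>a\<in>A. f a x) \<in> Hom R M N"
  using assms(2,3)
proof (induction A)
  case empty
  interpret left_module R N by fact
  show ?case using Hom_const_zero[OF assms(1)] by simp
next
  case (insert a A)
  interpret left_module R N by fact
  have "(\<lambda>x. f a x \<oplus>\<^bsub>N\<^esub> (\<Oplus>\<^bsub>N\<^esub>a\<in>A. f a x)) \<in> Hom R M N"
    using insert by (intro Hom_plus[OF assms(1)]) auto
  then show ?case
    by (rule Hom_cong[OF _ _ assms(4)])
       (subst M.finsum_insert, use insert in \<open>auto dest: HomD(1)\<close>)
qed

lemma Hom_sub: "\<lbrakk>f \<in> Hom R M N; S \<subseteq> carrier M\<rbrakk> \<Longrightarrow> f \<in> Hom R (M\<lparr>carrier := S\<rparr>) N"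
  by (rule HomI) (auto dest: HomD simp: subset_iff)

lemma Hom_into_sub:
  "\<lbrakk>f \<in> Hom R M N; \<And>x. x \<in> carrier M \<Longrightarrow> f x \<in> S\<rbrakk> \<Longrightarrow> f \<in> Hom R M (N\<lparr>carrier := S\<rparr>)"
  by (rule HomI) (auto dest: HomD)

lemma Hom_from_sub:
  "\<lbrakk>f \<in> Hom R M (N\<lparr>carrier := S\<rparr>); S \<subseteq> carrier N\<rbrakk> \<Longrightarrow> f \<in> Hom R M N"
  by (rule HomI) (auto dest: HomD simp: subset_iff)

lemma Hom_incl: "S \<subseteq> carrier M \<Longrightarrow> (\<lambda>x. x) \<in> Hom R (M\<lparr>carrier := S\<rparr>) M"
  by (rule HomI) auto

lemma epi_homD:
  assumes "p \<in> epi_hom R M N"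
  shows "p \<in> Hom R M N" "y \<in> carrier N \<Longrightarrow> \<exists>x\<in>carrier M. p x = y"
  using assms by (force simp: epi_hom_def)+

lemma epi_homI:
  assumes "p \<in> Hom R M N" "\<And>y. y \<in> carrier N \<Longrightarrow> \<exists>x\<in>carrier M. p x = y"
  shows "p \<in> epi_hom R M N"
  using assms unfolding epi_hom_def by (auto dest: HomD(1) simp: image_iff)

lemma epi_comp: "\<lbrakk>p \<in> epi_hom R M N; q \<in> epi_hom R N P\<rbrakk> \<Longrightarrow> (\<lambda>x. q (p x)) \<in> epi_hom R M P"
  by (auto simp: epi_hom_def image_image[symmetric] intro: Hom_comp simp del: image_image)

lemma submodule_image:
  assumes "left_module R M" "left_module R N" "f \<in> Hom R M N" "submodule S R M"
  shows "submodule (f ` S) R N"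
proof (rule submoduleI'[OF assms(2)])
  note S = submoduleD[OF assms(4)] and f = HomD[OF assms(3)]
  show "f ` S \<subseteq> carrier N" using S f by auto
  show "\<zero>\<^bsub>N\<^esub> \<in> f ` S"
    using Hom_zero[OF assms(3,1,2), symmetric] S(2) by (rule image_eqI)
  show "x \<oplus>\<^bsub>N\<^esub> y \<in> f ` S" if xy: "x \<in> f ` S" "y \<in> f ` S" for x y
  proof -
    obtain a b where "a \<in> S" "b \<in> S" "x = f a" "y = f b" using xy by blast
    then show ?thesis using S(1) by (intro image_eqI[of _ _ "a \<oplus>\<^bsub>M\<^esub> b"] S(3)) (auto simp: f(2) subset_iff)
  qed
  show "r \<odot>\<^bsub>N\<^esub> x \<in> f ` S" if r: "r \<in> carrier R" "x \<in> f ` S" for r x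
  proof -
    obtain a where "a \<in> S" "x = f a" using r by blast
    then show ?thesis using r S(1) by (intro image_eqI[of _ _ "r \<odot>\<^bsub>M\<^esub> a"] S(4)) (auto simp: f(3) subset_iff)
  qed
qed

lemma submodule_vimage:
  assumes "left_module R M" "left_module R N" "f \<in> Hom R M N" "submodule S R N"
  shows "submodule {x \<in> carrier M. f x \<in> S} R M"
proof (rule submoduleI'[OF assms(1)])
  interpret M: left_module R M by fact
  note S = submoduleD[OF assms(4)] and f = HomD[OF assms(3)]
  show "\<zero>\<^bsub>M\<^esub> \<in> {x \<in> carrier M. f x \<in> S}" using Hom_zero[OF assms(3,1,2)] S(2) by simp
qed (use submoduleD[OF assms(4)] HomD[OF assms(3)] assms(1) in
  \<open>auto simp: left_module.smult_closed abelian_monoid.a_closed left_moduleD\<close>)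

lemma submodule_zero: "left_module R M \<Longrightarrow> submodule {\<zero>\<^bsub>M\<^esub>} R M"
  by (rule submoduleI') (auto simp: left_module.smult_zero_right abelian_monoid.zero_closed
      abelian_monoid.l_zero left_moduleD)

lemma submodule_kernel:
  assumes "left_module R M" "left_module R N" "f \<in> Hom R M N"
  shows "submodule (a_kernel M N f) R M"
  using submodule_vimage[OF assms submodule_zero[OF assms(2)]] by (simp add: a_kernel_def')

section \<open>Inverses, factorisation through epimorphisms, quotient modules\<close>

lemma Hom_inv:
  assumes "left_module R M" "f \<in> Hom R M N" "inj_on f (carrier M)" "f ` carrier M = carrier N"
  obtains g where "g \<in> Hom R N M" "\<And>x. x \<in> carrier M \<Longrightarrow> g (f x) = x"
    "\<And>y. y \<in> carrier N \<Longrightarrow> f (g y) = y"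
proof
  interpret left_module R M by fact
  let ?g = "inv_into (carrier M) f"
  show gf: "?g (f x) = x" if "x \<in> carrier M" for x using that assms(3) by simp
  show fg: "f (?g y) = y" if "y \<in> carrier N" for y using that assms(4) by (simp add: f_inv_into_f)
  have gc: "?g y \<in> carrier M" if "y \<in> carrier N" for y using that assms(4) by (simp add: inv_into_into)
  show "?g \<in> Hom R N M"
  proof (rule HomI)
    show "?g (x \<oplus>\<^bsub>N\<^esub> y) = ?g x \<oplus>\<^bsub>M\<^esub> ?g y" if "x \<in> carrier N" "y \<in> carrier N" for x y
      using gf[of "?g x \<oplus>\<^bsub>M\<^esub> ?g y"] that gc fg HomD(2)[OF assms(2)] by simp
    show "?g (r \<odot>\<^bsub>N\<^esub> x) = r \<odot>\<^bsub>M\<^esub> ?g x" if "r \<in> carrier R" "x \<in> carrier N" for r x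
      using gf[of "r \<odot>\<^bsub>M\<^esub> ?g x"] that gc fg HomD(3)[OF assms(2)] by simp
  qed (use gc in auto)
qed

text \<open>Two preimages of an element differ by an element of the kernel, on which
  \<open>f\<close> vanishes. So the composition of \<open>f\<close> with a set-theoretic section of
  \<open>p\<close> does not depend on the section, and is therefore linear.\<close>

lemma Hom_factor:
  assumes "left_module R P" "left_module R X" "left_module R Z"
    and p: "p \<in> epi_hom R P X" and f: "f \<in> Hom R P Z"
    and k: "\<And>x. \<lbrakk>x \<in> carrier P; p x = \<zero>\<^bsub>X\<^esub>\<rbrakk> \<Longrightarrow> f x = \<zero>\<^bsub>Z\<^esub>"
  obtains g where "g \<in> Hom R X Z" "\<And>x. x \<in> carrier P \<Longrightarrow> g (p x) = f x"
proof -
  interpret P: left_module R P by fact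
  interpret X: left_module R X by fact
  interpret Z: left_module R Z by fact
  note p' = HomD[OF epi_homD(1)[OF p]] and f' = HomD[OF f]
  define s where "s y = (SOME x. x \<in> carrier P \<and> p x = y)" for y
  have s: "s y \<in> carrier P" "p (s y) = y" if "y \<in> carrier X" for y
    using someI_ex[of "\<lambda>x. x \<in> carrier P \<and> p x = y"] epi_homD(2)[OF p that] by (auto simp: s_def)
  have eq: "f x = f x'" if "x \<in> carrier P" "x' \<in> carrier P" "p x = p x'" for x x'
  proof -
    have "p (x \<ominus>\<^bsub>P\<^esub> x') = \<zero>\<^bsub>X\<^esub>"
      using that p' by (simp add: Hom_minus[OF epi_homD(1)[OF p] assms(1,2)] X.M.minus_self)
    then have "f x \<ominus>\<^bsub>Z\<^esub> f x' = \<zero>\<^bsub>Z\<^esub>" using k that by (simp add: Hom_minus[OF f assms(1,3), symmetric])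
    then show ?thesis using Z.M.minus_eq_zeroD that f' by blast
  qed
  have g: "f (s (p x)) = f x" if "x \<in> carrier P" for x
    by (rule eq) (use that s p' in auto)
  have "(\<lambda>y. f (s y)) \<in> Hom R X Z"
  proof (rule HomI)
    show "f (s (x \<oplus>\<^bsub>X\<^esub> y)) = f (s x) \<oplus>\<^bsub>Z\<^esub> f (s y)" if "x \<in> carrier X" "y \<in> carrier X" for x y
      using g[of "s x \<oplus>\<^bsub>P\<^esub> s y"] that s p' f' by simp
    show "f (s (r \<odot>\<^bsub>X\<^esub> x)) = r \<odot>\<^bsub>Z\<^esub> f (s x)" if "r \<in> carrier R" "x \<in> carrier X" for r x
      using g[of "r \<odot>\<^bsub>P\<^esub> s x"] that s p' f' by simp
  qed (use s f' in auto)
  from this g show thesis by (rule that)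
qed

text \<open>Transport of structure: the two compatibility assumptions say that the fibres of
  \<open>q\<close> form a congruence, so sums and multiples may be computed on any representatives.
  The application is the map to cosets.\<close>

lemma image_module:
  fixes q :: "'m \<Rightarrow> 'n" and M :: "('a, 'm) module"
  assumes "left_module R M"
    and a: "\<And>x x' y y'. \<lbrakk>x \<in> carrier M; x' \<in> carrier M; y \<in> carrier M; y' \<in> carrier M; q x = q x'; q y = q y'\<rbrakk>
      \<Longrightarrow> q (x \<oplus>\<^bsub>M\<^esub> y) = q (x' \<oplus>\<^bsub>M\<^esub> y')"
    and s: "\<And>r x x'. \<lbrakk>r \<in> carrier R; x \<in> carrier M; x' \<in> carrier M; q x = q x'\<rbrakk>
      \<Longrightarrow> q (r \<odot>\<^bsub>M\<^esub> x) = q (r \<odot>\<^bsub>M\<^esub> x')"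
  obtains N :: "('a, 'n) module" where "left_module R N" "q \<in> epi_hom R M N" "\<zero>\<^bsub>N\<^esub> = q \<zero>\<^bsub>M\<^esub>"
proof -
  interpret left_module R M by fact
  define k where "k = inv_into (carrier M) q"
  have k: "k (q x) \<in> carrier M" "q (k (q x)) = q x" if "x \<in> carrier M" for x
    using that by (auto simp: k_def inv_into_into f_inv_into_f)
  define N :: "('a, 'n) module" where "N = \<lparr>carrier = q ` carrier M, mult = undefined, one = undefined,
    zero = q \<zero>\<^bsub>M\<^esub>, add = (\<lambda>x y. q (k x \<oplus>\<^bsub>M\<^esub> k y)), smult = (\<lambda>r x. q (r \<odot>\<^bsub>M\<^esub> k x))\<rparr>"
  have add: "q x \<oplus>\<^bsub>N\<^esub> q y = q (x \<oplus>\<^bsub>M\<^esub> y)" if "x \<in> carrier M" "y \<in> carrier M" for x y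
    using that k by (auto simp: N_def intro!: a)
  have smu: "r \<odot>\<^bsub>N\<^esub> q x = q (r \<odot>\<^bsub>M\<^esub> x)" if "r \<in> carrier R" "x \<in> carrier M" for r x
    using that k by (auto simp: N_def intro!: s)
  have c: "carrier N = q ` carrier M" and z: "\<zero>\<^bsub>N\<^esub> = q \<zero>\<^bsub>M\<^esub>" by (auto simp: N_def)
  have neg: "\<exists>y\<in>carrier N. y \<oplus>\<^bsub>N\<^esub> x = \<zero>\<^bsub>N\<^esub>" if x: "x \<in> carrier N" for x
  proof -
    obtain y where "y \<in> carrier M" "x = q y" using x c by blast
    then show ?thesis by (intro bexI[of _ "q (\<ominus>\<^bsub>M\<^esub> y)"]) (auto simp: c z add M.l_neg)
  qed
  have "left_module R N"
    apply (intro left_module.intro left_module_axioms.intro)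
        apply (rule R.ring_axioms)
       apply (rule abelian_groupI)
    subgoal by (auto simp: c add)
    subgoal by (auto simp: c z)
    subgoal by (auto simp: c add M.a_ac)
    subgoal by (auto simp: c add M.a_comm)
    subgoal by (auto simp: c z add)
    subgoal by (rule neg)
    by (auto simp: c add smu smult_l_distr smult_r_distr smult_assoc)
  moreover have "q \<in> epi_hom R M N"
    by (rule epi_homI, rule HomI) (auto simp: c add smu)
  ultimately show thesis using z by (rule that)
qed

lemma quotient_module:
  fixes M :: "('a, 'm) module"
  assumes "left_module R M" "submodule S R M"
  obtains N :: "('a, 'm set) module" and q where "left_module R N" "q \<in> epi_hom R M N" "a_kernel M N q = S"
proof -
  interpret left_module R M by fact
  note S = submoduleD[OF assms(2)]
  \<comment> \<open>The coset of \<open>x\<close>; the quotient therefore lives on the type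
    \<open>'m set\<close>.\<close>
  define q where "q x = {y \<in> carrier M. y \<ominus>\<^bsub>M\<^esub> x \<in> S}" for x
  have refl: "x \<in> q x" if "x \<in> carrier M" for x using that S by (simp add: q_def M.minus_self)
  have sum: "y \<ominus>\<^bsub>M\<^esub> x' \<in> S" if "y \<ominus>\<^bsub>M\<^esub> x \<in> S" "x \<ominus>\<^bsub>M\<^esub> x' \<in> S"
    "x \<in> carrier M" "x' \<in> carrier M" "y \<in> carrier M" for x x' y
  proof -
    have "y \<ominus>\<^bsub>M\<^esub> x' = (y \<ominus>\<^bsub>M\<^esub> x) \<oplus>\<^bsub>M\<^esub> (x \<ominus>\<^bsub>M\<^esub> x')"
      using that by (simp add: a_minus_def M.a_assoc M.r_neg1 M.r_neg2)
    with S(3)[OF that(1,2)] show ?thesis by simp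
  qed
  have sym: "x' \<ominus>\<^bsub>M\<^esub> x \<in> S" if "x \<ominus>\<^bsub>M\<^esub> x' \<in> S" "x \<in> carrier M" "x' \<in> carrier M" for x x'
    using S(5)[OF that(1)] that by (simp add: a_minus_def M.minus_add M.a_comm)
  have iff: "q x = q x' \<longleftrightarrow> x \<ominus>\<^bsub>M\<^esub> x' \<in> S" if "x \<in> carrier M" "x' \<in> carrier M" for x x'
  proof
    assume "q x = q x'"
    then have "x \<in> q x'" using refl[OF that(1)] by blast
    then show "x \<ominus>\<^bsub>M\<^esub> x' \<in> S" by (simp add: q_def)
  next
    assume d: "x \<ominus>\<^bsub>M\<^esub> x' \<in> S"
    show "q x = q x'" unfolding q_def
      using sum[OF _ d that] sum[OF _ sym[OF d that] that(2,1)] by blast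
  qed
  obtain N where N: "left_module R N" "q \<in> epi_hom R M N" "\<zero>\<^bsub>N\<^esub> = q \<zero>\<^bsub>M\<^esub>"
  proof (rule image_module[OF assms(1), of q])
    show "q (x \<oplus>\<^bsub>M\<^esub> y) = q (x' \<oplus>\<^bsub>M\<^esub> y')" if "x \<in> carrier M" "x' \<in> carrier M" "y \<in> carrier M" "y' \<in> carrier M"
      "q x = q x'" "q y = q y'" for x x' y y'
      using that S(3) by (simp add: iff M.add_diff_add)
    show "q (r \<odot>\<^bsub>M\<^esub> x) = q (r \<odot>\<^bsub>M\<^esub> x')" if "r \<in> carrier R" "x \<in> carrier M" "x' \<in> carrier M" "q x = q x'" for r x x'
      using that S(4) by (simp add: iff smult_minus[symmetric])
  qed
  moreover have "a_kernel M N q = S"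
  proof -
    have "q x = \<zero>\<^bsub>N\<^esub> \<longleftrightarrow> x \<in> S" if "x \<in> carrier M" for x
      using iff[OF that M.zero_closed] that by (simp add: N(3) M.minus_zero_right)
    then show ?thesis using S(1) by (auto simp: a_kernel_def')
  qed
  ultimately show thesis using that by blast
qed

section \<open>Finite generation and noetherian modules\<close>

text \<open>Generation is tested against submodules instead of linear combinations. In this form it
  passes at once to images, extensions and other base rings, and it makes sense for a subset of an
  ambient module.\<close>

definition fgen :: "('a, 'x) ring_scheme \<Rightarrow> ('a, 'm) module \<Rightarrow> 'm set \<Rightarrow> bool" where
  "fgen R M S \<longleftrightarrow> (\<exists>A. finite A \<and> A \<subseteq> S \<and> (\<forall>U. submodule U R M \<longrightarrow> A \<subseteq> U \<longrightarrow> S \<subseteq> U))"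

lemma submodule_finsum:
  assumes "left_module R M" "submodule U R M" "finite A" "\<And>a. a \<in> A \<Longrightarrow> f a \<in> U"
  shows "(\<Oplus>\<^bsub>M\<^esub>a\<in>A. f a) \<in> U"
  using assms(3,4)
proof (induction A)
  case empty
  interpret left_module R M by fact
  show ?case using submoduleD(2)[OF assms(2)] by simp
next
  case (insert a A)
  interpret left_module R M by fact
  note U = submoduleD[OF assms(2)]
  have "(\<Oplus>\<^bsub>M\<^esub>a\<in>insert a A. f a) = f a \<oplus>\<^bsub>M\<^esub> (\<Oplus>\<^bsub>M\<^esub>a\<in>A. f a)"
    using insert U(1) by (intro M.finsum_insert) (auto simp: subset_iff)
  then show ?case using insert by (simp add: U(3))
qed

lemma submodule_combinations:
  assumes "left_module R M" "finite A" "A \<subseteq> carrier M"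
  shows "submodule {(\<Oplus>\<^bsub>M\<^esub>a\<in>A. c a \<odot>\<^bsub>M\<^esub> a) | c. c \<in> A \<rightarrow> carrier R} R M"
proof (rule submoduleI'[OF assms(1)])
  interpret left_module R M by fact
  let ?s = "\<lambda>c. \<Oplus>\<^bsub>M\<^esub>a\<in>A. c a \<odot>\<^bsub>M\<^esub> a"
  have cl: "(\<lambda>a. c a \<odot>\<^bsub>M\<^esub> a) \<in> A \<rightarrow> carrier M" if "c \<in> A \<rightarrow> carrier R" for c
    using that assms(3) by (auto simp: Pi_iff)
  have mem: "x \<in> {?s c | c. c \<in> A \<rightarrow> carrier R} \<longleftrightarrow> (\<exists>c. c \<in> A \<rightarrow> carrier R \<and> x = ?s c)" for x
    by (simp add: conj_commute)
  show "{?s c | c. c \<in> A \<rightarrow> carrier R} \<subseteq> carrier M"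
    using M.finsum_closed[OF cl] by auto
  have "?s (\<lambda>_. \<zero>\<^bsub>R\<^esub>) = \<zero>\<^bsub>M\<^esub>"
    using assms(3) smult_zero_left by (intro M.add.finprod_one_eqI) auto
  then show "\<zero>\<^bsub>M\<^esub> \<in> {?s c | c. c \<in> A \<rightarrow> carrier R}"
    by (intro CollectI exI[of _ "\<lambda>_. \<zero>\<^bsub>R\<^esub>"]) auto
  show "x \<oplus>\<^bsub>M\<^esub> y \<in> {?s c | c. c \<in> A \<rightarrow> carrier R}"
    if xy: "x \<in> {?s c | c. c \<in> A \<rightarrow> carrier R}" "y \<in> {?s c | c. c \<in> A \<rightarrow> carrier R}" for x y
  proof -
    obtain c where c: "c \<in> A \<rightarrow> carrier R" "x = ?s c"
      using xy(1) unfolding mem by (elim exE conjE) (rule that)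
    obtain d where d: "d \<in> A \<rightarrow> carrier R" "y = ?s d"
      using xy(2) unfolding mem by (elim exE conjE) (rule that)
    have "?s (\<lambda>a. c a \<oplus>\<^bsub>R\<^esub> d a) = (\<Oplus>\<^bsub>M\<^esub>a\<in>A. c a \<odot>\<^bsub>M\<^esub> a \<oplus>\<^bsub>M\<^esub> d a \<odot>\<^bsub>M\<^esub> a)"
      using c(1) d(1) assms(3) by (intro M.finsum_cong') (auto simp: Pi_iff smult_l_distr subset_iff)
    also have "\<dots> = ?s c \<oplus>\<^bsub>M\<^esub> ?s d" by (rule M.finsum_addf[OF cl[OF c(1)] cl[OF d(1)]])
    finally have "x \<oplus>\<^bsub>M\<^esub> y = ?s (\<lambda>a. c a \<oplus>\<^bsub>R\<^esub> d a)" unfolding c(2) d(2) by (rule sym)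
    moreover have "(\<lambda>a. c a \<oplus>\<^bsub>R\<^esub> d a) \<in> A \<rightarrow> carrier R" using c(1) d(1) by (simp add: Pi_iff)
    ultimately show ?thesis unfolding mem by (intro exI conjI)
  qed
  show "r \<odot>\<^bsub>M\<^esub> x \<in> {?s c | c. c \<in> A \<rightarrow> carrier R}"
    if rx: "r \<in> carrier R" "x \<in> {?s c | c. c \<in> A \<rightarrow> carrier R}" for r x
  proof -
    obtain c where c: "c \<in> A \<rightarrow> carrier R" "x = ?s c" using rx(2) unfolding mem by (elim exE conjE) (rule that)
    have "r \<odot>\<^bsub>M\<^esub> (\<Oplus>\<^bsub>M\<^esub>a\<in>B. c a \<odot>\<^bsub>M\<^esub> a) = (\<Oplus>\<^bsub>M\<^esub>a\<in>B. (r \<otimes>\<^bsub>R\<^esub> c a) \<odot>\<^bsub>M\<^esub> a)"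
      if "finite B" "B \<subseteq> A" for B
      using that
    proof (induction B)
      case (insert b B)
      then show ?case using c(1) assms(3) rx(1)
        by (subst (1 2) M.finsum_insert)
          (auto simp: Pi_iff subset_iff smult_r_distr smult_assoc intro!: M.finsum_closed)
    qed (simp add: smult_zero_right rx(1))
    then have "r \<odot>\<^bsub>M\<^esub> x = ?s (\<lambda>a. r \<otimes>\<^bsub>R\<^esub> c a)" unfolding c(2) using assms(2) by blast
    moreover have "(\<lambda>a. r \<otimes>\<^bsub>R\<^esub> c a) \<in> A \<rightarrow> carrier R" using c(1) rx(1) by (simp add: Pi_iff)
    ultimately show ?thesis unfolding mem by (intro exI conjI)
  qed
qed

text \<open>A submodule that contains \<open>A\<close> contains its linear combinations; conversely
  these combinations themselves form a submodule that contains \<open>A\<close>.\<close>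

lemma fg_module_iff_fgen: "fg_module R M \<longleftrightarrow> left_module R M \<and> fgen R M (carrier M)"
proof (intro iffI conjI)
  assume fg: "fg_module R M"
  then show LM: "left_module R M" by (rule fg_moduleD)
  then interpret left_module R M .
  obtain A where A: "finite A" "A \<subseteq> carrier M"
      "\<And>x. x \<in> carrier M \<Longrightarrow> \<exists>c. c \<in> A \<rightarrow> carrier R \<and> x = (\<Oplus>\<^bsub>M\<^esub>a\<in>A. c a \<odot>\<^bsub>M\<^esub> a)"
    using fg by (auto simp: fg_module_def)
  have "carrier M \<subseteq> U" if U: "submodule U R M" "A \<subseteq> U" for U
  proof
    fix x assume "x \<in> carrier M"
    then obtain c where "c \<in> A \<rightarrow> carrier R" "x = (\<Oplus>\<^bsub>M\<^esub>a\<in>A. c a \<odot>\<^bsub>M\<^esub> a)" using A(3) by blast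
    then show "x \<in> U" using submodule_finsum[OF LM U(1) A(1)] submoduleD(4)[OF U(1)] U(2)
      by (auto simp: Pi_iff subset_iff)
  qed
  with A show "fgen R M (carrier M)" unfolding fgen_def by blast
next
  assume "left_module R M \<and> fgen R M (carrier M)"
  then have LM: "left_module R M" and "fgen R M (carrier M)" by auto
  then obtain A where A: "finite A" "A \<subseteq> carrier M" "\<And>U. submodule U R M \<Longrightarrow> A \<subseteq> U \<Longrightarrow> carrier M \<subseteq> U"
    by (auto simp: fgen_def)
  interpret left_module R M by fact
  let ?U = "{(\<Oplus>\<^bsub>M\<^esub>a\<in>A. c a \<odot>\<^bsub>M\<^esub> a) | c. c \<in> A \<rightarrow> carrier R}"
  have "A \<subseteq> ?U"
  proof
    fix b assume b: "b \<in> A"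
    have "(\<Oplus>\<^bsub>M\<^esub>a\<in>A. (if b = a then \<one>\<^bsub>R\<^esub> else \<zero>\<^bsub>R\<^esub>) \<odot>\<^bsub>M\<^esub> a) = (\<Oplus>\<^bsub>M\<^esub>a\<in>A. if b = a then a else \<zero>\<^bsub>M\<^esub>)"
      using A(2) by (intro M.finsum_cong') (auto simp: smult_zero_left subset_iff)
    also have "\<dots> = b" using M.finsum_singleton[OF b A(1), of "\<lambda>a. a"] A(2) by auto
    finally show "b \<in> ?U" by (intro CollectI exI[of _ "\<lambda>a. if b = a then \<one>\<^bsub>R\<^esub> else \<zero>\<^bsub>R\<^esub>"]) auto
  qed
  from A(3)[OF submodule_combinations[OF LM A(1,2)] this]
  show "fg_module R M" unfolding fg_module_def using LM A(1,2) by blast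
qed

lemma fg_sub:
  assumes "left_module R M" "submodule S R M" "fgen R M S"
  shows "fg_module R (M\<lparr>carrier := S\<rparr>)"
proof -
  have "submodule U R M" if "submodule U R (M\<lparr>carrier := S\<rparr>)" for U
    using submodule_of_sub[OF assms(2) _ assms(1)] submoduleD(1)[OF that] that by auto
  moreover obtain A where "finite A" "A \<subseteq> S" "\<And>U. submodule U R M \<Longrightarrow> A \<subseteq> U \<Longrightarrow> S \<subseteq> U"
    using assms(3) by (auto simp: fgen_def)
  ultimately have "fgen R (M\<lparr>carrier := S\<rparr>) S" unfolding fgen_def by (intro exI[of _ A]) simp
  then show ?thesis using left_module_sub[OF assms(1,2)] by (simp add: fg_module_iff_fgen)
qed

lemma fgen_image:
  assumes "left_module R M" "left_module R N" "f \<in> Hom R M N" "S \<subseteq> carrier M" "fgen R M S"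
  shows "fgen R N (f ` S)"
proof -
  obtain A where A: "finite A" "A \<subseteq> S" "\<And>U. submodule U R M \<Longrightarrow> A \<subseteq> U \<Longrightarrow> S \<subseteq> U"
    using assms(5) by (auto simp: fgen_def)
  have "f ` S \<subseteq> U" if "submodule U R N" "f ` A \<subseteq> U" for U
    using A(3)[OF submodule_vimage[OF assms(1-3) that(1)]] A(2) assms(4) that(2) by blast
  then show ?thesis unfolding fgen_def using A by (intro exI[of _ "f ` A"]) auto
qed

lemma fg_epi: "\<lbrakk>fg_module R M; left_module R N; f \<in> epi_hom R M N\<rbrakk> \<Longrightarrow> fg_module R N"
  using fgen_image[of R M N f "carrier M"] by (auto simp: fg_module_iff_fgen epi_hom_def)

text \<open>Preimages of generators of the image, together with generators of the part of
  \<open>S\<close> in the kernel, generate \<open>S\<close>.\<close>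

lemma fgen_extension:
  assumes "left_module R M" "left_module R N" "f \<in> Hom R M N" "submodule S R M"
    and "fgen R N (f ` S)" "fgen R M {x \<in> S. f x = \<zero>\<^bsub>N\<^esub>}"
  shows "fgen R M S"
proof -
  interpret M: left_module R M by fact
  interpret N: left_module R N by fact
  note S = submoduleD[OF assms(4)]
  obtain B where B: "finite B" "B \<subseteq> f ` S" "\<And>U. submodule U R N \<Longrightarrow> B \<subseteq> U \<Longrightarrow> f ` S \<subseteq> U"
    using assms(5) by (auto simp: fgen_def)
  obtain C where C: "finite C" "C \<subseteq> {x \<in> S. f x = \<zero>\<^bsub>N\<^esub>}"
    "\<And>U. submodule U R M \<Longrightarrow> C \<subseteq> U \<Longrightarrow> {x \<in> S. f x = \<zero>\<^bsub>N\<^esub>} \<subseteq> U"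
    using assms(6) by (auto simp: fgen_def)
  obtain A where A: "A \<subseteq> S" "finite A" "B = f ` A" using finite_subset_image[OF B(1,2)] by blast
  have "S \<subseteq> U" if U: "submodule U R M" "A \<union> C \<subseteq> U" for U
  proof
    fix s assume s: "s \<in> S"
    \<comment> \<open>Intersecting with \<open>S\<close> keeps the preimage \<open>u\<close> found
      below inside \<open>S\<close>, so that \<open>s - u\<close> lies in the part of the kernel
      that \<open>C\<close> generates.\<close>
    have US: "submodule (U \<inter> S) R M" using U(1) assms(4) by (rule submodule_inter)
    have "B \<subseteq> f ` (U \<inter> S)" using U(2) A by auto
    then have "f ` S \<subseteq> f ` (U \<inter> S)" by (rule B(3)[OF submodule_image[OF assms(1-3) US]])
    then obtain u where u: "u \<in> U" "u \<in> S" "f s = f u" using s by auto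
    have "f (s \<ominus>\<^bsub>M\<^esub> u) = \<zero>\<^bsub>N\<^esub>"
      using Hom_minus[OF assms(3,1,2)] s u S(1) HomD(1)[OF assms(3)] by (simp add: subset_iff N.M.minus_self)
    then have "s \<ominus>\<^bsub>M\<^esub> u \<in> U" using C(3)[OF U(1)] U(2) S(6)[OF s u(2)] by auto
    from submoduleD(3)[OF U(1) this u(1)] show "s \<in> U"
      using s u S(1) by (simp add: M.M.minus_add_cancel subset_iff)
  qed
  moreover have "finite (A \<union> C)" "A \<union> C \<subseteq> S" using A C by auto
  ultimately show ?thesis unfolding fgen_def by blast
qed

lemma fgen_zero: "left_module R M \<Longrightarrow> fgen R M {\<zero>\<^bsub>M\<^esub>}"
  unfolding fgen_def by (rule exI[of _ "{}"]) (auto dest: submoduleD(2))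

section \<open>Noetherian modules\<close>

definition noetherian_module :: "('a, 'x) ring_scheme \<Rightarrow> ('a, 'm) module \<Rightarrow> bool" where
  "noetherian_module R M \<longleftrightarrow> (\<forall>S. submodule S R M \<longrightarrow> fgen R M S)"

lemma regular_module_simps [simp]:
  "carrier (regular_module R) = carrier R" "\<zero>\<^bsub>regular_module R\<^esub> = \<zero>\<^bsub>R\<^esub>"
  "add (regular_module R) = add R" "smult (regular_module R) = mult R"
  by (simp_all add: regular_module_def)

text \<open>Induction over a finite generating set: a submodule all of whose submodules are finitely
  generated is enlarged by one generator at a time, with \<open>fgen_extension\<close> for the
  quotient by the part already treated.\<close>

lemma fg_noetherian:
  fixes M :: "('a, 'm) module"
  assumes "fg_module R M" "noetherian_module R (regular_module R)"
  shows "noetherian_module R M"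
proof -
  have LM: "left_module R M" using assms(1) by (rule fg_moduleD)
  interpret left_module R M by fact
  have LR: "left_module R (regular_module R)" by (rule left_module_regular[OF R.ring_axioms])
  have step: "\<exists>U'. submodule U' R M \<and> insert a U \<subseteq> U' \<and> (\<forall>S. submodule S R M \<longrightarrow> S \<subseteq> U' \<longrightarrow> fgen R M S)"
    if U: "submodule U R M" "\<And>S. submodule S R M \<Longrightarrow> S \<subseteq> U \<Longrightarrow> fgen R M S" and a: "a \<in> carrier M" for U a
  proof -
    note U' = submoduleD[OF U(1)]
    obtain N :: "('a, 'm set) module" and q where N: "left_module R N" "q \<in> epi_hom R M N" "a_kernel M N q = U"
      by (rule quotient_module[OF LM U(1)])
    note q = epi_homD(1)[OF N(2)]
    have qU: "q x = \<zero>\<^bsub>N\<^esub> \<longleftrightarrow> x \<in> U" if "x \<in> carrier M" for x using N(3) that by (auto simp: a_kernel_def')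
    \<comment> \<open>The submodule generated by \<open>U\<close> and \<open>a\<close> is obtained
      as the preimage under \<open>q\<close> of the image of \<open>h\<close>, which avoids
      computing with sums.\<close>
    define h where "h c = q (c \<odot>\<^bsub>M\<^esub> a)" for c
    have h: "h \<in> Hom R (regular_module R) N"
      unfolding h_def by (rule Hom_comp[OF _ q], rule HomI) (use a in \<open>auto simp: smult_l_distr smult_assoc\<close>)
    have I: "submodule {x \<in> carrier M. q x \<in> h ` carrier R} R M"
      using submodule_image[OF LR N(1) h submodule_carrier[OF LR]]
      by (intro submodule_vimage[OF LM N(1) q]) simp
    have hz: "\<zero>\<^bsub>N\<^esub> = h \<zero>\<^bsub>R\<^esub>" using Hom_zero[OF h LR N(1)] by simp
    have fg: "fgen R M S" if S: "submodule S R M" "S \<subseteq> {x \<in> carrier M. q x \<in> h ` carrier R}" for S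
    proof (rule fgen_extension[OF LM N(1) q S(1)])
      have qS: "submodule (q ` S) R N" by (rule submodule_image[OF LM N(1) q S(1)])
      \<comment> \<open>A submodule of the image of \<open>h\<close> is the image of the left ideal
        that \<open>h\<close> maps into it, and this left ideal is finitely generated by
        assumption.\<close>
      have "q ` S \<subseteq> h ` carrier R" using S(2) by blast
      moreover have "h ` {c \<in> carrier R. h c \<in> q ` S} = q ` S \<inter> h ` carrier R" by auto
      ultimately have "q ` S = h ` {c \<in> carrier R. h c \<in> q ` S}" by auto
      moreover have "submodule {c \<in> carrier R. h c \<in> q ` S} R (regular_module R)"
        using submodule_vimage[OF LR N(1) h qS] by simp
      ultimately show "fgen R N (q ` S)"
        using fgen_image[OF LR N(1) h, of "{c \<in> carrier R. h c \<in> q ` S}"] assms(2)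
        by (auto simp: noetherian_module_def)
      have "{x \<in> S. q x = \<zero>\<^bsub>N\<^esub>} = S \<inter> U" using submoduleD(1)[OF S(1)] qU by auto
      then show "fgen R M {x \<in> S. q x = \<zero>\<^bsub>N\<^esub>}"
        using U(2) submodule_inter[OF S(1) U(1)] by simp
    qed
    have "q a = h \<one>\<^bsub>R\<^esub>" using a by (simp add: h_def)
    moreover have "q x = h \<zero>\<^bsub>R\<^esub>" if "x \<in> U" for x using that qU[of x] U'(1) hz by auto
    ultimately have "insert a U \<subseteq> {x \<in> carrier M. q x \<in> h ` carrier R}" using a U'(1) by auto
    with I fg show ?thesis by blast
  qed
  have ex: "\<exists>U. submodule U R M \<and> A \<subseteq> U \<and> (\<forall>S. submodule S R M \<longrightarrow> S \<subseteq> U \<longrightarrow> fgen R M S)"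
    if "finite A" "A \<subseteq> carrier M" for A using that
  proof (induction A)
    case empty
    have "fgen R M S" if "submodule S R M" "S \<subseteq> {\<zero>\<^bsub>M\<^esub>}" for S
      using that submoduleD(2)[OF that(1)] fgen_zero[OF LM] by (auto simp: subset_singleton_iff)
    then show ?case using submodule_zero[OF LM] by blast
  next
    case (insert a A)
    then obtain U where U: "submodule U R M" "A \<subseteq> U" "\<And>S. submodule S R M \<Longrightarrow> S \<subseteq> U \<Longrightarrow> fgen R M S" by auto
    from step[OF U(1,3), of a] obtain U' where "submodule U' R M" "insert a U \<subseteq> U'"
      "\<forall>S. submodule S R M \<longrightarrow> S \<subseteq> U' \<longrightarrow> fgen R M S" using insert.prems by auto
    then show ?case using U(2) by (intro exI[of _ U']) auto
  qed
  obtain A where A: "finite A" "A \<subseteq> carrier M" "\<And>U. submodule U R M \<Longrightarrow> A \<subseteq> U \<Longrightarrow> carrier M \<subseteq> U"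
    using assms(1) unfolding fg_module_iff_fgen fgen_def by blast
  from ex[OF A(1,2)] obtain U where U: "submodule U R M" "A \<subseteq> U"
    "\<And>S. submodule S R M \<Longrightarrow> S \<subseteq> U \<Longrightarrow> fgen R M S" by blast
  have "carrier M \<subseteq> U" using A(3) U by blast
  then show ?thesis unfolding noetherian_module_def using U(3) submoduleD(1) by blast
qed

section \<open>Artinian commutative rings are noetherian\<close>

lemma ideal_iff_submodule:
  assumes "cring K" shows "ideal I K \<longleftrightarrow> submodule I K (regular_module K)"
proof -
  interpret cring K by fact
  have L: "left_module K (regular_module K)" by (rule left_module_regular[OF ring_axioms])
  show ?thesis
  proof
    assume "ideal I K"
    then interpret ideal I K .
    show "submodule I K (regular_module K)"
      by (rule submoduleI'[OF L]) (auto simp: I_l_closed a_subset[THEN subsetD])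
  next
    assume S: "submodule I K (regular_module K)"
    note S' = submoduleD[OF S]
    have "subgroup I (add_monoid K)"
      using S by (simp add: submodule_def subgroup_def a_inv_def m_inv_def)
    moreover have "x \<otimes>\<^bsub>K\<^esub> a \<in> I" "a \<otimes>\<^bsub>K\<^esub> x \<in> I" if "a \<in> I" "x \<in> carrier K" for a x
      using S'(1,4) that m_comm[of a x] by auto
    ultimately show "ideal I K" by (intro idealI ring_axioms)
  qed
qed

text \<open>Akizuki's theorem. A minimal non-finitely-generated ideal \<open>N\<close> satisfies \<open>a N = N\<close> or
  \<open>a N = 0\<close> for all \<open>a\<close>, so by the descending chain condition it is a vector space over
  \<open>K / ann N\<close>; a hyperplane \<open>H\<close> avoiding a given \<open>x \<noteq> 0\<close> is finitely generated and \<open>N = H + K x\<close>.\<close>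

lemma (in cring) artinian_noetherian:
  assumes "artinian_cring R"
  shows "noetherian_module R (regular_module R)"
proof (rule ccontr)
  let ?K = "regular_module R"
  have L: "left_module R ?K" by (rule left_module_regular[OF ring_axioms])
  note iff = ideal_iff_submodule[OF is_cring]
  have dcc: "\<exists>n. \<forall>m\<ge>n. J m = J n" if "\<And>n. submodule (J n) R ?K" "\<And>n. J (Suc n) \<subseteq> J n" for J
    using assms that unfolding artinian_cring_def iff by blast
  \<comment> \<open>The descending chain condition as well-foundedness, in order to pick a minimal
    submodule that is not finitely generated.\<close>
  have wf: "wf {(I, J). submodule I R ?K \<and> submodule J R ?K \<and> I \<subset> J}"
    unfolding wf_iff_no_infinite_down_chain
  proof
    assume "\<exists>J. \<forall>i. (J (Suc i), J i) \<in> {(I, J). submodule I R ?K \<and> submodule J R ?K \<and> I \<subset> J}"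
    then obtain J where J: "\<And>i. submodule (J i) R ?K" "\<And>i. J (Suc i) \<subset> J i" by blast
    then obtain n where "J (Suc n) = J n" using dcc[of J] by (metis le_SucI order_refl psubset_imp_subset)
    with J(2)[of n] show False by simp
  qed
  assume "\<not> noetherian_module R ?K"
  then obtain N0 where N0: "N0 \<in> {N. submodule N R ?K \<and> \<not> fgen R ?K N}" by (auto simp: noetherian_module_def)
  obtain N where NQ: "N \<in> {N. submodule N R ?K \<and> \<not> fgen R ?K N}"
    and min0: "\<And>I. (I, N) \<in> {(I, J). submodule I R ?K \<and> submodule J R ?K \<and> I \<subset> J} \<Longrightarrow>
      I \<notin> {N. submodule N R ?K \<and> \<not> fgen R ?K N}"
    by (rule wfE_min[OF wf N0]) (rule that)
  have N: "submodule N R ?K" "\<not> fgen R ?K N" using NQ by auto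
  have min: "fgen R ?K I" if "submodule I R ?K" "I \<subset> N" for I
    using min0[of I] that N(1) by simp
  note N' = submoduleD[OF N(1)]
  have NK: "N \<subseteq> carrier R" using N'(1) by simp
  \<comment> \<open>If the image and the kernel of multiplication by \<open>a\<close> on
    \<open>N\<close> were both proper in \<open>N\<close>, they would be finitely generated by
    minimality, and then \<open>N\<close> would be as well.\<close>
  have dich: "(\<forall>x\<in>N. a \<otimes> x = \<zero>) \<or> (\<lambda>x. a \<otimes> x) ` N = N" if a: "a \<in> carrier R" for a
  proof (rule ccontr)
    assume c: "\<not> ?thesis"
    have h: "(\<lambda>x. a \<otimes> x) \<in> Hom R ?K ?K" using a by (intro HomI) (auto simp: r_distr m_ac)
    have "(\<lambda>x. a \<otimes> x) ` N \<subseteq> N" using N'(4) a by auto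
    then have 1: "fgen R ?K ((\<lambda>x. a \<otimes> x) ` N)"
      using c by (intro min submodule_image[OF L L h N(1)]) auto
    have k: "{x \<in> N. a \<otimes> x = \<zero>} = N \<inter> a_kernel ?K ?K (\<lambda>x. a \<otimes> x)" using NK by (auto simp: a_kernel_def')
    have "fgen R ?K {x \<in> N. a \<otimes> x = \<zero>}"
      using c unfolding k by (intro min submodule_inter N(1) submodule_kernel[OF L L h]) (auto simp: k[symmetric])
    with fgen_extension[OF L L h N(1) 1] N(2) show False by simp
  qed
  \<comment> \<open>The chain of the ideals generated by the powers of \<open>a\<close> becomes
    stationary, which gives \<open>c\<close> with a^n = a^(n+1) c. Every \<open>x\<close> in
    \<open>N\<close> has the form a^n y, so c a x = a^(n+1) c y = a^n y = x.\<close>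
  have inv: "\<exists>c\<in>carrier R. \<forall>x\<in>N. (c \<otimes> a) \<otimes> x = x"
    if a: "a \<in> carrier R" and nz: "\<not> (\<forall>x\<in>N. a \<otimes> x = \<zero>)" for a
  proof -
    have pow: "(\<lambda>x. a [^] (n::nat) \<otimes> x) ` N = N" for n
    proof (induction n)
      case (Suc n)
      have "(\<lambda>x. a [^] Suc n \<otimes> x) ` N = (\<lambda>x. a [^] n \<otimes> x) ` (\<lambda>x. a \<otimes> x) ` N"
        unfolding image_image using NK a by (intro image_cong) (auto simp: m_assoc)
      with Suc dich[OF a] nz show ?case by simp
    qed (use NK in \<open>auto simp: image_iff subset_iff\<close>)
    define J where "J n = (\<lambda>x. a [^] (n::nat) \<otimes> x) ` carrier R" for n
    have "submodule (J n) R ?K" for n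
    proof -
      have h: "(\<lambda>x. a [^] n \<otimes> x) \<in> Hom R ?K ?K" using a by (intro HomI) (auto simp: r_distr m_ac)
      show ?thesis unfolding J_def using submodule_image[OF L L h submodule_carrier[OF L]] by simp
    qed
    moreover have "J (Suc n) \<subseteq> J n" for n unfolding J_def using a by (auto simp: m_assoc)
    ultimately obtain n where "J (Suc n) = J n" using dcc[of J] by (metis le_SucI order_refl)
    moreover have "a [^] n \<in> J n" unfolding J_def using a by (intro image_eqI[of _ _ \<one>]) auto
    ultimately obtain c where c: "c \<in> carrier R" "a [^] n = a [^] Suc n \<otimes> c" unfolding J_def by auto
    have "(c \<otimes> a) \<otimes> x = x" if x: "x \<in> N" for x
    proof -
      obtain y where y: "y \<in> N" "x = a [^] n \<otimes> y" using pow[of n] x by blast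
      have "(c \<otimes> a) \<otimes> x = (a [^] Suc n \<otimes> c) \<otimes> y" using y c(1) a NK by (auto simp: m_ac subset_iff)
      with c(2) y(2) show ?thesis by simp
    qed
    with c(1) show ?thesis by blast
  qed
  obtain x0 where x0: "x0 \<in> N" "x0 \<noteq> \<zero>" using N(2) N'(2) fgen_zero[OF L] by (metis regular_module_simps(2) singletonI subsetI subset_singletonD subset_antisym empty_iff singletonD)
  \<comment> \<open>The hyperplane is found by Zorn's lemma, as a submodule of \<open>N\<close> that
    is maximal among those avoiding \<open>x0\<close>.\<close>
  define \<H> where "\<H> = {H. submodule H R ?K \<and> H \<subseteq> N \<and> x0 \<notin> H}"
  have "\<exists>H\<in>\<H>. \<forall>X\<in>\<H>. H \<subseteq> X \<longrightarrow> X = H"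
  proof (rule subset_Zorn_nonempty)
    show "\<H> \<noteq> {}" using submodule_zero[OF L] x0 N'(2) by (auto simp: \<H>_def intro!: exI[of _ "{\<zero>}"])
    fix C assume C: "C \<noteq> {}" "subset.chain \<H> C"
    have C': "submodule H R ?K" "H \<subseteq> N" "x0 \<notin> H" if "H \<in> C" for H
      using C(2) that by (auto simp: subset_chain_def \<H>_def)
    have "submodule (\<Union>C) R ?K"
    proof (rule submoduleI'[OF L])
      show "\<Union>C \<subseteq> carrier ?K" using C'(1) submoduleD(1) by blast
      show "\<zero>\<^bsub>?K\<^esub> \<in> \<Union>C" using C(1) C'(1) submoduleD(2) by blast
      show "x \<oplus>\<^bsub>?K\<^esub> y \<in> \<Union>C" if xy: "x \<in> \<Union>C" "y \<in> \<Union>C" for x y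
      proof -
        obtain H H' where H: "H \<in> C" "H' \<in> C" "x \<in> H" "y \<in> H'" using xy by blast
        then have "H \<subseteq> H' \<or> H' \<subseteq> H" using C(2) by (auto simp: subset_chain_def)
        then show ?thesis using H submoduleD(3)[OF C'(1)] by blast
      qed
      show "r \<odot>\<^bsub>?K\<^esub> x \<in> \<Union>C" if "r \<in> carrier R" "x \<in> \<Union>C" for r x
        using that submoduleD(4)[OF C'(1)] by blast
    qed
    then show "\<Union>C \<in> \<H>" using C' by (auto simp: \<H>_def)
  qed
  then obtain H where HH: "H \<in> \<H>" "\<forall>X\<in>\<H>. H \<subseteq> X \<longrightarrow> X = H" by blast
  then have H: "submodule H R ?K" "H \<subseteq> N" "x0 \<notin> H" by (simp_all add: \<H>_def)
  have max: "X = H" if "submodule X R ?K" "X \<subseteq> N" "x0 \<notin> X" "H \<subseteq> X" for X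
    using HH(2) that by (simp add: \<H>_def)
  note H' = submoduleD[OF H(1)]
  have "fgen R ?K H" using H x0 by (intro min) auto
  then obtain A where A: "finite A" "A \<subseteq> H" "\<And>U. submodule U R ?K \<Longrightarrow> A \<subseteq> U \<Longrightarrow> H \<subseteq> U" by (auto simp: fgen_def)
  have "N \<subseteq> U" if U: "submodule U R ?K" "insert x0 A \<subseteq> U" for U
  proof
    fix y assume y: "y \<in> N"
    have HU: "H \<subseteq> U" using A(3) U by auto
    have yK: "y \<in> carrier R" and HK: "H \<subseteq> carrier R" using y NK H(2) by auto
    show "y \<in> U"
    proof (cases "y \<in> H")
      case False
      \<comment> \<open>\<open>X\<close> is generated by \<open>H\<close> and \<open>y\<close>. By
        maximality it contains \<open>x0\<close>, so \<open>x0 = h + c y\<close>, where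
        \<open>c\<close> does not annihilate \<open>N\<close> because \<open>x0\<close> is not in
        \<open>H\<close>. Inverting \<open>c\<close> on \<open>N\<close> recovers \<open>y\<close>
        from \<open>x0\<close> and \<open>h\<close>.\<close>
      define X where "X = {h \<oplus> c \<otimes> y | h c. h \<in> H \<and> c \<in> carrier R}"
      have X: "submodule X R ?K"
      proof (rule submoduleI'[OF L])
        show "X \<subseteq> carrier ?K" using HK yK by (auto simp: X_def)
        show "\<zero>\<^bsub>?K\<^esub> \<in> X" unfolding X_def using H'(2) yK by (auto intro!: exI[of _ \<zero>])
        show "u \<oplus>\<^bsub>?K\<^esub> v \<in> X" if uv: "u \<in> X" "v \<in> X" for u v
        proof -
          obtain h c h' c' where *: "h \<in> H" "c \<in> carrier R" "u = h \<oplus> c \<otimes> y" "h' \<in> H" "c' \<in> carrier R" "v = h' \<oplus> c' \<otimes> y"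
            using uv unfolding X_def by blast
          then have "u \<oplus> v = (h \<oplus> h') \<oplus> (c \<oplus> c') \<otimes> y" using HK yK by (auto simp: l_distr a_ac subset_iff)
          with * H'(3) show ?thesis unfolding X_def by force
        qed
        show "r \<odot>\<^bsub>?K\<^esub> u \<in> X" if u: "r \<in> carrier R" "u \<in> X" for r u
        proof -
          obtain h c where *: "h \<in> H" "c \<in> carrier R" "u = h \<oplus> c \<otimes> y" using u unfolding X_def by blast
          then have "r \<otimes> u = r \<otimes> h \<oplus> (r \<otimes> c) \<otimes> y" using HK yK u(1) by (auto simp: r_distr m_assoc subset_iff)
          with * u(1) H'(4) show ?thesis unfolding X_def by force
        qed
      qed
      have "y \<in> X" unfolding X_def using H'(2) yK by (intro CollectI exI[of _ \<zero>] exI[of _ \<one>]) auto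
      moreover have "H \<subseteq> X"
      proof
        fix h assume h: "h \<in> H"
        then have "h = h \<oplus> \<zero> \<otimes> y" using HK yK by auto
        with h show "h \<in> X" unfolding X_def by blast
      qed
      moreover have "X \<subseteq> N"
      proof
        fix u assume "u \<in> X"
        then obtain h c where "h \<in> H" "c \<in> carrier R" "u = h \<oplus> c \<otimes> y" unfolding X_def by blast
        then show "u \<in> N" using N'(3)[of h "c \<otimes> y"] N'(4)[of c y] H(2) y by auto
      qed
      ultimately have "x0 \<in> X" using max[OF X] False by blast
      then obtain h c where c: "h \<in> H" "c \<in> carrier R" "x0 = h \<oplus> c \<otimes> y" unfolding X_def by blast
      have hK: "h \<in> carrier R" using c(1) HK by blast
      have "\<not> (\<forall>x\<in>N. c \<otimes> x = \<zero>)"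
      proof
        assume "\<forall>x\<in>N. c \<otimes> x = \<zero>"
        with y have "c \<otimes> y = \<zero>" by blast
        with c H(3) hK show False by simp
      qed
      from inv[OF c(2) this] obtain d where d: "d \<in> carrier R" "(d \<otimes> c) \<otimes> y = y" using y by blast
      have "x0 \<ominus> h = c \<otimes> y" using c hK yK by (simp add: add_minus_cancel_left)
      then have "y = d \<otimes> (x0 \<ominus> h)" using d c yK by (simp add: m_assoc)
      moreover have "x0 \<ominus> h \<in> U" using submoduleD(6)[OF U(1), of x0 h] HU U(2) c(1) by (auto simp: a_minus_def a_inv_def m_inv_def)
      ultimately show ?thesis using submoduleD(4)[OF U(1) d(1)] by simp
    qed (use HU in auto)
  qed
  moreover have "finite (insert x0 A)" "insert x0 A \<subseteq> N" using A x0 H by auto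
  ultimately have "fgen R ?K N" unfolding fgen_def by blast
  with N(2) show False by simp
qed

section \<open>Finitely generated modules over an artin algebra\<close>

definition restrict_scalars :: "('k \<Rightarrow> 'a) \<Rightarrow> ('a, 'm) module \<Rightarrow> ('k, 'm) module" where
  "restrict_scalars \<phi> M = \<lparr>carrier = carrier M, mult = mult M, one = one M, zero = zero M,
     add = add M, smult = (\<lambda>c x. \<phi> c \<odot>\<^bsub>M\<^esub> x)\<rparr>"

lemma restrict_scalars_simps [simp]:
  "carrier (restrict_scalars \<phi> M) = carrier M" "\<zero>\<^bsub>restrict_scalars \<phi> M\<^esub> = \<zero>\<^bsub>M\<^esub>"
  "add (restrict_scalars \<phi> M) = add M" "smult (restrict_scalars \<phi> M) = (\<lambda>c x. \<phi> c \<odot>\<^bsub>M\<^esub> x)"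
  by (simp_all add: restrict_scalars_def)

lemma left_module_restrict_scalars:
  assumes "ring K" "\<phi> \<in> ring_hom K R" "left_module R M"
  shows "left_module K (restrict_scalars \<phi> M)"
proof -
  interpret left_module R M by fact
  note \<phi> = ring_hom_memE[OF assms(2)]
  show ?thesis
    apply (intro left_module.intro left_module_axioms.intro)
        apply (rule assms(1))
       apply (rule abelian_groupI)
    subgoal by simp
    subgoal by simp
    subgoal by (simp add: M.a_assoc)
    subgoal by (simp add: M.a_comm)
    subgoal by simp
    subgoal for x by (rule bexI[of _ "\<ominus>\<^bsub>M\<^esub> x"]) (auto simp: M.l_neg)
    by (simp_all add: \<phi> smult_l_distr smult_r_distr smult_assoc)
qed

lemma submodule_restrict_scalars:
  assumes "\<phi> \<in> ring_hom K R" "submodule S R M" "left_module R M" "ring K"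
  shows "submodule S K (restrict_scalars \<phi> M)"
  using submoduleD[OF assms(2)] ring_hom_memE(1)[OF assms(1)]
  by (intro submoduleI' left_module_restrict_scalars[OF assms(4,1,3)]) auto

text \<open>Every \<open>R\<close>-submodule is a \<open>K\<close>-submodule, so the test over
  \<open>K\<close> includes the test over \<open>R\<close>.\<close>

lemma fgen_restrict_scalarsD:
  assumes "\<phi> \<in> ring_hom K R" "left_module R M" "ring K" "fgen K (restrict_scalars \<phi> M) S"
  shows "fgen R M S"
proof -
  obtain A where "finite A" "A \<subseteq> S" "\<And>U. submodule U K (restrict_scalars \<phi> M) \<Longrightarrow> A \<subseteq> U \<Longrightarrow> S \<subseteq> U"
    using assms(4) by (auto simp: fgen_def)
  then show ?thesis unfolding fgen_def
    using submodule_restrict_scalars[OF assms(1) _ assms(2,3)] by (intro exI[of _ A]) simp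
qed

text \<open>If \<open>E\<close> generates \<open>R\<close> over \<open>K\<close> and
  \<open>A\<close> generates \<open>M\<close> over \<open>R\<close>, the products of their elements
  generate \<open>M\<close> over \<open>K\<close>, and \<open>K\<close> is noetherian.\<close>

lemma artin_algebra_noetherian:
  assumes "artin_algebra K \<phi> R" "fg_module R M"
  shows "noetherian_module K (restrict_scalars \<phi> M)"
proof (rule fg_noetherian)
  have K: "ring K" "artinian_cring K" "\<phi> \<in> ring_hom K R" "ring R" "fg_module K (scalar_module \<phi> R)"
    "\<And>c a. c \<in> carrier K \<Longrightarrow> a \<in> carrier R \<Longrightarrow> \<phi> c \<otimes>\<^bsub>R\<^esub> a = a \<otimes>\<^bsub>R\<^esub> \<phi> c"
    using assms(1) by (auto simp: artin_algebra_def artinian_cring_def cring_def)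
  show "noetherian_module K (regular_module K)" using K(2) by (intro cring.artinian_noetherian) (simp_all add: artinian_cring_def)
  have LM: "left_module R M" using assms(2) by (rule fg_moduleD)
  interpret left_module R M by fact
  note \<phi> = ring_hom_memE[OF K(3)]
  let ?M = "restrict_scalars \<phi> M"
  have LK: "left_module K ?M" by (rule left_module_restrict_scalars[OF K(1,3) LM])
  have LS: "left_module K (scalar_module \<phi> R)" using K(5) by (rule fg_moduleD)
  obtain E where E: "finite E" "E \<subseteq> carrier R" "\<And>U. submodule U K (scalar_module \<phi> R) \<Longrightarrow> E \<subseteq> U \<Longrightarrow> carrier R \<subseteq> U"
    using K(5) unfolding fg_module_iff_fgen fgen_def by (auto simp: scalar_module_def)
  obtain A where A: "finite A" "A \<subseteq> carrier M" "\<And>U. submodule U R M \<Longrightarrow> A \<subseteq> U \<Longrightarrow> carrier M \<subseteq> U"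
    using assms(2) unfolding fg_module_iff_fgen fgen_def by blast
  have "carrier ?M \<subseteq> U" if U: "submodule U K ?M" "(\<lambda>(e, a). e \<odot>\<^bsub>M\<^esub> a) ` (E \<times> A) \<subseteq> U" for U
  proof -
    note U' = submoduleD[OF U(1), simplified]
    \<comment> \<open>The largest \<open>R\<close>-submodule inside \<open>U\<close>; it is
      everything as soon as it contains the generators \<open>A\<close>.\<close>
    define V where "V = {x \<in> carrier M. \<forall>r\<in>carrier R. r \<odot>\<^bsub>M\<^esub> x \<in> U}"
    have "submodule V R M"
      by (rule submoduleI'[OF LM]) (auto simp: V_def smult_zero_right U' smult_r_distr smult_assoc[symmetric])
    moreover have "A \<subseteq> V"
    proof
      fix a assume a: "a \<in> A"
      then have aM: "a \<in> carrier M" using A(2) by blast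
      have "submodule {r \<in> carrier R. r \<odot>\<^bsub>M\<^esub> a \<in> U} K (scalar_module \<phi> R)"
        using U'(4) aM
        by (intro submoduleI'[OF LS]) (auto simp: scalar_module_def smult_zero_left U' smult_l_distr smult_assoc \<phi>)
      then have "carrier R \<subseteq> {r \<in> carrier R. r \<odot>\<^bsub>M\<^esub> a \<in> U}" using U(2) a E(2) by (intro E(3)) auto
      then show "a \<in> V" using aM by (auto simp: V_def)
    qed
    ultimately have "carrier M \<subseteq> V" by (rule A(3))
    then show ?thesis by (force simp: V_def)
  qed
  moreover have "(\<lambda>(e, a). e \<odot>\<^bsub>M\<^esub> a) ` (E \<times> A) \<subseteq> carrier ?M" using E(2) A(2) by auto
  moreover have "finite ((\<lambda>(e, a). e \<odot>\<^bsub>M\<^esub> a) ` (E \<times> A))" using A E by auto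
  ultimately show "fg_module K ?M" unfolding fg_module_iff_fgen fgen_def using LK by blast
qed

lemma artin_algebra_fgen:
  assumes "artin_algebra K \<phi> R" "fg_module R M" "submodule S R M"
  shows "fgen R M S"
proof -
  have K: "ring K" "\<phi> \<in> ring_hom K R"
    using assms(1) by (auto simp: artin_algebra_def artinian_cring_def cring_def)
  have LM: "left_module R M" using assms(2) by (rule fg_moduleD)
  show ?thesis
    using artin_algebra_noetherian[OF assms(1,2)] submodule_restrict_scalars[OF K(2) assms(3) LM K(1)]
    by (intro fgen_restrict_scalarsD[OF K(2) LM K(1)]) (auto simp: noetherian_module_def)
qed

lemma artin_algebra_fg_sub:
  assumes "artin_algebra K \<phi> R" "fg_module R M" "submodule S R M"
  shows "fg_module R (M\<lparr>carrier := S\<rparr>)"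
  using fg_sub[OF fg_moduleD[OF assms(2)] assms(3) artin_algebra_fgen[OF assms]] .

section \<open>Projective and injective modules\<close>

text \<open>Only the carrier changes, so the kernel of a map out of an \<open>'a fgmod\<close> is
  again an \<open>'a fgmod\<close> and syzygies can be iterated without change of type.\<close>

abbreviation Ker :: "('a, 'm) module \<Rightarrow> ('a, 'n) module \<Rightarrow> ('m \<Rightarrow> 'n) \<Rightarrow> ('a, 'm) module" where
  "Ker M N f \<equiv> M\<lparr>carrier := a_kernel M N f\<rparr>"

text \<open>The definitions of projectivity, resolutions and global dimension quantify over
  \<open>'a fgmod\<close> only. A module of another element type enters them through such a copy and
  an explicit pair of inverse maps.\<close>

lemma fg_copy:
  fixes M :: "('a, 'm) module"
  assumes "fg_module R M"
  obtains N :: "'a fgmod" and f g where "fg_module R N" "f \<in> Hom R M N" "g \<in> Hom R N M"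
    "\<And>x. x \<in> carrier M \<Longrightarrow> g (f x) = x" "\<And>y. y \<in> carrier N \<Longrightarrow> f (g y) = y"
proof -
  obtain N :: "'a fgmod" where N: "fg_module R N" "module_isomorphic R M N"
    by (rule fg_module_isomorphic_fgmod[OF assms])
  then obtain f where f: "f \<in> Hom R M N" "inj_on f (carrier M)" "f ` carrier M = carrier N"
    by (auto simp: module_isomorphic_def mono_hom_def epi_hom_def)
  obtain g where "g \<in> Hom R N M" "\<And>x. x \<in> carrier M \<Longrightarrow> g (f x) = x" "\<And>y. y \<in> carrier N \<Longrightarrow> f (g y) = y"
    by (rule Hom_inv[OF fg_moduleD[OF assms] f]) (rule that)
  with N(1) f(1) show thesis by (rule that)
qed

text \<open>The coset construction raises the element type, so the quotient is moved back to
  \<open>'a fgmod\<close>.\<close>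

lemma quotient_fgmod:
  fixes M :: "('a, 'm) module"
  assumes M: "fg_module R M" and S: "submodule S R M"
  obtains N :: "'a fgmod" and q where "fg_module R N" "q \<in> epi_hom R M N" "a_kernel M N q = S"
proof -
  note LM = fg_moduleD[OF M]
  obtain Q :: "('a, 'm set) module" and p where Q: "left_module R Q" "p \<in> epi_hom R M Q" "a_kernel M Q p = S"
    by (rule quotient_module[OF LM S])
  obtain N :: "'a fgmod" and f g where N: "fg_module R N" "f \<in> Hom R Q N" "g \<in> Hom R N Q"
    "\<And>x. x \<in> carrier Q \<Longrightarrow> g (f x) = x" "\<And>y. y \<in> carrier N \<Longrightarrow> f (g y) = y"
    by (rule fg_copy[OF fg_epi[OF M Q(1,2)]]) (rule that)
  have "f \<in> epi_hom R Q N" using N(5) HomD(1)[OF N(3)] by (intro epi_homI[OF N(2)]) blast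
  note epi = epi_comp[OF Q(2) this]
  have "f x = \<zero>\<^bsub>N\<^esub> \<longleftrightarrow> x = \<zero>\<^bsub>Q\<^esub>" if "x \<in> carrier Q" for x
    using N(4)[OF that] Hom_zero[OF N(2) Q(1) fg_moduleD[OF N(1)]] Hom_zero[OF N(3) fg_moduleD[OF N(1)] Q(1)] by metis
  then have "a_kernel M N (\<lambda>x. f (p x)) = S"
    using HomD(1)[OF epi_homD(1)[OF Q(2)]] unfolding Q(3)[symmetric] by (auto simp: a_kernel_def')
  with N(1) epi show thesis by (rule that)
qed

lemma projectiveD: "projective_module R P \<Longrightarrow> fg_module R P" "projective_module R P \<Longrightarrow> left_module R P"
  by (auto simp: projective_module_def fg_moduleD)

text \<open>\<open>projective_module\<close> tests the lifting property against modules in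
  \<open>'a fgmod\<close>; passing to copies of \<open>X\<close> and \<open>Y\<close> makes it
  available for all element types.\<close>

lemma projective_lift:
  fixes X :: "('a, 'm) module" and Y :: "('a, 'n) module"
  assumes P: "projective_module R P" and X: "fg_module R X" and Y: "fg_module R Y"
    and p: "p \<in> epi_hom R X Y" and g: "g \<in> Hom R P Y"
  obtains h where "h \<in> Hom R P X" "\<And>x. x \<in> carrier P \<Longrightarrow> p (h x) = g x"
proof -
  obtain X' :: "'a fgmod" and f f' where X': "fg_module R X'" "f \<in> Hom R X X'" "f' \<in> Hom R X' X"
    "\<And>x. x \<in> carrier X \<Longrightarrow> f' (f x) = x" "\<And>y. y \<in> carrier X' \<Longrightarrow> f (f' y) = y"
    by (rule fg_copy[OF X]) (rule that)
  obtain Y' :: "'a fgmod" and k k' where Y': "fg_module R Y'" "k \<in> Hom R Y Y'" "k' \<in> Hom R Y' Y"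
    "\<And>x. x \<in> carrier Y \<Longrightarrow> k' (k x) = x" "\<And>y. y \<in> carrier Y' \<Longrightarrow> k (k' y) = y"
    by (rule fg_copy[OF Y]) (rule that)
  have "(\<lambda>x. k (p (f' x))) \<in> epi_hom R X' Y'"
  proof (rule epi_homI)
    show "(\<lambda>x. k (p (f' x))) \<in> Hom R X' Y'"
      by (intro Hom_comp[OF _ Y'(2)] Hom_comp[OF X'(3)] epi_homD(1)[OF p])
    fix y assume y: "y \<in> carrier Y'"
    then obtain x where "x \<in> carrier X" "p x = k' y" using epi_homD(2)[OF p] HomD(1)[OF Y'(3)] by blast
    then show "\<exists>x\<in>carrier X'. k (p (f' x)) = y"
      using y X'(4) Y'(5) HomD(1)[OF X'(2)] by (intro bexI[of _ "f x"]) auto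
  qed
  moreover have "(\<lambda>x. k (g x)) \<in> Hom R P Y'" by (rule Hom_comp[OF g Y'(2)])
  ultimately obtain h where h: "h \<in> Hom R P X'" "\<And>x. x \<in> carrier P \<Longrightarrow> k (p (f' (h x))) = k (g x)"
    using P X'(1) Y'(1) unfolding projective_module_def by meson
  show thesis
  proof (rule that)
    show "(\<lambda>x. f' (h x)) \<in> Hom R P X" by (rule Hom_comp[OF h(1) X'(3)])
    fix x assume x: "x \<in> carrier P"
    have "k' (k (p (f' (h x)))) = k' (k (g x))" using h(2)[OF x] by simp
    then show "p (f' (h x)) = g x"
      using x HomD(1)[OF h(1)] HomD(1)[OF X'(3)] HomD(1)[OF epi_homD(1)[OF p]] HomD(1)[OF g] Y'(4) by simp
  qed
qed

text \<open>Copies in \<open>'a fgmod\<close> make the extension property available for all element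
  types, as in \<open>projective_lift\<close>.\<close>

lemma injective_extend:
  fixes X :: "('a, 'm) module" and Y :: "('a, 'n) module"
  assumes I: "injective_module R I" and X: "fg_module R X" and Y: "fg_module R Y"
    and j: "j \<in> mono_hom R X Y" and g: "g \<in> Hom R X I"
  obtains h where "h \<in> Hom R Y I" "\<And>x. x \<in> carrier X \<Longrightarrow> h (j x) = g x"
proof -
  obtain X' :: "'a fgmod" and f f' where X': "fg_module R X'" "f \<in> Hom R X X'" "f' \<in> Hom R X' X"
    "\<And>x. x \<in> carrier X \<Longrightarrow> f' (f x) = x" "\<And>y. y \<in> carrier X' \<Longrightarrow> f (f' y) = y"
    by (rule fg_copy[OF X]) (rule that)
  obtain Y' :: "'a fgmod" and k k' where Y': "fg_module R Y'" "k \<in> Hom R Y Y'" "k' \<in> Hom R Y' Y"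
    "\<And>x. x \<in> carrier Y \<Longrightarrow> k' (k x) = x" "\<And>y. y \<in> carrier Y' \<Longrightarrow> k (k' y) = y"
    by (rule fg_copy[OF Y]) (rule that)
  have jH: "j \<in> Hom R X Y" "inj_on j (carrier X)" using j by (auto simp: mono_hom_def)
  have "(\<lambda>x. k (j (f' x))) \<in> mono_hom R X' Y'"
    unfolding mono_hom_def
  proof (intro CollectI conjI inj_onI)
    show "(\<lambda>x. k (j (f' x))) \<in> Hom R X' Y'"
      by (intro Hom_comp[OF _ Y'(2)] Hom_comp[OF X'(3)] jH)
    fix x y assume xy: "x \<in> carrier X'" "y \<in> carrier X'" "k (j (f' x)) = k (j (f' y))"
    have c: "j (f' x) \<in> carrier Y" "j (f' y) \<in> carrier Y"
      using xy HomD(1)[OF jH(1)] HomD(1)[OF X'(3)] by auto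
    have "j (f' x) = k' (k (j (f' x)))" using Y'(4)[OF c(1)] by (rule sym)
    also have "\<dots> = j (f' y)" unfolding xy(3) by (rule Y'(4)[OF c(2)])
    finally have "j (f' x) = j (f' y)" .
    then have "f' x = f' y" using xy HomD(1)[OF X'(3)] by (intro inj_onD[OF jH(2)])
    then have "f (f' x) = f (f' y)" by simp
    then show "x = y" using xy X'(5) by simp
  qed
  moreover have "(\<lambda>x. g (f' x)) \<in> Hom R X' I" by (rule Hom_comp[OF X'(3) g])
  ultimately obtain h where h: "h \<in> Hom R Y' I" "\<And>x. x \<in> carrier X' \<Longrightarrow> h (k (j (f' x))) = g (f' x)"
    using I X'(1) Y'(1) unfolding injective_module_def by meson
  show thesis
  proof (rule that)
    show "(\<lambda>x. h (k x)) \<in> Hom R Y I" by (rule Hom_comp[OF Y'(2) h(1)])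
    fix x assume x: "x \<in> carrier X"
    then show "h (k (j x)) = g x" using h(2)[of "f x"] HomD(1)[OF X'(2)] X'(4) by simp
  qed
qed

lemma projective_retract:
  assumes P: "projective_module R P" and X: "fg_module R X"
    and i: "i \<in> Hom R X P" and r: "r \<in> Hom R P X" and ri: "\<And>x. x \<in> carrier X \<Longrightarrow> r (i x) = x"
  shows "projective_module R X"
  unfolding projective_module_def
proof (intro conjI X allI impI)
  fix A B :: "'a fgmod" and p g
  assume A: "fg_module R A" "fg_module R B" and p: "p \<in> epi_hom R A B" and g: "g \<in> Hom R X B"
  have gr: "(\<lambda>x. g (r x)) \<in> Hom R P B" by (rule Hom_comp[OF r g])
  obtain h where h: "h \<in> Hom R P A" "\<And>x. x \<in> carrier P \<Longrightarrow> p (h x) = g (r x)"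
    by (rule projective_lift[OF P A p gr]) (rule that)
  have "p (h (i x)) = g x" if "x \<in> carrier X" for x
    using h(2)[of "i x"] HomD(1)[OF i] ri that by simp
  moreover have "(\<lambda>x. h (i x)) \<in> Hom R X A" by (rule Hom_comp[OF i h(1)])
  ultimately show "\<exists>h\<in>Hom R X A. \<forall>x\<in>carrier X. p (h x) = g x" by (intro bexI[of _ "\<lambda>x. h (i x)"]) auto
qed

lemma projective_section:
  fixes X :: "('a, 'm) module"
  assumes "projective_module R P" "fg_module R X" "p \<in> epi_hom R X P"
  obtains s where "s \<in> Hom R P X" "\<And>x. x \<in> carrier P \<Longrightarrow> p (s x) = x"
  by (rule projective_lift[OF assms(1,2) projectiveD(1)[OF assms(1)] assms(3) Hom_id]) (rule that)

text \<open>A zero module with the element type of \<open>M\<close>, with which a resolution of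
  \<open>M\<close> can be continued after its last nonzero term.\<close>

lemma zero_submodule_projective:
  assumes "left_module R M"
  shows "projective_module R (M\<lparr>carrier := {\<zero>\<^bsub>M\<^esub>}\<rparr>)"
  unfolding projective_module_def
proof (intro conjI allI impI)
  show "fg_module R (M\<lparr>carrier := {\<zero>\<^bsub>M\<^esub>}\<rparr>)"
    by (rule fg_sub[OF assms submodule_zero[OF assms] fgen_zero[OF assms]])
  have L: "left_module R (M\<lparr>carrier := {\<zero>\<^bsub>M\<^esub>}\<rparr>)" by (rule left_module_sub[OF assms submodule_zero[OF assms]])
  fix X Y :: "'a fgmod" and p g
  assume X: "fg_module R X" "fg_module R Y" "p \<in> epi_hom R X Y" "g \<in> Hom R (M\<lparr>carrier := {\<zero>\<^bsub>M\<^esub>}\<rparr>) Y"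
  note LX = fg_moduleD[OF X(1)] fg_moduleD[OF X(2)]
  show "\<exists>h\<in>Hom R (M\<lparr>carrier := {\<zero>\<^bsub>M\<^esub>}\<rparr>) X. \<forall>x\<in>carrier (M\<lparr>carrier := {\<zero>\<^bsub>M\<^esub>}\<rparr>). p (h x) = g x"
    using Hom_zero[OF X(4) L LX(2)] Hom_zero[OF epi_homD(1)[OF X(3)] LX]
    by (intro bexI[OF _ Hom_const_zero[OF LX(1)]]) simp
qed

subsection \<open>Direct sums and powers\<close>

lemma direct_sum_simps [simp]:
  "\<zero>\<^bsub>direct_sum Ms\<^esub> = map (\<lambda>M. \<zero>\<^bsub>M\<^esub>) Ms"
  "xs \<in> carrier (direct_sum Ms) \<longleftrightarrow> length xs = length Ms \<and> (\<forall>i<length Ms. xs ! i \<in> carrier (Ms ! i))"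
  "xs \<oplus>\<^bsub>direct_sum Ms\<^esub> ys = map (\<lambda>i. xs ! i \<oplus>\<^bsub>Ms ! i\<^esub> ys ! i) [0..<length Ms]"
  "r \<odot>\<^bsub>direct_sum Ms\<^esub> xs = map (\<lambda>i. r \<odot>\<^bsub>Ms ! i\<^esub> xs ! i) [0..<length Ms]"
  by (simp_all add: direct_sum_def)

lemma Hom_nth: "i < length Ms \<Longrightarrow> (\<lambda>xs. xs ! i) \<in> Hom R (direct_sum Ms) (Ms ! i)"
  by (rule HomI) auto

lemma Hom_tuple:
  assumes "\<And>i. i < length Ms \<Longrightarrow> f i \<in> Hom R M (Ms ! i)"
  shows "(\<lambda>x. map (\<lambda>i. f i x) [0..<length Ms]) \<in> Hom R M (direct_sum Ms)"
  by (rule HomI) (auto simp: HomD[OF assms])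

text \<open>The biproduct characterisation of the power M^c. Lists of elements are only one model of
  it: copies in \<open>'a fgmod\<close>, kernels of maps between powers and
  \<open>Hom_module R T W\<close> are treated in the same way.\<close>

definition is_power ::
    "('a, 'x) ring_scheme \<Rightarrow> ('a, 'm) module \<Rightarrow> nat \<Rightarrow> ('a, 'w) module \<Rightarrow>
      (nat \<Rightarrow> 'm \<Rightarrow> 'w) \<Rightarrow> (nat \<Rightarrow> 'w \<Rightarrow> 'm) \<Rightarrow> bool" where
  "is_power R M c W \<iota> \<pi> \<longleftrightarrow> left_module R M \<and> left_module R W \<and>
     (\<forall>j<c. \<iota> j \<in> Hom R M W \<and> \<pi> j \<in> Hom R W M) \<and>
     (\<forall>j<c. \<forall>k<c. \<forall>x\<in>carrier M. \<pi> j (\<iota> k x) = (if j = k then x else \<zero>\<^bsub>M\<^esub>)) \<and>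
     (\<forall>w\<in>carrier W. (\<Oplus>\<^bsub>W\<^esub>j\<in>{..<c}. \<iota> j (\<pi> j w)) = w)"

lemma is_powerD:
  assumes "is_power R M c W \<iota> \<pi>"
  shows "left_module R M" "left_module R W" "j < c \<Longrightarrow> \<iota> j \<in> Hom R M W" "j < c \<Longrightarrow> \<pi> j \<in> Hom R W M"
    "j < c \<Longrightarrow> k < c \<Longrightarrow> x \<in> carrier M \<Longrightarrow> \<pi> j (\<iota> k x) = (if j = k then x else \<zero>\<^bsub>M\<^esub>)"
    "w \<in> carrier W \<Longrightarrow> (\<Oplus>\<^bsub>W\<^esub>j\<in>{..<c}. \<iota> j (\<pi> j w)) = w"
  using assms unfolding is_power_def by blast+

lemma is_power_module_power:
  fixes M :: "('a, 'm) module"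
  assumes "left_module R M"
  obtains \<iota> where "is_power R M c (module_power M c) \<iota> (\<lambda>j xs. xs ! j)"
proof -
  interpret left_module R M by fact
  let ?W = "module_power M c"
  have LW: "left_module R ?W"
    by (rule left_module_direct_sum) (use assms R.ring_axioms in auto)
  interpret W: left_module R ?W by (rule LW)
  define \<iota> where "\<iota> j x = map (\<lambda>i. if i = j then x else \<zero>\<^bsub>M\<^esub>) [0..<length (replicate c M)]" for j :: nat and x
  have \<iota>: "\<iota> j \<in> Hom R M ?W" for j
    unfolding \<iota>_def
  proof (rule Hom_tuple)
    fix i assume "i < length (replicate c M)"
    then show "(\<lambda>x. if i = j then x else \<zero>\<^bsub>M\<^esub>) \<in> Hom R M (replicate c M ! i)"
      using Hom_id Hom_const_zero[OF assms] by (cases "i = j") auto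
  qed
  have \<pi>: "(\<lambda>xs. xs ! j) \<in> Hom R ?W M" if "j < c" for j
    using Hom_nth[of j "replicate c M" R] that by simp
  have sum: "(\<Oplus>\<^bsub>?W\<^esub>j\<in>{..<c}. \<iota> j (w ! j)) = w" (is "?s = w") if w: "w \<in> carrier ?W" for w
  proof (rule nth_equalityI)
    have c: "\<iota> j (w ! j) \<in> carrier ?W" if "j < c" for j
      using HomD(1)[OF \<iota>] w that by simp
    then have "?s \<in> carrier ?W" by (intro W.M.finsum_closed) auto
    then show len: "length ?s = length w" using w by simp
    fix i assume "i < length ?s"
    then have i: "i < c" using len w by simp
    have "?s ! i = (\<Oplus>\<^bsub>M\<^esub>j\<in>{..<c}. \<iota> j (w ! j) ! i)"
      using c by (intro left_module_hom_finsum[OF LW assms \<pi>[OF i]]) auto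
    also have "\<dots> = (\<Oplus>\<^bsub>M\<^esub>j\<in>{..<c}. if i = j then w ! j else \<zero>\<^bsub>M\<^esub>)"
      using i w by (intro M.finsum_cong') (auto simp: \<iota>_def)
    also have "\<dots> = w ! i" using i w by (intro M.finsum_singleton) auto
    finally show "?s ! i = w ! i" .
  qed
  have "is_power R M c ?W \<iota> (\<lambda>j xs. xs ! j)"
    unfolding is_power_def using assms LW \<iota> \<pi> sum by (auto simp: \<iota>_def)
  then show thesis by (rule that)
qed

text \<open>Moves the list model of a power into \<open>'a fgmod\<close>.\<close>

lemma is_power_iso:
  assumes W: "is_power R M c W \<iota> \<pi>" and L: "left_module R W'"
    and f: "f \<in> Hom R W W'" and g: "g \<in> Hom R W' W"
    and gf: "\<And>x. x \<in> carrier W \<Longrightarrow> g (f x) = x" and fg: "\<And>x. x \<in> carrier W' \<Longrightarrow> f (g x) = x"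
  shows "is_power R M c W' (\<lambda>j x. f (\<iota> j x)) (\<lambda>j x. \<pi> j (g x))"
  unfolding is_power_def
proof (intro conjI allI impI ballI)
  note W' = is_powerD[OF W]
  fix w assume w: "w \<in> carrier W'"
  have "(\<Oplus>\<^bsub>W'\<^esub>j\<in>{..<c}. f (\<iota> j (\<pi> j (g w)))) = f (\<Oplus>\<^bsub>W\<^esub>j\<in>{..<c}. \<iota> j (\<pi> j (g w)))"
    using HomD(1)[OF W'(3)] HomD(1)[OF W'(4)] HomD(1)[OF g] w
    by (intro left_module_hom_finsum[OF W'(2) L f, symmetric]) auto
  also have "\<dots> = w" using W'(6) w HomD(1)[OF g] fg by simp
  finally show "(\<Oplus>\<^bsub>W'\<^esub>j\<in>{..<c}. f (\<iota> j (\<pi> j (g w)))) = w" .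
next
  note W' = is_powerD[OF W]
  fix j k x assume "j < c" "k < c" "x \<in> carrier M"
  then show "\<pi> j (g (f (\<iota> k x))) = (if j = k then x else \<zero>\<^bsub>M\<^esub>)"
    using gf HomD(1)[OF W'(3)] W'(5) by simp
qed (auto intro: Hom_comp[OF _ f] Hom_comp[OF g] is_powerD[OF W] L)

lemma is_power_fg:
  assumes W: "is_power R M c W \<iota> \<pi>" and M: "fg_module R M"
  shows "fg_module R W"
proof -
  note W' = is_powerD[OF W]
  obtain A where A: "finite A" "A \<subseteq> carrier M" "\<And>U. submodule U R M \<Longrightarrow> A \<subseteq> U \<Longrightarrow> carrier M \<subseteq> U"
    using M by (auto simp: fg_module_iff_fgen fgen_def)
  let ?B = "\<Union>j\<in>{..<c}. \<iota> j ` A"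
  have "carrier W \<subseteq> U" if U: "submodule U R W" "?B \<subseteq> U" for U
  proof
    fix w assume w: "w \<in> carrier W"
    have "\<iota> j x \<in> U" if "j < c" "x \<in> carrier M" for j x
      using A(3)[OF submodule_vimage[OF W'(1,2) W'(3)[OF that(1)] U(1)]] U(2) A(2) that by blast
    then have "(\<Oplus>\<^bsub>W\<^esub>j\<in>{..<c}. \<iota> j (\<pi> j w)) \<in> U"
      using HomD(1)[OF W'(4)] w by (intro submodule_finsum[OF W'(2) U(1)]) auto
    then show "w \<in> U" using W'(6)[OF w] by simp
  qed
  moreover have "finite ?B" "?B \<subseteq> carrier W" using A HomD(1)[OF W'(3)] by auto
  ultimately have "fgen R W (carrier W)" unfolding fgen_def by (intro exI[of _ ?B]) simp
  with W'(2) show ?thesis by (simp add: fg_module_iff_fgen)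
qed

lemma power_exists:
  fixes M :: "('a, 'm) module"
  assumes "fg_module R M"
  obtains W :: "'a fgmod" and \<iota> \<pi> where "is_power R M c W \<iota> \<pi>" "fg_module R W"
proof -
  obtain \<iota> where 1: "is_power R M c (module_power M c) \<iota> (\<lambda>j xs. xs ! j)"
    by (rule is_power_module_power[OF fg_moduleD[OF assms]])
  obtain W :: "'a fgmod" and f g where W: "fg_module R W" "f \<in> Hom R (module_power M c) W"
    "g \<in> Hom R W (module_power M c)" "\<And>x. x \<in> carrier (module_power M c) \<Longrightarrow> g (f x) = x"
    "\<And>y. y \<in> carrier W \<Longrightarrow> f (g y) = y"
    by (rule fg_copy[OF is_power_fg[OF 1 assms]]) (rule that)
  show thesis by (rule that[OF is_power_iso[OF 1 fg_moduleD[OF W(1)] W(2-5)] W(1)])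
qed

lemma power_hom:
  assumes W: "is_power R M c W \<iota> \<pi>" and X: "left_module R X" and f: "\<And>j. j < c \<Longrightarrow> f j \<in> Hom R M X"
  shows "(\<lambda>w. \<Oplus>\<^bsub>X\<^esub>j\<in>{..<c}. f j (\<pi> j w)) \<in> Hom R W X"
    and "\<And>k x. k < c \<Longrightarrow> x \<in> carrier M \<Longrightarrow> (\<Oplus>\<^bsub>X\<^esub>j\<in>{..<c}. f j (\<pi> j (\<iota> k x))) = f k x"
proof -
  note W' = is_powerD[OF W]
  interpret X: left_module R X by fact
  show "(\<lambda>w. \<Oplus>\<^bsub>X\<^esub>j\<in>{..<c}. f j (\<pi> j w)) \<in> Hom R W X"
    by (rule Hom_finsum[OF X _ _ W'(2)]) (auto intro: Hom_comp[OF W'(4) f])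
  show "(\<Oplus>\<^bsub>X\<^esub>j\<in>{..<c}. f j (\<pi> j (\<iota> k x))) = f k x" if k: "k < c" "x \<in> carrier M" for k x
  proof -
    have "(\<Oplus>\<^bsub>X\<^esub>j\<in>{..<c}. f j (\<pi> j (\<iota> k x))) = (\<Oplus>\<^bsub>X\<^esub>j\<in>{..<c}. if k = j then f j x else \<zero>\<^bsub>X\<^esub>)"
      using k W'(5) Hom_zero[OF f W'(1) X] HomD(1)[OF f] by (intro X.M.finsum_cong') auto
    also have "\<dots> = f k x" using k HomD(1)[OF f] by (intro X.M.finsum_singleton) auto
    finally show ?thesis .
  qed
qed

lemma power_hom_eq:
  assumes W: "is_power R M c W \<iota> \<pi>" and X: "left_module R X" and f: "f \<in> Hom R W X" and w: "w \<in> carrier W"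
  shows "f w = (\<Oplus>\<^bsub>X\<^esub>j\<in>{..<c}. f (\<iota> j (\<pi> j w)))"
proof -
  note W' = is_powerD[OF W]
  have "f w = f (\<Oplus>\<^bsub>W\<^esub>j\<in>{..<c}. \<iota> j (\<pi> j w))" using W'(6) w by simp
  also have "\<dots> = (\<Oplus>\<^bsub>X\<^esub>j\<in>{..<c}. f (\<iota> j (\<pi> j w)))"
    using HomD(1)[OF W'(3)] HomD(1)[OF W'(4)] w by (intro left_module_hom_finsum[OF W'(2) X f]) auto
  finally show ?thesis .
qed

lemma projective_power:
  assumes W: "is_power R M c W \<iota> \<pi>" and M: "projective_module R M"
  shows "projective_module R W"
  unfolding projective_module_def
proof (intro conjI allI impI is_power_fg[OF W projectiveD(1)[OF M]])
  note W' = is_powerD[OF W]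
  fix X Y :: "'a fgmod" and p g
  assume X: "fg_module R X" "fg_module R Y" and p: "p \<in> epi_hom R X Y" and g: "g \<in> Hom R W Y"
  have ex: "\<exists>h. h \<in> Hom R M X \<and> (\<forall>x\<in>carrier M. p (h x) = g (\<iota> j x))" if "j < c" for j
    using projective_lift[OF M X p Hom_comp[OF W'(3)[OF that] g]] by metis
  define h where "h j = (SOME h. h \<in> Hom R M X \<and> (\<forall>x\<in>carrier M. p (h x) = g (\<iota> j x)))" for j
  have h: "h j \<in> Hom R M X" "\<And>x. x \<in> carrier M \<Longrightarrow> p (h j x) = g (\<iota> j x)" if "j < c" for j
    using someI_ex[OF ex[OF that]] by (auto simp: h_def)
  note LX = fg_moduleD[OF X(1)] fg_moduleD[OF X(2)]
  interpret Y: left_module R Y by (rule LX(2))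
  have "p (\<Oplus>\<^bsub>X\<^esub>j\<in>{..<c}. h j (\<pi> j w)) = g w" if w: "w \<in> carrier W" for w
  proof -
    have "p (\<Oplus>\<^bsub>X\<^esub>j\<in>{..<c}. h j (\<pi> j w)) = (\<Oplus>\<^bsub>Y\<^esub>j\<in>{..<c}. p (h j (\<pi> j w)))"
      using HomD(1)[OF W'(4)] HomD(1)[OF h(1)] w
      by (intro left_module_hom_finsum[OF LX epi_homD(1)[OF p]]) auto
    also have "\<dots> = (\<Oplus>\<^bsub>Y\<^esub>j\<in>{..<c}. g (\<iota> j (\<pi> j w)))"
      using HomD(1)[OF W'(4)] HomD(1)[OF W'(3)] HomD(1)[OF g] w h(2) by (intro Y.M.finsum_cong') auto
    also have "\<dots> = g w" by (rule power_hom_eq[OF W LX(2) g w, symmetric])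
    finally show ?thesis .
  qed
  then show "\<exists>h\<in>Hom R W X. \<forall>x\<in>carrier W. p (h x) = g x"
    by (intro bexI[OF _ power_hom(1)[OF W LX(1) h(1)]]) auto
qed

subsection \<open>Extension of homomorphisms from submodules\<close>

text \<open>For projective \<open>P\<close> this says Ext^1(P/N, Y) = 0. For general
  \<open>P\<close> it says that the pushout of the extension of \<open>P/N\<close> by
  \<open>N\<close> along any map from \<open>N\<close> to \<open>Y\<close> splits.\<close>

definition extends_from ::
    "('a, 'x) ring_scheme \<Rightarrow> ('a, 'm) module \<Rightarrow> 'm set \<Rightarrow> ('a, 'y) module \<Rightarrow> bool" where
  "extends_from R P N Y \<longleftrightarrow>
     (\<forall>h\<in>Hom R (P\<lparr>carrier := N\<rparr>) Y. \<exists>g\<in>Hom R P Y. \<forall>x\<in>N. g x = h x)"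

lemma extends_fromE:
  assumes "extends_from R P N Y" "h \<in> Hom R (P\<lparr>carrier := N\<rparr>) Y"
  obtains g where "g \<in> Hom R P Y" "\<And>x. x \<in> N \<Longrightarrow> g x = h x"
  using assms unfolding extends_from_def by blast

lemma extends_from_injective:
  assumes "injective_module R I" "fg_module R P" "submodule N R P" "fg_module R (P\<lparr>carrier := N\<rparr>)"
  shows "extends_from R P N I"
  unfolding extends_from_def
proof
  fix h assume h: "h \<in> Hom R (P\<lparr>carrier := N\<rparr>) I"
  have "(\<lambda>x. x) \<in> mono_hom R (P\<lparr>carrier := N\<rparr>) P"
    using Hom_incl[OF submoduleD(1)[OF assms(3)]] by (auto simp: mono_hom_def)
  from injective_extend[OF assms(1,4,2) this h]
  obtain g where "g \<in> Hom R P I" "\<And>x. x \<in> carrier (P\<lparr>carrier := N\<rparr>) \<Longrightarrow> g x = h x" by metis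
  then show "\<exists>g\<in>Hom R P I. \<forall>x\<in>N. g x = h x" by auto
qed

lemma extends_from_direct_sum:
  assumes "\<And>Z. Z \<in> set Zs \<Longrightarrow> extends_from R P N Z" "N \<subseteq> carrier P"
  shows "extends_from R P N (direct_sum Zs)"
  unfolding extends_from_def
proof
  fix h assume h: "h \<in> Hom R (P\<lparr>carrier := N\<rparr>) (direct_sum Zs)"
  have ex: "\<exists>g. g \<in> Hom R P (Zs ! i) \<and> (\<forall>x\<in>N. g x = h x ! i)" if "i < length Zs" for i
    using extends_fromE[OF assms(1)[OF nth_mem[OF that]] Hom_comp[OF h Hom_nth[OF that]]] by metis
  define g where "g i = (SOME g. g \<in> Hom R P (Zs ! i) \<and> (\<forall>x\<in>N. g x = h x ! i))" for i
  have g: "g i \<in> Hom R P (Zs ! i)" "\<And>x. x \<in> N \<Longrightarrow> g i x = h x ! i" if "i < length Zs" for i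
    using someI_ex[OF ex[OF that]] by (auto simp: g_def)
  have "map (\<lambda>i. g i x) [0..<length Zs] = h x" if "x \<in> N" for x
    using HomD(1)[OF h, of x] that g(2) by (intro nth_equalityI) auto
  then show "\<exists>g\<in>Hom R P (direct_sum Zs). \<forall>x\<in>N. g x = h x"
    by (intro bexI[OF _ Hom_tuple[OF g(1)]]) auto
qed

lemma extends_from_power:
  assumes "extends_from R P N M" "is_power R M c W \<iota> \<pi>" "left_module R P"
  shows "extends_from R P N W"
  unfolding extends_from_def
proof
  note W' = is_powerD[OF assms(2)]
  fix h assume h: "h \<in> Hom R (P\<lparr>carrier := N\<rparr>) W"
  have ex: "\<exists>g. g \<in> Hom R P M \<and> (\<forall>x\<in>N. g x = \<pi> j (h x))" if "j < c" for j
    using extends_fromE[OF assms(1) Hom_comp[OF h W'(4)[OF that]]] by metis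
  define g where "g j = (SOME g. g \<in> Hom R P M \<and> (\<forall>x\<in>N. g x = \<pi> j (h x)))" for j
  have g: "g j \<in> Hom R P M" "\<And>x. x \<in> N \<Longrightarrow> g j x = \<pi> j (h x)" if "j < c" for j
    using someI_ex[OF ex[OF that]] by (auto simp: g_def)
  interpret W: left_module R W by (rule W'(2))
  let ?h = "\<lambda>x. \<Oplus>\<^bsub>W\<^esub>j\<in>{..<c}. \<iota> j (g j x)"
  have eq: "?h x = h x" if "x \<in> N" for x
  proof -
    have hx: "h x \<in> carrier W" using HomD(1)[OF h] that by simp
    have "?h x = (\<Oplus>\<^bsub>W\<^esub>j\<in>{..<c}. \<iota> j (\<pi> j (h x)))"
      using HomD(1)[OF W'(3)] HomD(1)[OF W'(4)] hx that g(2) by (intro W.M.finsum_cong') auto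
    then show ?thesis using W'(6)[OF hx] by simp
  qed
  have "?h \<in> Hom R P W"
    by (rule Hom_finsum[OF W'(2) _ _ assms(3)]) (auto intro: Hom_comp[OF g(1) W'(3)])
  with eq show "\<exists>g\<in>Hom R P W. \<forall>x\<in>N. g x = h x" by (intro bexI[of _ ?h]) auto
qed

text \<open>Projectivity of \<open>N\<close> allows a map to \<open>Y\<close> to be lifted to
  \<open>Z\<close> before it is extended. For projective \<open>P\<close> this is the right
  exactness of Ext^1(P/N, _), where \<open>P/N\<close> has projective dimension at most one.\<close>

lemma extends_from_epi:
  fixes Z :: "('a, 'z) module" and Y :: "('a, 'y) module"
  assumes "extends_from R P N Z" "projective_module R (P\<lparr>carrier := N\<rparr>)"
    and "fg_module R Z" "fg_module R Y" "q \<in> epi_hom R Z Y"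
  shows "extends_from R P N Y"
  unfolding extends_from_def
proof
  fix h assume h: "h \<in> Hom R (P\<lparr>carrier := N\<rparr>) Y"
  obtain k where k: "k \<in> Hom R (P\<lparr>carrier := N\<rparr>) Z" "\<And>x. x \<in> carrier (P\<lparr>carrier := N\<rparr>) \<Longrightarrow> q (k x) = h x"
    by (rule projective_lift[OF assms(2-5) h]) (rule that)
  obtain g where g: "g \<in> Hom R P Z" "\<And>x. x \<in> N \<Longrightarrow> g x = k x"
    by (rule extends_fromE[OF assms(1) k(1)]) (rule that)
  have "q (g x) = h x" if "x \<in> N" for x using k(2) g(2) that by simp
  then show "\<exists>g\<in>Hom R P Y. \<forall>x\<in>N. g x = h x"
    by (intro bexI[OF _ Hom_comp[OF g(1) epi_homD(1)[OF assms(5)]]]) auto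
qed

section \<open>Vanishing of extension groups\<close>

lemma (in abelian_group) add_add_minus:
  assumes "a \<in> carrier G" "b \<in> carrier G" "c \<in> carrier G"
  shows "(a \<oplus> b) \<oplus> (c \<ominus> b) = a \<oplus> c"
proof -
  have "(a \<oplus> b) \<oplus> (c \<ominus> b) = a \<oplus> ((c \<ominus> b) \<oplus> b)"
    using assms by (simp add: a_assoc a_comm[of b "c \<ominus> b"])
  then show ?thesis using assms by (simp add: minus_add_cancel)
qed

section \<open>Free modules and enough projectives\<close>

lemma projective_regular:
  assumes "ring R" shows "projective_module R (regular_module R)"
  unfolding projective_module_def
proof (intro conjI allI impI fg_module_regular[OF assms])
  interpret R: ring R by fact
  fix X Y :: "'a fgmod" and p g
  assume X: "fg_module R X" "fg_module R Y" and p: "p \<in> epi_hom R X Y" and g: "g \<in> Hom R (regular_module R) Y"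
  interpret X: left_module R X by (rule fg_moduleD[OF X(1)])
  obtain x where x: "x \<in> carrier X" "p x = g \<one>\<^bsub>R\<^esub>"
    using epi_homD(2)[OF p, of "g \<one>\<^bsub>R\<^esub>"] HomD(1)[OF g] by auto
  have "(\<lambda>r. r \<odot>\<^bsub>X\<^esub> x) \<in> Hom R (regular_module R) X"
    using x by (intro HomI) (auto simp: X.smult_l_distr X.smult_assoc)
  moreover have "p (r \<odot>\<^bsub>X\<^esub> x) = g r" if "r \<in> carrier R" for r
    using HomD(3)[OF epi_homD(1)[OF p]] HomD(3)[OF g, of r "\<one>\<^bsub>R\<^esub>"] x that by simp
  ultimately show "\<exists>h\<in>Hom R (regular_module R) X. \<forall>x\<in>carrier (regular_module R). p (h x) = g x"
    by (intro bexI[of _ "\<lambda>r. r \<odot>\<^bsub>X\<^esub> x"]) auto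
qed

text \<open>The number \<open>c\<close> depends on \<open>X\<close> only, and the epimorphism exists
  from every model of the power. Over the endomorphism ring the model is Hom(T, W) with
  \<open>W\<close> a power of \<open>T\<close>, which can be chosen only after \<open>c\<close> is
  known.\<close>

lemma power_regular_epi:
  fixes X :: "('a, 'm) module"
  assumes "fg_module R X"
  obtains c where "\<And>(P :: ('a, 'p) module) \<iota> \<pi>. is_power R (regular_module R) c P \<iota> \<pi> \<Longrightarrow> \<exists>p. p \<in> epi_hom R P X"
proof -
  interpret X: left_module R X by (rule fg_moduleD[OF assms])
  obtain A where A: "finite A" "A \<subseteq> carrier X" "\<And>U. submodule U R X \<Longrightarrow> A \<subseteq> U \<Longrightarrow> carrier X \<subseteq> U"
    using assms by (auto simp: fg_module_iff_fgen fgen_def)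
  obtain as where as: "set as = A" using finite_list[OF A(1)] by blast
  let ?c = "length as"
  have h: "(\<lambda>r. r \<odot>\<^bsub>X\<^esub> (as ! j)) \<in> Hom R (regular_module R) X" if "j < ?c" for j
    using A(2) as nth_mem[OF that] by (intro HomI) (auto simp: X.smult_l_distr X.smult_assoc subset_iff)
  have "\<exists>p. p \<in> epi_hom R P X" if P: "is_power R (regular_module R) ?c P \<iota> \<pi>"
    for P :: "('a, 'p) module" and \<iota> \<pi>
  proof -
    define p where "p w = (\<Oplus>\<^bsub>X\<^esub>j\<in>{..<?c}. \<pi> j w \<odot>\<^bsub>X\<^esub> (as ! j))" for w
    have p: "p \<in> Hom R P X" unfolding p_def by (rule power_hom(1)[OF P X.left_module_axioms h])
    have p1: "p (\<iota> k \<one>\<^bsub>R\<^esub>) = as ! k" if "k < ?c" for k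
      using power_hom(2)[OF P X.left_module_axioms h that, where x = "\<one>\<^bsub>R\<^esub>"] A(2) as nth_mem[OF that]
      by (auto simp: p_def subset_iff)
    have "A \<subseteq> p ` carrier P"
    proof
      fix a assume "a \<in> A"
      then obtain k where k: "k < ?c" "as ! k = a" using as by (auto simp: in_set_conv_nth)
      show "a \<in> p ` carrier P"
        using p1[OF k(1)] k HomD(1)[OF is_powerD(3)[OF P k(1)], of "\<one>\<^bsub>R\<^esub>"] by (auto intro!: image_eqI)
    qed
    then have "carrier X \<subseteq> p ` carrier P"
      by (intro A(3) submodule_image[OF is_powerD(2)[OF P] X.left_module_axioms p]
          submodule_carrier[OF is_powerD(2)[OF P]])
    then have "p \<in> epi_hom R P X" using p by (intro epi_homI) auto
    then show ?thesis by blast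
  qed
  then show thesis by (rule that)
qed

lemma enough_projectives:
  fixes X :: "('a, 'm) module"
  assumes "fg_module R X"
  obtains P :: "'a fgmod" and p where "projective_module R P" "p \<in> epi_hom R P X"
proof -
  have R: "ring R" by (rule left_moduleD(1)[OF fg_moduleD[OF assms]])
  obtain c where c: "\<And>(P :: 'a fgmod) \<iota> \<pi>. is_power R (regular_module R) c P \<iota> \<pi> \<Longrightarrow> \<exists>p. p \<in> epi_hom R P X"
    by (rule power_regular_epi[OF assms]) (rule that)
  obtain P :: "'a fgmod" and \<iota> \<pi> where P: "is_power R (regular_module R) c P \<iota> \<pi>"
    by (rule power_exists[OF fg_module_regular[OF R]]) (rule that)
  from c[OF P] obtain p where "p \<in> epi_hom R P X" by blast
  with projective_power[OF P projective_regular[OF R]] show thesis by (rule that)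
qed

text \<open>\<open>Ext_zero R Y k X\<close> expresses \<open>Ext\<^sup>k\<^sup>+\<^sup>1(X, Y) = 0\<close> through the \<open>k\<close>-th syzygy in some projective
  resolution of \<open>X\<close>.\<close>

primrec Ext_zero ::
    "('a, 'x) ring_scheme \<Rightarrow> ('a, 'y) module \<Rightarrow> nat \<Rightarrow> 'a fgmod \<Rightarrow> bool" where
  "Ext_zero R Y 0 = (\<lambda>X. \<exists>(P :: 'a fgmod) p. projective_module R P \<and> p \<in> epi_hom R P X \<and>
     extends_from R P (a_kernel P X p) Y)"
| "Ext_zero R Y (Suc k) = (\<lambda>X. \<exists>(P :: 'a fgmod) p. projective_module R P \<and> p \<in> epi_hom R P X \<and>
     Ext_zero R Y k (Ker P X p))"

section \<open>Syzygies and vanishing of Ext over an artin algebra\<close>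

lemma kernel_iff: "x \<in> a_kernel P X p \<longleftrightarrow> x \<in> carrier P \<and> p x = \<zero>\<^bsub>X\<^esub>"
  by (simp add: a_kernel_def')

lemma Hom_to_Ker:
  "\<lbrakk>f \<in> Hom R Z P; \<And>z. z \<in> carrier Z \<Longrightarrow> p (f z) = \<zero>\<^bsub>X\<^esub>\<rbrakk> \<Longrightarrow> f \<in> Hom R Z (Ker P X p)"
  by (rule Hom_into_sub) (auto simp: kernel_iff HomD(1))

lemma Hom_from_Ker: "f \<in> Hom R P Z \<Longrightarrow> f \<in> Hom R (Ker P X p) Z"
  by (rule Hom_sub) (auto simp: kernel_iff)

lemma Ker_id: "(\<lambda>x. x) \<in> Hom R (Ker P X p) P"
  by (rule Hom_incl) (auto simp: kernel_iff)

lemma left_module_Ker: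
  "\<lbrakk>left_module R P; left_module R X; p \<in> Hom R P X\<rbrakk> \<Longrightarrow> left_module R (Ker P X p)"
  by (rule left_module_sub[OF _ submodule_kernel])

text \<open>Kept apart from \<open>T\<close>, because the opposite endomorphism ring is an instance
  as well; this is how kernels over it are known to be finitely generated.\<close>

locale artin_alg =
  fixes K :: "'k ring" and \<phi> :: "'k \<Rightarrow> 'a" and R :: "'a ring"
  assumes artin: "artin_algebra K \<phi> R"
begin

lemma is_ring: "ring R"
  using artin by (simp add: artin_algebra_def)

lemma fg_submodule: "\<lbrakk>fg_module R M; submodule S R M\<rbrakk> \<Longrightarrow> fg_module R (M\<lparr>carrier := S\<rparr>)"
  by (rule artin_algebra_fg_sub[OF artin])

lemma fg_Ker: "\<lbrakk>fg_module R P; left_module R X; p \<in> Hom R P X\<rbrakk> \<Longrightarrow> fg_module R (Ker P X p)"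
  by (rule fg_submodule[OF _ submodule_kernel[OF fg_moduleD]])

text \<open>Lifting \<open>a\<close>, \<open>b\<close> and \<open>w\<close> to the projective
  modules leaves the error \<open>e = id - v u - w' s p'\<close>, which has values in the kernel of
  \<open>p'\<close>; on this kernel the last term vanishes. So on the kernels
  \<open>id - v u\<close> factors through the projective module \<open>P'\<close>, and the situation
  repeats one syzygy further.\<close>

lemma stable_retract_comparison:
  fixes X X' W P P' :: "'a fgmod"
  assumes X: "fg_module R X" "fg_module R X'" and a: "a \<in> Hom R X X'" and b: "b \<in> Hom R X' X"
    and W: "projective_module R W" and s: "s \<in> Hom R X' W" and w: "w \<in> Hom R W X'"
    and id: "\<And>x. x \<in> carrier X' \<Longrightarrow> x = a (b x) \<oplus>\<^bsub>X'\<^esub> w (s x)"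
    and P: "projective_module R P" "p \<in> epi_hom R P X"
    and P': "projective_module R P'" "p' \<in> epi_hom R P' X'"
  obtains u v e where "u \<in> Hom R (Ker P' X' p') (Ker P X p)" "u \<in> Hom R P' P"
    "v \<in> Hom R (Ker P X p) (Ker P' X' p')" "e \<in> Hom R P' (Ker P' X' p')"
    "\<And>x. x \<in> a_kernel P' X' p' \<Longrightarrow> x = v (u x) \<oplus>\<^bsub>P'\<^esub> e x"
proof -
  note LX = fg_moduleD[OF X(1)] fg_moduleD[OF X(2)]
  note LP = projectiveD(2)[OF P(1)] projectiveD(2)[OF P'(1)]
  note p = epi_homD(1)[OF P(2)] and p' = epi_homD(1)[OF P'(2)]
  interpret P': left_module R P' by (rule LP(2))
  interpret X': left_module R X' by (rule LX(2))
  obtain u where u: "u \<in> Hom R P' P" "\<And>x. x \<in> carrier P' \<Longrightarrow> p (u x) = b (p' x)"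
    by (rule projective_lift[OF P'(1) projectiveD(1)[OF P(1)] X(1) P(2) Hom_comp[OF p' b]]) (rule that)
  obtain v where v: "v \<in> Hom R P P'" "\<And>x. x \<in> carrier P \<Longrightarrow> p' (v x) = a (p x)"
    by (rule projective_lift[OF P(1) projectiveD(1)[OF P'(1)] X(2) P'(2) Hom_comp[OF p a]]) (rule that)
  obtain w' where w': "w' \<in> Hom R W P'" "\<And>x. x \<in> carrier W \<Longrightarrow> p' (w' x) = w x"
    by (rule projective_lift[OF W projectiveD(1)[OF P'(1)] X(2) P'(2) w]) (rule that)
  define e where "e x = (x \<ominus>\<^bsub>P'\<^esub> v (u x)) \<ominus>\<^bsub>P'\<^esub> w' (s (p' x))" for x
  have e: "e \<in> Hom R P' P'"
    unfolding e_def
    by (intro Hom_diff[OF LP(2)] Hom_id Hom_comp[OF u(1) v(1)] Hom_comp[OF Hom_comp[OF p' s] w'(1)])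
  have c: "p' x \<in> carrier X'" "v (u x) \<in> carrier P'" "u x \<in> carrier P" "s (p' x) \<in> carrier W"
    "w' (s (p' x)) \<in> carrier P'" if "x \<in> carrier P'" for x
    using that HomD(1)[OF p'] HomD(1)[OF u(1)] HomD(1)[OF v(1)] HomD(1)[OF s] HomD(1)[OF w'(1)] by auto
  have pe: "p' (e x) = \<zero>\<^bsub>X'\<^esub>" if x: "x \<in> carrier P'" for x
  proof -
    let ?z = "p' x"
    have "p' (e x) = (?z \<ominus>\<^bsub>X'\<^esub> a (b ?z)) \<ominus>\<^bsub>X'\<^esub> w (s ?z)"
      using x c[OF x] by (simp add: e_def Hom_minus[OF p' LP(2) LX(2)] u(2) v(2) w'(2))
    moreover have "a (b ?z) \<in> carrier X'" "w (s ?z) \<in> carrier X'"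
      using c[OF x] HomD(1)[OF a] HomD(1)[OF b] HomD(1)[OF w] by auto
    moreover have "?z \<ominus>\<^bsub>X'\<^esub> a (b ?z) = (a (b ?z) \<oplus>\<^bsub>X'\<^esub> w (s ?z)) \<ominus>\<^bsub>X'\<^esub> a (b ?z)"
      using id[OF c(1)[OF x]] by (rule arg_cong)
    ultimately show ?thesis by (simp add: X'.M.add_minus_cancel_left X'.M.minus_self)
  qed
  have ke: "x = v (u x) \<oplus>\<^bsub>P'\<^esub> e x" if "x \<in> a_kernel P' X' p'" for x
  proof -
    have x: "x \<in> carrier P'" "p' x = \<zero>\<^bsub>X'\<^esub>" using that by (auto simp: kernel_iff)
    have "w' (s (p' x)) = \<zero>\<^bsub>P'\<^esub>"
      using x Hom_zero[OF s LX(2) projectiveD(2)[OF W]] Hom_zero[OF w'(1) projectiveD(2)[OF W] LP(2)] by simp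
    then have "e x = x \<ominus>\<^bsub>P'\<^esub> v (u x)" using x c[OF x(1)] by (simp add: e_def P'.M.minus_zero_right)
    moreover have "v (u x) \<oplus>\<^bsub>P'\<^esub> (x \<ominus>\<^bsub>P'\<^esub> v (u x)) = (x \<ominus>\<^bsub>P'\<^esub> v (u x)) \<oplus>\<^bsub>P'\<^esub> v (u x)"
      using x c[OF x(1)] by (intro P'.M.a_comm) auto
    ultimately show ?thesis using x c[OF x(1)] by (simp add: P'.M.minus_add_cancel)
  qed
  have "u \<in> Hom R (Ker P' X' p') (Ker P X p)"
    using u(2) Hom_zero[OF b LX(2,1)] by (intro Hom_to_Ker Hom_from_Ker u(1)) (auto simp: kernel_iff)
  moreover have "v \<in> Hom R (Ker P X p) (Ker P' X' p')"
    using v(2) Hom_zero[OF a LX] by (intro Hom_to_Ker Hom_from_Ker v(1)) (auto simp: kernel_iff)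
  moreover have "e \<in> Hom R P' (Ker P' X' p')" using pe by (intro Hom_to_Ker e)
  ultimately show thesis using u(1) ke by (intro that)
qed

text \<open>If \<open>id - a b\<close> factors through a projective module, then \<open>X'\<close> is a stable retract of \<open>X\<close>,
  and its syzygies are stable retracts of those of \<open>X\<close>.\<close>

lemma Ext_zero_stable_retract_all:
  fixes X X' W P' :: "'a fgmod"
  assumes "left_module R Y" "Ext_zero R Y k X" "fg_module R X" "fg_module R X'"
    and "a \<in> Hom R X X'" "b \<in> Hom R X' X"
    and "projective_module R W" "s \<in> Hom R X' W" "w \<in> Hom R W X'"
    and "\<And>x. x \<in> carrier X' \<Longrightarrow> x = a (b x) \<oplus>\<^bsub>X'\<^esub> w (s x)"
    and "projective_module R P'" "p' \<in> epi_hom R P' X'"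
  shows "case k of 0 \<Rightarrow> extends_from R P' (a_kernel P' X' p') Y | Suc j \<Rightarrow> Ext_zero R Y j (Ker P' X' p')"
  using assms(2-)
proof (induction k arbitrary: X X' a b W s w P' p')
  case (0 X X' a b W s w P' p')
  interpret Y: left_module R Y by (rule assms(1))
  obtain P :: "'a fgmod" and p where P: "projective_module R P" "p \<in> epi_hom R P X"
    and ext: "extends_from R P (a_kernel P X p) Y" using 0(1) by auto
  obtain u v e where u: "u \<in> Hom R (Ker P' X' p') (Ker P X p)" "u \<in> Hom R P' P"
    and v: "v \<in> Hom R (Ker P X p) (Ker P' X' p')" and e: "e \<in> Hom R P' (Ker P' X' p')"
    and eq: "\<And>x. x \<in> a_kernel P' X' p' \<Longrightarrow> x = v (u x) \<oplus>\<^bsub>P'\<^esub> e x"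
    by (rule stable_retract_comparison[OF 0(2-9) P 0(10,11)]) (assumption | rule that)+
  have "extends_from R P' (a_kernel P' X' p') Y"
    unfolding extends_from_def
  proof
    fix f assume f: "f \<in> Hom R (Ker P' X' p') Y"
    obtain g where g: "g \<in> Hom R P Y" "\<And>x. x \<in> a_kernel P X p \<Longrightarrow> g x = f (v x)"
      by (rule extends_fromE[OF ext Hom_comp[OF v f]]) (rule that)
    \<comment> \<open>Both \<open>u\<close> and \<open>e\<close> are defined on all of
      \<open>P'\<close>, so the sum of \<open>g u\<close> and \<open>f e\<close> is the required
      extension of \<open>f\<close>.\<close>
    have "g (u x) \<oplus>\<^bsub>Y\<^esub> f (e x) = f x" if x: "x \<in> a_kernel P' X' p'" for x
    proof -
      have c: "u x \<in> a_kernel P X p" "v (u x) \<in> a_kernel P' X' p'" "e x \<in> a_kernel P' X' p'"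
        using x HomD(1)[OF u(1)] HomD(1)[OF v] HomD(1)[OF e] by (auto simp: kernel_iff)
      have "f x = f (v (u x) \<oplus>\<^bsub>P'\<^esub> e x)" using eq[OF x] by (rule arg_cong)
      also have "\<dots> = f (v (u x)) \<oplus>\<^bsub>Y\<^esub> f (e x)" using HomD(2)[OF f, of "v (u x)" "e x"] c by simp
      finally show ?thesis using g(2)[OF c(1)] by simp
    qed
    then show "\<exists>g\<in>Hom R P' Y. \<forall>x\<in>a_kernel P' X' p'. g x = f x"
      by (intro bexI[OF _ Hom_plus[OF assms(1) Hom_comp[OF u(2) g(1)] Hom_comp[OF e f]]]) auto
  qed
  then show ?case by simp
next
  case (Suc k X X' a b W s w P' p')
  obtain P :: "'a fgmod" and p where P: "projective_module R P" "p \<in> epi_hom R P X"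
    and ext: "Ext_zero R Y k (Ker P X p)" using Suc(2) by auto
  obtain u v e where u: "u \<in> Hom R (Ker P' X' p') (Ker P X p)" "u \<in> Hom R P' P"
    and v: "v \<in> Hom R (Ker P X p) (Ker P' X' p')" and e: "e \<in> Hom R P' (Ker P' X' p')"
    and eq: "\<And>x. x \<in> a_kernel P' X' p' \<Longrightarrow> x = v (u x) \<oplus>\<^bsub>P'\<^esub> e x"
    by (rule stable_retract_comparison[OF Suc(3-10) P Suc(11,12)]) (assumption | rule that)+
  have fg: "fg_module R (Ker P X p)" "fg_module R (Ker P' X' p')"
    using fg_Ker[OF projectiveD(1)[OF P(1)] fg_moduleD[OF Suc(3)] epi_homD(1)[OF P(2)]]
      fg_Ker[OF projectiveD(1)[OF Suc(11)] fg_moduleD[OF Suc(4)] epi_homD(1)[OF Suc(12)]] by auto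
  obtain P'' :: "'a fgmod" and p'' where P'': "projective_module R P''" "p'' \<in> epi_hom R P'' (Ker P' X' p')"
    by (rule enough_projectives[OF fg(2)])
  \<comment> \<open>The projective module through which the error factors is now \<open>P'\<close>,
    by the inclusion of the kernel followed by \<open>e\<close>.\<close>
  have "case k of 0 \<Rightarrow> extends_from R P'' (a_kernel P'' (Ker P' X' p') p'') Y
    | Suc j \<Rightarrow> Ext_zero R Y j (Ker P'' (Ker P' X' p') p'')"
    by (rule Suc(1)[OF ext fg v u(1) Suc(11) Ker_id e _ P'']) (use eq in auto)
  then show ?case using P'' by (cases k) auto
qed

lemma Ext_zero_stable_retract:
  fixes X X' W :: "'a fgmod"
  assumes "left_module R Y" "Ext_zero R Y k X" "fg_module R X" "fg_module R X'"
    and "a \<in> Hom R X X'" "b \<in> Hom R X' X"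
    and "projective_module R W" "s \<in> Hom R X' W" "w \<in> Hom R W X'"
    and "\<And>x. x \<in> carrier X' \<Longrightarrow> x = a (b x) \<oplus>\<^bsub>X'\<^esub> w (s x)"
  shows "Ext_zero R Y k X'"
proof -
  obtain P :: "'a fgmod" and p where P: "projective_module R P" "p \<in> epi_hom R P X'"
    by (rule enough_projectives[OF assms(4)])
  from Ext_zero_stable_retract_all[OF assms P] P show ?thesis by (cases k) auto
qed

text \<open>Every module is a stable retract of itself, by identities and zero maps, so the
  resolution chosen in \<open>Ext_zero\<close> does not matter.\<close>

lemma Ext_zero_all:
  fixes X P :: "'a fgmod"
  assumes "left_module R Y" "Ext_zero R Y k X" "fg_module R X"
    and "projective_module R P" "p \<in> epi_hom R P X"
  shows "case k of 0 \<Rightarrow> extends_from R P (a_kernel P X p) Y | Suc j \<Rightarrow> Ext_zero R Y j (Ker P X p)"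
proof -
  note LP = projectiveD(2)[OF assms(4)]
  interpret X: left_module R X by (rule fg_moduleD[OF assms(3)])
  show ?thesis
    by (rule Ext_zero_stable_retract_all[OF assms(1-3,3) Hom_id Hom_id assms(4) Hom_const_zero[OF LP]
          Hom_const_zero[OF X.left_module_axioms] _ assms(4,5)]) simp
qed

text \<open>Dimension shift: the syzygy of \<open>X\<close> given by \<open>P \<rightarrow> W \<rightarrow> X\<close> maps onto \<open>ker q\<close> with the projective
  kernel of \<open>P \<rightarrow> W\<close>.\<close>

lemma Ext_zero_shift:
  fixes X W P :: "'a fgmod"
  assumes Y: "left_module R Y" and ext: "Ext_zero R Y (Suc k) X" and X: "fg_module R X"
    and W: "fg_module R W" and q: "q \<in> epi_hom R W X"
    and P: "projective_module R P" "r \<in> epi_hom R P W" "projective_module R (Ker P W r)"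
    and ext': "extends_from R P (a_kernel P W r) Y"
  shows "Ext_zero R Y k (Ker W X q)"
proof -
  note LW = fg_moduleD[OF W] and LX = fg_moduleD[OF X] and LP = projectiveD(2)[OF P(1)]
  note q1 = epi_homD(1)[OF q] and r1 = epi_homD(1)[OF P(2)]
  interpret Y: left_module R Y by (rule Y)
  interpret W: left_module R W by (rule LW)
  let ?p = "\<lambda>x. q (r x)"
  have p: "?p \<in> epi_hom R P X" by (rule epi_comp[OF P(2) q])
  note p1 = epi_homD(1)[OF p]
  let ?N = "Ker P X ?p"
  have fgN: "fg_module R ?N" by (rule fg_Ker[OF projectiveD(1)[OF P(1)] LX p1])
  have extN: "Ext_zero R Y k ?N" using Ext_zero_all[OF Y ext X P(1) p] by simp
  have rN: "r \<in> epi_hom R ?N (Ker W X q)"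
  proof (rule epi_homI)
    show "r \<in> Hom R ?N (Ker W X q)" by (intro Hom_to_Ker Hom_from_Ker r1) (simp add: kernel_iff)
    fix y assume "y \<in> carrier (Ker W X q)"
    then have y: "y \<in> carrier W" "q y = \<zero>\<^bsub>X\<^esub>" by (auto simp: kernel_iff)
    then obtain x where "x \<in> carrier P" "r x = y" using epi_homD(2)[OF P(2)] by blast
    with y show "\<exists>x\<in>carrier ?N. r x = y" by (auto simp: kernel_iff)
  qed
  have LKW: "left_module R (Ker W X q)" by (rule left_module_Ker[OF LW LX q1])
  show ?thesis
  proof -
    obtain P2 :: "'a fgmod" and p2 where P2: "projective_module R P2" "p2 \<in> epi_hom R P2 ?N"
      by (rule enough_projectives[OF fgN])
    note LP2 = projectiveD(2)[OF P2(1)] and p2 = epi_homD(1)[OF P2(2)]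
    interpret P2: left_module R P2 by (rule LP2)
    have LN: "left_module R ?N" by (rule fg_moduleD[OF fgN])
    have p2P: "p2 \<in> Hom R P2 P" by (rule Hom_from_sub[OF p2]) (auto simp: kernel_iff)
    let ?rp = "\<lambda>x. r (p2 x)"
    have rp: "?rp \<in> epi_hom R P2 (Ker W X q)" by (rule epi_comp[OF P2(2) rN])
    \<comment> \<open>\<open>?M\<close> is the second syzygy of \<open>X\<close> and
      \<open>?M'\<close> the first syzygy of the kernel of \<open>q\<close>, both inside
      \<open>P2\<close>. Their quotient is \<open>?L\<close>, and since this is projective,
      \<open>?M'\<close> is the direct sum of \<open>?M\<close> and a copy of
      \<open>?L\<close>.\<close>
    let ?M = "Ker P2 ?N p2" and ?M' = "Ker P2 (Ker W X q) ?rp" and ?L = "Ker P W r"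
    have LM': "left_module R ?M'" by (rule left_module_Ker[OF LP2 LKW epi_homD(1)[OF rp]])
    have LN0: "left_module R ?L" by (rule left_module_Ker[OF LP LW r1])
    have M': "x \<in> carrier ?M' \<longleftrightarrow> x \<in> carrier P2 \<and> r (p2 x) = \<zero>\<^bsub>W\<^esub>" for x by (simp add: kernel_iff)
    have M: "x \<in> carrier ?M \<longleftrightarrow> x \<in> carrier P2 \<and> p2 x = \<zero>\<^bsub>P\<^esub>" for x by (simp add: kernel_iff)
    have N0: "x \<in> carrier ?L \<longleftrightarrow> x \<in> carrier P \<and> r x = \<zero>\<^bsub>W\<^esub>" for x by (simp add: kernel_iff)
    have MM': "carrier ?M \<subseteq> carrier ?M'" unfolding subset_iff M M' using Hom_zero[OF r1 LP LW] by auto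
    have \<rho>: "p2 \<in> epi_hom R ?M' ?L"
    proof (rule epi_homI)
      show "p2 \<in> Hom R ?M' ?L" by (intro Hom_to_Ker Hom_from_Ker p2P) (simp add: kernel_iff)
      fix y assume "y \<in> carrier ?L"
      then have y: "y \<in> carrier P" "r y = \<zero>\<^bsub>W\<^esub>" by (auto simp: kernel_iff)
      then have yN: "y \<in> a_kernel P X (\<lambda>x. q (r x))" using Hom_zero[OF q1 LW LX] by (simp add: kernel_iff)
      have "\<exists>x\<in>carrier P2. p2 x = y" by (rule epi_homD(2)[OF P2(2)]) (use yN in simp)
      then obtain x where "x \<in> carrier P2" "p2 x = y" by blast
      with y show "\<exists>x\<in>carrier ?M'. p2 x = y" by (auto simp: kernel_iff)
    qed
    have fgM': "fg_module R ?M'" by (rule fg_Ker[OF projectiveD(1)[OF P2(1)] LKW epi_homD(1)[OF rp]])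
    have fgM: "fg_module R ?M" by (rule fg_Ker[OF projectiveD(1)[OF P2(1)] LN p2])
    obtain \<sigma> where \<sigma>: "\<sigma> \<in> Hom R ?L ?M'" "\<And>x. x \<in> carrier ?L \<Longrightarrow> p2 (\<sigma> x) = x"
      by (rule projective_section[OF P(3) fgM' \<rho>]) (rule that)
    have \<sigma>P: "\<sigma> \<in> Hom R ?L P2" by (rule Hom_from_sub[OF \<sigma>(1)]) (simp add: subset_iff kernel_iff)
    have p2N0: "p2 x \<in> carrier ?L" if "x \<in> carrier ?M'" for x using HomD(1)[OF epi_homD(1)[OF \<rho>]] that .
    let ?d = "\<lambda>x. x \<ominus>\<^bsub>P2\<^esub> \<sigma> (p2 x)"
    have dP: "?d \<in> Hom R ?M' P2"
      by (intro Hom_diff[OF LP2] Hom_comp[OF epi_homD(1)[OF \<rho>] \<sigma>P] Ker_id)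
    have dz: "p2 (?d x) = \<zero>\<^bsub>P\<^esub>" if x: "x \<in> carrier ?M'" for x
    proof -
      interpret P: left_module R P by (rule LP)
      have "p2 x \<in> carrier P" using p2N0[OF x] N0 by blast
      then show ?thesis
        using x \<sigma>(2)[OF p2N0[OF x]] HomD(1)[OF \<sigma>P p2N0[OF x]]
        by (simp add: kernel_iff Hom_minus[OF p2P LP2 LP] P.M.minus_self)
    qed
    have d: "?d \<in> Hom R ?M' ?M"
      by (rule Hom_into_sub[OF dP]) (use dz HomD(1)[OF dP] in \<open>simp add: kernel_iff\<close>)
    have split: "x = ?d x \<oplus>\<^bsub>P2\<^esub> \<sigma> (p2 x)" if x: "x \<in> carrier ?M'" for x
      using x HomD(1)[OF \<sigma>P p2N0[OF x]] by (simp add: kernel_iff P2.M.minus_add_cancel)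
    \<comment> \<open>The long exact sequence asks for Ext^(k+1)(W, Y) = 0. For \<open>k = 0\<close>
      this is \<open>ext'\<close>; for larger \<open>k\<close> it holds because the syzygy
      \<open>?L\<close> of \<open>W\<close> is projective.\<close>
    show ?thesis
    proof (cases k)
      case 0
      have ext2: "extends_from R P2 (a_kernel P2 ?N p2) Y"
        using Ext_zero_all[OF Y extN fgN P2] 0 by simp
      have "extends_from R P2 (a_kernel P2 (Ker W X q) ?rp) Y"
        unfolding extends_from_def
      proof
        fix f assume f: "f \<in> Hom R ?M' Y"
        have fM: "f \<in> Hom R ?M Y"
          using Hom_sub[OF f MM'] by simp
        obtain g where g: "g \<in> Hom R P2 Y" "\<And>x. x \<in> a_kernel P2 ?N p2 \<Longrightarrow> g x = f x"
          by (rule extends_fromE[OF ext2 fM]) (rule that)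
        have "(\<lambda>x. f (\<sigma> x) \<ominus>\<^bsub>Y\<^esub> g (\<sigma> x)) \<in> Hom R ?L Y"
          by (intro Hom_diff[OF Y] Hom_comp[OF \<sigma>(1) f] Hom_comp[OF \<sigma>P g(1)])
        \<comment> \<open>\<open>g\<close> is only known to agree with \<open>f\<close> on
          \<open>?M\<close>. On the complement the difference is a map from \<open>?L\<close>; its
          extension to \<open>P\<close> corrects \<open>g\<close>.\<close>
        from extends_fromE[OF ext' this] obtain G where G: "G \<in> Hom R P Y"
          "\<And>x. x \<in> a_kernel P W r \<Longrightarrow> G x = f (\<sigma> x) \<ominus>\<^bsub>Y\<^esub> g (\<sigma> x)" by metis
        have "g x \<oplus>\<^bsub>Y\<^esub> G (p2 x) = f x" if x: "x \<in> carrier ?M'" for x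
        proof -
          let ?s = "\<sigma> (p2 x)"
          have c: "?s \<in> carrier ?M'" "?d x \<in> carrier ?M" "?d x \<in> carrier ?M'" "?s \<in> carrier P2" "?d x \<in> carrier P2"
            using HomD(1)[OF \<sigma>(1) p2N0[OF x]] HomD(1)[OF d x] MM' HomD(1)[OF \<sigma>P p2N0[OF x]] HomD(1)[OF dP x]
            by (simp_all add: subset_iff)
          have cY: "f (?d x) \<in> carrier Y" "f ?s \<in> carrier Y" "g ?s \<in> carrier Y"
            using HomD(1)[OF f] HomD(1)[OF g(1)] c by blast+
          have fx: "f x = f (?d x) \<oplus>\<^bsub>Y\<^esub> f ?s"
            using arg_cong[OF split[OF x], of f] HomD(2)[OF f c(3,1)] by simp
          have gx: "g x = f (?d x) \<oplus>\<^bsub>Y\<^esub> g ?s"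
            using arg_cong[OF split[OF x], of g] HomD(2)[OF g(1) c(5,4)] g(2)[of "?d x"] c(2) by simp
          have Gx: "G (p2 x) = f ?s \<ominus>\<^bsub>Y\<^esub> g ?s" using G(2) p2N0[OF x] by simp
          show ?thesis unfolding fx gx Gx using cY
            by (simp add: Y.M.add_add_minus)
        qed
        then show "\<exists>g\<in>Hom R P2 Y. \<forall>x\<in>a_kernel P2 (Ker W X q) ?rp. g x = f x"
          by (intro bexI[OF _ Hom_plus[OF Y g(1) Hom_comp[OF p2P G(1)]]]) auto
      qed
      with P2(1) rp 0 show ?thesis by auto
    next
      case (Suc j)
      have extM: "Ext_zero R Y j ?M" using Ext_zero_all[OF Y extN fgN P2] Suc by simp
      have incl: "(\<lambda>x. x) \<in> Hom R ?M ?M'" using MM' by (intro HomI) auto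
      \<comment> \<open>\<open>?M'\<close> is a stable retract of \<open>?M\<close>, with the error
        factoring through the projective module \<open>?L\<close>.\<close>
      have "Ext_zero R Y j ?M'"
        by (rule Ext_zero_stable_retract[OF Y extM fgM fgM' incl d P(3) epi_homD(1)[OF \<rho>] \<sigma>(1)])
          (use split in simp)
      with P2(1) rp Suc show ?thesis by auto
    qed
  qed
qed

text \<open>Since \<open>P 2\<close> is zero, exactness makes \<open>d 0\<close> injective, so it
  identifies \<open>P 1\<close> with the first syzygy.\<close>

lemma projective_syzygy:
  fixes M :: "('a, 'm) module"
  assumes "fg_module R M" "projective_resolution R M P \<epsilon> d" "\<And>i. i > 1 \<Longrightarrow> is_zero_module (P i)"
  shows "projective_module R (Ker (P 0) M \<epsilon>)"
proof -
  have P: "projective_module R (P i)" "d i \<in> Hom R (P (Suc i)) (P i)" for i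
    using assms(2) by (auto simp: projective_resolution_def)
  have \<epsilon>: "\<epsilon> \<in> epi_hom R (P 0) M" and k0: "d 0 ` carrier (P 1) = a_kernel (P 0) M \<epsilon>"
    and k1: "d 1 ` carrier (P 2) = a_kernel (P 1) (P 0) (d 0)"
    using assms(2) by (auto simp: projective_resolution_def numeral_2_eq_2)
  note LP = projectiveD(2)[OF P(1)]
  have d0: "d 0 \<in> Hom R (P 1) (P 0)" and d1: "d 1 \<in> Hom R (P 2) (P 1)" using P(2)[of 0] P(2)[of 1] by (simp_all add: numeral_2_eq_2)
  have z: "a_kernel (P 1) (P 0) (d 0) = {\<zero>\<^bsub>P 1\<^esub>}"
    using assms(3)[of 2] k1 Hom_zero[OF d1 LP LP] by (simp add: is_zero_module_def)
  have S: "submodule (a_kernel (P 0) M \<epsilon>) R (P 0)"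
    by (rule submodule_kernel[OF LP fg_moduleD[OF assms(1)] epi_homD(1)[OF \<epsilon>]])
  have fgK: "fg_module R (Ker (P 0) M \<epsilon>)" by (rule fg_submodule[OF projectiveD(1)[OF P(1)] S])
  have dK: "d 0 \<in> Hom R (P 1) (Ker (P 0) M \<epsilon>)"
    by (rule Hom_into_sub[OF d0]) (use k0 in blast)
  have inj: "inj_on (d 0) (carrier (P 1))"
  proof (rule inj_onI)
    interpret P0: left_module R "P 0" by (rule LP)
    interpret P1: left_module R "P 1" by (rule LP)
    fix x y assume xy: "x \<in> carrier (P 1)" "y \<in> carrier (P 1)" "d 0 x = d 0 y"
    have "x \<ominus>\<^bsub>P 1\<^esub> y \<in> a_kernel (P 1) (P 0) (d 0)"
      using P1.M.minus_closed[OF xy(1,2)] Hom_minus[OF d0 LP LP xy(1,2)] HomD(1)[OF d0 xy(2)] xy(3)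
      by (simp add: kernel_iff P0.M.minus_self)
    then show "x = y" using xy unfolding z using P1.M.minus_eq_zeroD by blast
  qed
  obtain g where g: "g \<in> Hom R (Ker (P 0) M \<epsilon>) (P 1)" "\<And>x. x \<in> carrier (P 1) \<Longrightarrow> g (d 0 x) = x"
    "\<And>y. y \<in> carrier (Ker (P 0) M \<epsilon>) \<Longrightarrow> d 0 (g y) = y"
    by (rule Hom_inv[OF LP dK inj]) (use k0 in simp, rule that)
  show ?thesis
    by (rule projective_retract[OF P(1) fgK g(1) dK g(3)])
qed

text \<open>For the modules \<open>Y\<close> considered here, \<open>Ext\<^sup>k\<^sup>+\<^sup>1(M, Y)\<close> already vanishes if \<open>M\<close> has projective
  dimension \<open>k + 1\<close>, not only if it has projective dimension \<open>k\<close>.\<close>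

lemma Ext_zero_resolution:
  fixes M :: "'a fgmod"
  assumes Y: "\<And>P N. \<lbrakk>projective_module R (P :: 'a fgmod); submodule N R P;
      projective_module R (P\<lparr>carrier := N\<rparr>)\<rbrakk> \<Longrightarrow> extends_from R P N Y"
    and "fg_module R M" "projective_resolution R M P \<epsilon> d" "\<And>i. i > Suc k \<Longrightarrow> is_zero_module (P i)"
  shows "Ext_zero R Y k M"
  using assms(2-)
proof (induction k arbitrary: M P \<epsilon> d)
  case (0 M P \<epsilon> d)
  have P: "projective_module R (P 0)" and \<epsilon>: "\<epsilon> \<in> epi_hom R (P 0) M"
    using 0(2) by (auto simp: projective_resolution_def)
  have S: "submodule (a_kernel (P 0) M \<epsilon>) R (P 0)"
    by (rule submodule_kernel[OF projectiveD(2)[OF P] fg_moduleD[OF 0(1)] epi_homD(1)[OF \<epsilon>]])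
  have "projective_module R (Ker (P 0) M \<epsilon>)" by (rule projective_syzygy[OF 0(1,2)]) (use 0(3) in simp)
  then have "extends_from R (P 0) (a_kernel (P 0) M \<epsilon>) Y" by (rule Y[OF P S])
  with P \<epsilon> show ?case by auto
next
  case (Suc k M P \<epsilon> d)
  have P: "projective_module R (P i)" "d i \<in> Hom R (P (Suc i)) (P i)" for i
    using Suc(3) by (auto simp: projective_resolution_def)
  have \<epsilon>: "\<epsilon> \<in> epi_hom R (P 0) M" and k0: "d 0 ` carrier (P 1) = a_kernel (P 0) M \<epsilon>"
    and kS: "d (Suc i) ` carrier (P (Suc (Suc i))) = a_kernel (P (Suc i)) (P i) (d i)" for i
    using Suc(3) by (auto simp: projective_resolution_def)
  have fgK: "fg_module R (Ker (P 0) M \<epsilon>)"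
    by (rule fg_Ker[OF projectiveD(1)[OF P(1)] fg_moduleD[OF Suc(2)] epi_homD(1)[OF \<epsilon>]])
  have dK: "d 0 \<in> Hom R (P 1) (Ker (P 0) M \<epsilon>)"
    using k0 P(2)[of 0] by (intro Hom_into_sub) auto
  have "projective_resolution R (Ker (P 0) M \<epsilon>) (\<lambda>i. P (Suc i)) (d 0) (\<lambda>i. d (Suc i))"
    unfolding projective_resolution_def
  proof (intro conjI allI)
    show "d 0 \<in> epi_hom R (P (Suc 0)) (Ker (P 0) M \<epsilon>)" using dK k0 by (simp add: epi_hom_def)
    show "d (Suc 0) ` carrier (P (Suc 1)) = a_kernel (P (Suc 0)) (Ker (P 0) M \<epsilon>) (d 0)"
      using kS[of 0] by (simp add: a_kernel_def')
  qed (use P kS in auto)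
  then have "Ext_zero R Y k (Ker (P 0) M \<epsilon>)"
    by (rule Suc(1)[OF fgK]) (use Suc(4) in auto)
  with P(1) \<epsilon> show ?case by auto
qed

end

section \<open>Modules generated by a tilting module\<close>

text \<open>The trace of \<open>T\<close> in \<open>X\<close>, the least submodule containing all
  images of \<open>T\<close>, is everything. No finite sums are needed in this form; an epimorphism
  from a power of \<open>T\<close> is recovered in \<open>right_approximation\<close>.\<close>

definition generated_by :: "('a, 'x) ring_scheme \<Rightarrow> ('a, 't) module \<Rightarrow> ('a, 'm) module \<Rightarrow> bool" where
  "generated_by R T X \<longleftrightarrow> fg_module R X \<and>
     (\<forall>U. submodule U R X \<longrightarrow> (\<forall>f\<in>Hom R T X. f ` carrier T \<subseteq> U) \<longrightarrow> carrier X \<subseteq> U)"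

lemma generated_byD:
  assumes "generated_by R T X" "submodule U R X" "\<forall>f\<in>Hom R T X. f ` carrier T \<subseteq> U"
  shows "carrier X \<subseteq> U"
proof -
  have "\<forall>U. submodule U R X \<longrightarrow> (\<forall>f\<in>Hom R T X. f ` carrier T \<subseteq> U) \<longrightarrow> carrier X \<subseteq> U"
    using assms(1) unfolding generated_by_def by (rule conjunct2)
  then show ?thesis using assms(2,3) by (elim allE impE)
qed

lemma generated_by_epi:
  assumes X: "generated_by R T X" and Y: "left_module R Y" and q: "q \<in> epi_hom R X Y"
  shows "generated_by R T Y"
  unfolding generated_by_def
proof (intro conjI allI impI)
  have fg: "fg_module R X" using X by (simp add: generated_by_def)
  note LX = fg_moduleD[OF fg] and q1 = epi_homD(1)[OF q]
  show "fg_module R Y" by (rule fg_epi[OF fg Y q])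
  fix U assume U: "submodule U R Y" "\<forall>f\<in>Hom R T Y. f ` carrier T \<subseteq> U"
  let ?V = "{x \<in> carrier X. q x \<in> U}"
  have "submodule ?V R X" by (rule submodule_vimage[OF LX Y q1 U(1)])
  moreover have "\<forall>f\<in>Hom R T X. f ` carrier T \<subseteq> ?V"
  proof
    fix f assume f: "f \<in> Hom R T X"
    have "(\<lambda>t. q (f t)) ` carrier T \<subseteq> U" by (rule bspec[OF U(2) Hom_comp[OF f q1]])
    then show "f ` carrier T \<subseteq> ?V" using HomD(1)[OF f] by auto
  qed
  ultimately have V: "carrier X \<subseteq> ?V" by (rule generated_byD[OF X])
  show "carrier Y \<subseteq> U"
  proof
    fix y assume "y \<in> carrier Y"
    from epi_homD(2)[OF q this] obtain x where "x \<in> carrier X" "q x = y" by blast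
    with V show "y \<in> U" by auto
  qed
qed

lemma generated_by_power:
  assumes W: "is_power R T c W \<iota> \<pi>" and fg: "fg_module R T"
  shows "generated_by R T W"
  unfolding generated_by_def
proof (intro conjI allI impI is_power_fg[OF W fg] subsetI)
  note W' = is_powerD[OF W]
  fix U w assume U: "submodule U R W" "\<forall>f\<in>Hom R T W. f ` carrier T \<subseteq> U" and w: "w \<in> carrier W"
  have "(\<Oplus>\<^bsub>W\<^esub>j\<in>{..<c}. \<iota> j (\<pi> j w)) \<in> U"
  proof (rule submodule_finsum[OF W'(2) U(1)])
    fix j assume "j \<in> {..<c}"
    then have j: "j < c" by simp
    have "\<iota> j ` carrier T \<subseteq> U" using U(2) W'(3)[OF j] by blast
    then show "\<iota> j (\<pi> j w) \<in> U" using HomD(1)[OF W'(4)[OF j] w] by blast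
  qed simp
  then show "w \<in> U" using W'(6)[OF w] by simp
qed

text \<open>The map \<open>id - e\<close> vanishes on the kernel of \<open>p\<close>, hence factors
  through \<open>p\<close>; the factor is the section.\<close>

lemma split_epi:
  assumes M: "left_module R M" and P: "left_module R P" and p: "p \<in> epi_hom R P M"
    and e: "e \<in> Hom R P P" and pe: "\<And>x. x \<in> carrier P \<Longrightarrow> p (e x) = \<zero>\<^bsub>M\<^esub>"
    and id: "\<And>x. \<lbrakk>x \<in> carrier P; p x = \<zero>\<^bsub>M\<^esub>\<rbrakk> \<Longrightarrow> e x = x"
  obtains s where "s \<in> Hom R M P" "\<And>y. y \<in> carrier M \<Longrightarrow> p (s y) = y"
proof -
  interpret M: left_module R M by fact
  interpret P: left_module R P by fact
  have d: "(\<lambda>x. x \<ominus>\<^bsub>P\<^esub> e x) \<in> Hom R P P" by (rule Hom_diff[OF P Hom_id e])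
  obtain s where s: "s \<in> Hom R M P" "\<And>x. x \<in> carrier P \<Longrightarrow> s (p x) = x \<ominus>\<^bsub>P\<^esub> e x"
    by (rule Hom_factor[OF P M P p d]) (simp add: id P.M.minus_self, rule that)
  have "p (s y) = y" if y: "y \<in> carrier M" for y
  proof -
    from epi_homD(2)[OF p y] obtain x where x: "x \<in> carrier P" "p x = y" by blast
    have "p (x \<ominus>\<^bsub>P\<^esub> e x) = p x \<ominus>\<^bsub>M\<^esub> p (e x)"
      by (rule Hom_minus[OF epi_homD(1)[OF p] P M x(1) HomD(1)[OF e x(1)]])
    then show ?thesis using s(2)[OF x(1)] x pe y by (simp add: M.M.minus_zero_right)
  qed
  with s(1) show thesis by (rule that)
qed

text \<open>The presentation by \<open>P\<close> is compared with \<open>\<tau>\<close> through a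
  lift \<open>u\<close> of \<open>p\<close>. With \<open>g\<close> extending \<open>h u\<close> to
  \<open>P\<close>, the expression \<open>g x + h (b - u x)\<close> makes sense on the pullback of
  \<open>\<tau>\<close> and \<open>p\<close>, depends on \<open>b\<close> only, and gives
  \<open>h\<close> on the kernel of \<open>\<tau>\<close>.\<close>

lemma extends_from_kernel:
  fixes T :: "('a, 't) module" and B :: "('a, 'b) module"
  assumes T: "fg_module R T" and B: "fg_module R B" and Y: "left_module R Y"
    and \<tau>: "\<tau> \<in> epi_hom R B T" and P: "projective_module R P" "p \<in> epi_hom R P T"
    and ext: "extends_from R P (a_kernel P T p) Y"
  shows "extends_from R B (a_kernel B T \<tau>) Y"
  unfolding extends_from_def
proof
  fix h assume h: "h \<in> Hom R (Ker B T \<tau>) Y"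
  note LT = fg_moduleD[OF T] and LB = fg_moduleD[OF B] and LP = projectiveD(2)[OF P(1)]
  note \<tau>1 = epi_homD(1)[OF \<tau>] and p1 = epi_homD(1)[OF P(2)]
  interpret T: left_module R T by (rule LT)
  interpret B: left_module R B by (rule LB)
  interpret P: left_module R P by (rule LP)
  interpret Y: left_module R Y by (rule Y)
  obtain u where u: "u \<in> Hom R P B" "\<And>x. x \<in> carrier P \<Longrightarrow> \<tau> (u x) = p x"
    by (rule projective_lift[OF P(1) B T \<tau> p1]) (rule that)
  have uK: "u \<in> Hom R (Ker P T p) (Ker B T \<tau>)"
    using u(2) by (intro Hom_to_Ker Hom_from_Ker u(1)) (simp add: kernel_iff)
  obtain g where g: "g \<in> Hom R P Y" "\<And>x. x \<in> a_kernel P T p \<Longrightarrow> g x = h (u x)"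
    by (rule extends_fromE[OF ext Hom_comp[OF uK h]]) (rule that)
  define H0 where "H0 b x = g x \<oplus>\<^bsub>Y\<^esub> h (b \<ominus>\<^bsub>B\<^esub> u x)" for b x
  have k: "b \<ominus>\<^bsub>B\<^esub> u x \<in> a_kernel B T \<tau>" if "b \<in> carrier B" "x \<in> carrier P" "\<tau> b = p x" for b x
    using that HomD(1)[OF u(1)] HomD(1)[OF \<tau>1] HomD(1)[OF p1]
    by (simp add: kernel_iff Hom_minus[OF \<tau>1 LB LT] u(2) T.M.minus_self)
  have H0c: "H0 b x \<in> carrier Y" if "b \<in> carrier B" "x \<in> carrier P" "\<tau> b = p x" for b x
    using HomD(1)[OF g(1) that(2)] HomD(1)[OF h, of "b \<ominus>\<^bsub>B\<^esub> u x"] k[OF that] by (simp add: H0_def)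
  have H0add: "H0 (b \<oplus>\<^bsub>B\<^esub> b') (x \<oplus>\<^bsub>P\<^esub> x') = H0 b x \<oplus>\<^bsub>Y\<^esub> H0 b' x'"
    if b: "b \<in> carrier B" "x \<in> carrier P" "\<tau> b = p x" and b': "b' \<in> carrier B" "x' \<in> carrier P" "\<tau> b' = p x'"
    for b b' x x'
  proof -
    have "(b \<oplus>\<^bsub>B\<^esub> b') \<ominus>\<^bsub>B\<^esub> u (x \<oplus>\<^bsub>P\<^esub> x') = (b \<ominus>\<^bsub>B\<^esub> u x) \<oplus>\<^bsub>B\<^esub> (b' \<ominus>\<^bsub>B\<^esub> u x')"
      using b b' HomD(1)[OF u(1)] by (simp add: HomD(2)[OF u(1)] B.M.add_diff_add)
    moreover have "h ((b \<ominus>\<^bsub>B\<^esub> u x) \<oplus>\<^bsub>B\<^esub> (b' \<ominus>\<^bsub>B\<^esub> u x')) = h (b \<ominus>\<^bsub>B\<^esub> u x) \<oplus>\<^bsub>Y\<^esub> h (b' \<ominus>\<^bsub>B\<^esub> u x')"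
      using HomD(2)[OF h, of "b \<ominus>\<^bsub>B\<^esub> u x" "b' \<ominus>\<^bsub>B\<^esub> u x'"] k[OF b] k[OF b'] by simp
    moreover have "h (b \<ominus>\<^bsub>B\<^esub> u x) \<in> carrier Y" "h (b' \<ominus>\<^bsub>B\<^esub> u x') \<in> carrier Y" "g x \<in> carrier Y" "g x' \<in> carrier Y"
      using HomD(1)[OF h] k[OF b] k[OF b'] HomD(1)[OF g(1)] b b' by auto
    ultimately show ?thesis using b b' by (simp add: H0_def HomD(2)[OF g(1)] Y.M.a_ac)
  qed
  have H0smult: "H0 (r \<odot>\<^bsub>B\<^esub> b) (r \<odot>\<^bsub>P\<^esub> x) = r \<odot>\<^bsub>Y\<^esub> H0 b x"
    if r: "r \<in> carrier R" and b: "b \<in> carrier B" "x \<in> carrier P" "\<tau> b = p x" for r b x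
  proof -
    have "r \<odot>\<^bsub>B\<^esub> b \<ominus>\<^bsub>B\<^esub> u (r \<odot>\<^bsub>P\<^esub> x) = r \<odot>\<^bsub>B\<^esub> (b \<ominus>\<^bsub>B\<^esub> u x)"
      using b r HomD(1)[OF u(1)] by (simp add: HomD(3)[OF u(1)] B.smult_minus)
    moreover have "h (r \<odot>\<^bsub>B\<^esub> (b \<ominus>\<^bsub>B\<^esub> u x)) = r \<odot>\<^bsub>Y\<^esub> h (b \<ominus>\<^bsub>B\<^esub> u x)"
      using HomD(3)[OF h r, of "b \<ominus>\<^bsub>B\<^esub> u x"] k[OF b] by simp
    moreover have "h (b \<ominus>\<^bsub>B\<^esub> u x) \<in> carrier Y" "g x \<in> carrier Y"
      using HomD(1)[OF h] k[OF b] HomD(1)[OF g(1)] b by auto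
    ultimately show ?thesis using b r by (simp add: H0_def HomD(3)[OF g(1)] Y.smult_r_distr)
  qed
  have H0z: "H0 \<zero>\<^bsub>B\<^esub> x = \<zero>\<^bsub>Y\<^esub>" if x: "x \<in> carrier P" "p x = \<zero>\<^bsub>T\<^esub>" for x
  proof -
    have ux: "u x \<in> carrier B" "u x \<in> a_kernel B T \<tau>" using HomD(1)[OF u(1) x(1)] u(2)[OF x(1)] x(2) by (auto simp: kernel_iff)
    have "\<zero>\<^bsub>B\<^esub> \<ominus>\<^bsub>B\<^esub> u x \<in> a_kernel B T \<tau>" by (rule k) (use x Hom_zero[OF \<tau>1 LB LT] in auto)
    then have "h (u x) \<oplus>\<^bsub>Y\<^esub> h (\<zero>\<^bsub>B\<^esub> \<ominus>\<^bsub>B\<^esub> u x) = h (u x \<oplus>\<^bsub>B\<^esub> (\<zero>\<^bsub>B\<^esub> \<ominus>\<^bsub>B\<^esub> u x))"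
      using HomD(2)[OF h, of "u x" "\<zero>\<^bsub>B\<^esub> \<ominus>\<^bsub>B\<^esub> u x"] ux by simp
    also have "u x \<oplus>\<^bsub>B\<^esub> (\<zero>\<^bsub>B\<^esub> \<ominus>\<^bsub>B\<^esub> u x) = \<zero>\<^bsub>B\<^esub>" using ux by (simp add: a_minus_def B.M.r_neg)
    also have "h \<zero>\<^bsub>B\<^esub> = \<zero>\<^bsub>Y\<^esub>" using Hom_zero[OF h left_module_Ker[OF LB LT \<tau>1] Y] by simp
    finally show ?thesis using g(2)[of x] x by (simp add: H0_def kernel_iff)
  qed
  \<comment> \<open>Changing \<open>x\<close> adds an element of the kernel of \<open>p\<close>,
    where \<open>g\<close> and \<open>h u\<close> agree, so the two summands compensate each
    other.\<close>
  have H0u: "H0 b x = H0 b x'" if b: "b \<in> carrier B" "x \<in> carrier P" "\<tau> b = p x" and b': "x' \<in> carrier P" "\<tau> b = p x'" for b x x'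
  proof -
    have z: "p (x' \<ominus>\<^bsub>P\<^esub> x) = \<zero>\<^bsub>T\<^esub>" "x' \<ominus>\<^bsub>P\<^esub> x \<in> carrier P"
      using b b' HomD(1)[OF \<tau>1 b(1)] HomD(1)[OF p1] by (auto simp: Hom_minus[OF p1 LP LT] T.M.minus_self)
    have "H0 (\<zero>\<^bsub>B\<^esub> \<oplus>\<^bsub>B\<^esub> b) ((x' \<ominus>\<^bsub>P\<^esub> x) \<oplus>\<^bsub>P\<^esub> x) = H0 \<zero>\<^bsub>B\<^esub> (x' \<ominus>\<^bsub>P\<^esub> x) \<oplus>\<^bsub>Y\<^esub> H0 b x"
      by (rule H0add) (use z b Hom_zero[OF \<tau>1 LB LT] in auto)
    then show ?thesis using H0z[OF z(2,1)] H0c[OF b] b b' by (simp add: P.M.minus_add_cancel)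
  qed
  \<comment> \<open>The choice \<open>s\<close> need not be linear; linearity of the result comes
    from its independence of \<open>x\<close>.\<close>
  define s where "s b = (SOME x. x \<in> carrier P \<and> p x = \<tau> b)" for b
  have "s b \<in> carrier P \<and> p (s b) = \<tau> b" if "b \<in> carrier B" for b
    unfolding s_def by (rule someI_ex) (use epi_homD(2)[OF P(2) HomD(1)[OF \<tau>1 that]] in blast)
  then have s: "s b \<in> carrier P" "\<tau> b = p (s b)" if "b \<in> carrier B" for b
    using that by auto
  have "(\<lambda>b. H0 b (s b)) \<in> Hom R B Y"
  proof (rule HomI)
    show "H0 b (s b) \<in> carrier Y" if "b \<in> carrier B" for b using H0c s that by blast
    show "H0 (b \<oplus>\<^bsub>B\<^esub> b') (s (b \<oplus>\<^bsub>B\<^esub> b')) = H0 b (s b) \<oplus>\<^bsub>Y\<^esub> H0 b' (s b')" if b: "b \<in> carrier B" "b' \<in> carrier B" for b b'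
    proof -
      have "H0 (b \<oplus>\<^bsub>B\<^esub> b') (s (b \<oplus>\<^bsub>B\<^esub> b')) = H0 (b \<oplus>\<^bsub>B\<^esub> b') (s b \<oplus>\<^bsub>P\<^esub> s b')"
      proof (rule H0u)
        show "\<tau> (b \<oplus>\<^bsub>B\<^esub> b') = p (s b \<oplus>\<^bsub>P\<^esub> s b')"
          unfolding HomD(2)[OF \<tau>1 b] using s b by (simp add: HomD(2)[OF p1])
      qed (use s b s[of "b \<oplus>\<^bsub>B\<^esub> b'"] in auto)
      then show ?thesis using H0add[of b "s b" b' "s b'"] s b by simp
    qed
    show "H0 (r \<odot>\<^bsub>B\<^esub> b) (s (r \<odot>\<^bsub>B\<^esub> b)) = r \<odot>\<^bsub>Y\<^esub> H0 b (s b)" if b: "r \<in> carrier R" "b \<in> carrier B" for r b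
    proof -
      have "H0 (r \<odot>\<^bsub>B\<^esub> b) (s (r \<odot>\<^bsub>B\<^esub> b)) = H0 (r \<odot>\<^bsub>B\<^esub> b) (r \<odot>\<^bsub>P\<^esub> s b)"
      proof (rule H0u)
        show "\<tau> (r \<odot>\<^bsub>B\<^esub> b) = p (r \<odot>\<^bsub>P\<^esub> s b)"
          unfolding HomD(3)[OF \<tau>1 b] using s b by (simp add: HomD(3)[OF p1])
      qed (use s b s[of "r \<odot>\<^bsub>B\<^esub> b"] in auto)
      then show ?thesis using H0smult[of r b "s b"] s b by simp
    qed
  qed
  moreover have "H0 b (s b) = h b" if b: "b \<in> a_kernel B T \<tau>" for b
  proof -
    have b': "b \<in> carrier B" "\<tau> b = \<zero>\<^bsub>T\<^esub>" using b by (auto simp: kernel_iff)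
    have "H0 b (s b) = H0 b \<zero>\<^bsub>P\<^esub>" by (rule H0u) (use s b' Hom_zero[OF p1 LP LT] in auto)
    also have "\<dots> = h b" using Hom_zero[OF g(1) LP Y] Hom_zero[OF u(1) LP LB] b' HomD(1)[OF h, of b] b
      by (simp add: H0_def B.M.minus_zero_right)
    finally show ?thesis .
  qed
  ultimately show "\<exists>g\<in>Hom R B Y. \<forall>x\<in>a_kernel B T \<tau>. g x = h x" by (intro bexI) auto
qed

section \<open>From Ext^1(T, Y) = 0 to generation of Y by T\<close>

lemma pair_direct_sum:
  "xs \<in> carrier (direct_sum [A, C]) \<longleftrightarrow> (\<exists>a\<in>carrier A. \<exists>c\<in>carrier C. xs = [a, c])"
  "[a, c] \<oplus>\<^bsub>direct_sum [A, C]\<^esub> [a', c'] = [a \<oplus>\<^bsub>A\<^esub> a', c \<oplus>\<^bsub>C\<^esub> c']"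
  "r \<odot>\<^bsub>direct_sum [A, C]\<^esub> [a, c] = [r \<odot>\<^bsub>A\<^esub> a, r \<odot>\<^bsub>C\<^esub> c]"
  "\<zero>\<^bsub>direct_sum [A, C]\<^esub> = [\<zero>\<^bsub>A\<^esub>, \<zero>\<^bsub>C\<^esub>]"
  by (auto simp: length_Suc_conv less_Suc_eq numeral_2_eq_2 all_conj_distrib upt_rec)

lemma fg_direct_sum:
  fixes Ms :: "('a, 'm) module list"
  assumes "ring R" "\<And>M. M \<in> set Ms \<Longrightarrow> fg_module R M"
  shows "fg_module R (direct_sum Ms)"
  using assms(2)
proof (induction Ms)
  case Nil
  have L: "left_module R (direct_sum ([] :: ('a, 'm) module list))"
    by (rule left_module_direct_sum[OF assms(1)]) simp
  have "carrier (direct_sum ([] :: ('a, 'm) module list)) = {\<zero>\<^bsub>direct_sum ([] :: ('a, 'm) module list)\<^esub>}"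
    by auto
  with L fgen_zero[OF L] show ?case by (simp add: fg_module_iff_fgen del: direct_sum_simps)
next
  case (Cons M Ms)
  have fg: "fg_module R M" "fg_module R (direct_sum Ms)" using Cons by auto
  note LM = fg_moduleD[OF fg(1)] and LS = fg_moduleD[OF fg(2)]
  interpret M: left_module R M by (rule LM)
  have LD: "left_module R (direct_sum (M # Ms))"
    using Cons.prems by (intro left_module_direct_sum[OF assms(1)]) (auto dest: fg_moduleD)
  have p: "(\<lambda>xs. xs ! 0) \<in> Hom R (direct_sum (M # Ms)) M" using Hom_nth[of 0 "M # Ms" R] by simp
  have cons: "x # xs \<in> carrier (direct_sum (M # Ms)) \<longleftrightarrow> x \<in> carrier M \<and> xs \<in> carrier (direct_sum Ms)" for x xs
    by (auto simp: nth_Cons' less_Suc_eq_0_disj)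
  have e: "(\<lambda>xs. \<zero>\<^bsub>M\<^esub> # xs) \<in> Hom R (direct_sum Ms) (direct_sum (M # Ms))"
  proof (rule HomI)
    fix xs assume "xs \<in> carrier (direct_sum Ms)"
    then show "\<zero>\<^bsub>M\<^esub> # xs \<in> carrier (direct_sum (M # Ms))" unfolding cons by simp
  qed (auto simp: M.smult_zero_right map_upt_Suc simp del: upt_Suc)
  have ex: "\<exists>x ys. xs = x # ys \<and> x \<in> carrier M \<and> ys \<in> carrier (direct_sum Ms)"
    if "xs \<in> carrier (direct_sum (M # Ms))" for xs
    using that cons[of "hd xs" "tl xs"] by (cases xs) auto
  have "(\<lambda>xs. xs ! 0) ` carrier (direct_sum (M # Ms)) = carrier M"
  proof (intro equalityI subsetI)
    fix x assume "x \<in> carrier M"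
    then have "x # \<zero>\<^bsub>direct_sum Ms\<^esub> \<in> carrier (direct_sum (M # Ms))"
      unfolding cons using abelian_monoid.zero_closed[OF left_moduleD(3)[OF LS]] by simp
    then show "x \<in> (\<lambda>xs. xs ! 0) ` carrier (direct_sum (M # Ms))" by (rule rev_image_eqI) simp
  qed (use HomD(1)[OF p] in auto)
  moreover have "{xs \<in> carrier (direct_sum (M # Ms)). xs ! 0 = \<zero>\<^bsub>M\<^esub>} = (\<lambda>xs. \<zero>\<^bsub>M\<^esub> # xs) ` carrier (direct_sum Ms)"
  proof (intro equalityI subsetI)
    fix xs assume "xs \<in> {xs \<in> carrier (direct_sum (M # Ms)). xs ! 0 = \<zero>\<^bsub>M\<^esub>}"
    then have xs: "xs \<in> carrier (direct_sum (M # Ms))" "xs ! 0 = \<zero>\<^bsub>M\<^esub>" by blast+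
    from ex[OF xs(1)] obtain x ys where "xs = x # ys" "ys \<in> carrier (direct_sum Ms)" by blast
    with xs(2) show "xs \<in> (\<lambda>xs. \<zero>\<^bsub>M\<^esub> # xs) ` carrier (direct_sum Ms)" by (intro rev_image_eqI) simp_all
  next
    fix xs assume "xs \<in> (\<lambda>xs. \<zero>\<^bsub>M\<^esub> # xs) ` carrier (direct_sum Ms)"
    then obtain ys where "ys \<in> carrier (direct_sum Ms)" "xs = \<zero>\<^bsub>M\<^esub> # ys" by blast
    with HomD(1)[OF e, of ys] show "xs \<in> {xs \<in> carrier (direct_sum (M # Ms)). xs ! 0 = \<zero>\<^bsub>M\<^esub>}" by simp
  qed
  ultimately have "fgen R (direct_sum (M # Ms)) (carrier (direct_sum (M # Ms)))"
    using fgen_image[OF LS LD e, of "carrier (direct_sum Ms)"] fg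
    by (intro fgen_extension[OF LD LM p submodule_carrier[OF LD]]) (simp_all add: fg_module_iff_fgen del: direct_sum_simps)
  with LD show ?case by (simp add: fg_module_iff_fgen)
qed

context artin_alg
begin

text \<open>The submodules \<open>S i\<close> form a filtration of \<open>B\<close> that starts with
  the kernel of \<open>q\<close>, ends with \<open>B\<close> and has successive quotients
  \<open>T\<close>. A map is extended over one copy of \<open>T\<close> at a time.\<close>

lemma extends_from_kernel_power:
  fixes T :: "('a, 't) module" and B :: "('a, 'b) module"
  assumes W: "is_power R T c W \<iota> \<pi>" and T: "fg_module R T" and B: "fg_module R B" and Y: "left_module R Y"
    and q: "q \<in> epi_hom R B W" and P: "projective_module R P" "p \<in> epi_hom R P T"
    and ext: "extends_from R P (a_kernel P T p) Y"
  shows "extends_from R B (a_kernel B W q) Y"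
proof -
  note W' = is_powerD[OF W] and LB = fg_moduleD[OF B] and q1 = epi_homD(1)[OF q]
  interpret W: left_module R W by (rule W'(2))
  interpret T: left_module R T by (rule W'(1))
  define S where "S i = {b \<in> carrier B. \<forall>j<c. i \<le> j \<longrightarrow> \<pi> j (q b) = \<zero>\<^bsub>T\<^esub>}" for i
  have S: "submodule (S i) R B" for i
  proof (rule submoduleI'[OF LB])
    interpret B: left_module R B by (rule LB)
    show "\<zero>\<^bsub>B\<^esub> \<in> S i" using Hom_zero[OF q1 LB W'(2)] Hom_zero[OF W'(4) W'(2,1)] by (simp add: S_def)
    show "x \<oplus>\<^bsub>B\<^esub> y \<in> S i" if "x \<in> S i" "y \<in> S i" for x y
      using that HomD(1)[OF q1] by (simp add: S_def HomD(2)[OF q1] HomD(2)[OF W'(4)])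
    show "r \<odot>\<^bsub>B\<^esub> x \<in> S i" if "r \<in> carrier R" "x \<in> S i" for r x
      using that HomD(1)[OF q1] by (simp add: S_def HomD(3)[OF q1] HomD(3)[OF W'(4)] T.smult_zero_right)
  qed (auto simp: S_def)
  have S0: "S 0 = a_kernel B W q"
  proof (intro equalityI subsetI)
    fix b assume b: "b \<in> S 0"
    then have "(\<Oplus>\<^bsub>W\<^esub>j\<in>{..<c}. \<iota> j (\<pi> j (q b))) = \<zero>\<^bsub>W\<^esub>"
      using Hom_zero[OF W'(3) W'(1,2)] by (intro W.M.add.finprod_one_eqI) (auto simp: S_def)
    moreover have "(\<Oplus>\<^bsub>W\<^esub>j\<in>{..<c}. \<iota> j (\<pi> j (q b))) = q b"
      using b HomD(1)[OF q1] by (intro W'(6)) (simp add: S_def)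
    ultimately show "b \<in> a_kernel B W q" using b by (simp add: kernel_iff S_def)
  qed (use Hom_zero[OF W'(4) W'(2,1)] in \<open>auto simp: S_def kernel_iff\<close>)
  have step: "extends_from R (B\<lparr>carrier := S (Suc i)\<rparr>) (S i) Y" if i: "i < c" for i
  proof -
    let ?B = "B\<lparr>carrier := S (Suc i)\<rparr>" and ?t = "\<lambda>b. \<pi> i (q b)"
    have fgB: "fg_module R ?B" by (rule fg_submodule[OF B S])
    have "?t \<in> epi_hom R ?B T"
    proof (rule epi_homI)
      show "?t \<in> Hom R ?B T" by (rule Hom_sub[OF Hom_comp[OF q1 W'(4)[OF i]]]) (auto simp: S_def)
      fix t assume t: "t \<in> carrier T"
      \<comment> \<open>A preimage of \<open>\<iota> i t\<close> has all other coordinates zero, so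
        it lies in \<open>S (Suc i)\<close>.\<close>
      from epi_homD(2)[OF q HomD(1)[OF W'(3)[OF i] t]] obtain b where b: "b \<in> carrier B" "q b = \<iota> i t" by blast
      with W'(5) i t have "b \<in> S (Suc i)" "?t b = t" by (auto simp: S_def)
      then show "\<exists>b\<in>carrier ?B. ?t b = t" by auto
    qed
    from extends_from_kernel[OF T fgB Y this P ext]
    have "extends_from R ?B (a_kernel ?B T ?t) Y" .
    moreover have "a_kernel ?B T ?t = S i"
      using i by (auto simp: kernel_iff S_def Suc_le_eq) (metis le_neq_implies_less)
    ultimately show ?thesis by simp
  qed
  show ?thesis
    unfolding extends_from_def
  proof
    fix h assume h: "h \<in> Hom R (Ker B W q) Y"
    have "\<exists>g\<in>Hom R (B\<lparr>carrier := S i\<rparr>) Y. \<forall>x\<in>a_kernel B W q. g x = h x" if "i \<le> c" for i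
      using that
    proof (induction i)
      case 0
      show ?case using h by (intro bexI[of _ h]) (auto simp: S0)
    next
      case (Suc i)
      then obtain g where g: "g \<in> Hom R (B\<lparr>carrier := S i\<rparr>) Y" "\<forall>x\<in>a_kernel B W q. g x = h x" by auto
      obtain g' where g': "g' \<in> Hom R (B\<lparr>carrier := S (Suc i)\<rparr>) Y" "\<And>x. x \<in> S i \<Longrightarrow> g' x = g x"
        using extends_fromE[OF step[of i], of g] g(1) Suc.prems by auto
      have "a_kernel B W q \<subseteq> S i" unfolding S0[symmetric] by (auto simp: S_def)
      with g(2) g'(2) have "\<forall>x\<in>a_kernel B W q. g' x = h x" by auto
      with g'(1) show ?case by blast
    qed
    from this[of c] obtain g where g: "g \<in> Hom R (B\<lparr>carrier := S c\<rparr>) Y" "\<forall>x\<in>a_kernel B W q. g x = h x" by auto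
    moreover have "B\<lparr>carrier := S c\<rparr> = B" by (cases B) (auto simp: S_def)
    ultimately show "\<exists>g\<in>Hom R B Y. \<forall>x\<in>a_kernel B W q. g x = h x" by auto
  qed
qed

text \<open>Homomorphisms from the ring to \<open>Y\<close> extend along its embedding into \<open>T0\<close>.\<close>

lemma generated_by_of_extends:
  fixes T :: "('a, 't) module" and Y :: "('a, 'y) module" and T0 T1 :: "'a fgmod"
  assumes T: "fg_module R T" and Y: "fg_module R Y"
    and P: "projective_module R P" "p \<in> epi_hom R P T" and ext: "extends_from R P (a_kernel P T p) Y"
    and add: "in_add R T T0" "in_add R T T1"
    and f: "f \<in> mono_hom R (regular_module R) T0" and g: "g \<in> epi_hom R T0 T1"
    and exact: "f ` carrier (regular_module R) = a_kernel T0 T1 g"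
  shows "generated_by R T Y"
proof -
  note LY = fg_moduleD[OF Y] and LT = fg_moduleD[OF T]
  interpret Y: left_module R Y by (rule LY)
  have fgT: "fg_module R T0" "fg_module R T1" using add by (auto simp: in_add_def)
  note LT0 = fg_moduleD[OF fgT(1)] and LT1 = fg_moduleD[OF fgT(2)]
  interpret T0: left_module R T0 by (rule LT0)
  have LR: "left_module R (regular_module R)" by (rule left_module_regular[OF is_ring])
  have f1: "f \<in> Hom R (regular_module R) T0" "inj_on f (carrier (regular_module R))"
    using f by (auto simp: mono_hom_def)
  obtain Y1 :: "'a fgmod" and n i where Y1: "fg_module R Y1"
    and i: "i \<in> Hom R (direct_sum [T1, Y1]) (module_power T n)"
      "i ` carrier (direct_sum [T1, Y1]) = carrier (module_power T n)" "inj_on i (carrier (direct_sum [T1, Y1]))"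
    using add(2) unfolding in_add_def module_isomorphic_def mono_hom_def epi_hom_def by auto
  obtain Y0 :: "'a fgmod" and m i0 where Y0: "fg_module R Y0"
    and i0: "i0 \<in> Hom R (direct_sum [T0, Y0]) (module_power T m)"
      "inj_on i0 (carrier (direct_sum [T0, Y0]))" "i0 ` carrier (direct_sum [T0, Y0]) = carrier (module_power T m)"
    using add(1) unfolding in_add_def module_isomorphic_def mono_hom_def epi_hom_def by auto
  note LY1 = fg_moduleD[OF Y1] and LY0 = fg_moduleD[OF Y0]
  interpret Y1: left_module R Y1 by (rule LY1)
  interpret Y0: left_module R Y0 by (rule LY0)
  interpret T1: left_module R T1 by (rule LT1)
  have LD: "left_module R (direct_sum [T0, Y1])" "left_module R (direct_sum [T0, Y0])" "left_module R (direct_sum [T1, Y1])"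
    using LT0 LT1 LY1 LY0 by (auto intro!: left_module_direct_sum is_ring)
  obtain \<iota> where W: "is_power R T n (module_power T n) \<iota> (\<lambda>j xs. xs ! j)"
    by (rule is_power_module_power[OF LT])
  \<comment> \<open>\<open>T1\<close> is only a summand of a power of \<open>T\<close>. Adding its
    complement \<open>Y1\<close> to both \<open>T0\<close> and \<open>T1\<close> gives an
    epimorphism onto the power without changing the kernel, which is a copy of the ring.\<close>
  let ?B = "direct_sum [T0, Y1]" and ?q = "\<lambda>xs. i [g (xs ! 0), xs ! 1]"
  have g1: "g \<in> Hom R T0 T1" by (rule epi_homD(1)[OF g])
  have gq: "(\<lambda>xs. [g (xs ! 0), xs ! 1]) \<in> Hom R ?B (direct_sum [T1, Y1])"
    by (rule HomI) (auto simp: pair_direct_sum HomD[OF g1] simp del: direct_sum_simps)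
  have q: "?q \<in> epi_hom R ?B (module_power T n)"
  proof (rule epi_homI)
    show "?q \<in> Hom R ?B (module_power T n)" by (rule Hom_comp[OF gq i(1)])
    fix y assume "y \<in> carrier (module_power T n)"
    then have "y \<in> i ` carrier (direct_sum [T1, Y1])" by (simp only: i(2))
    then obtain z where z: "z \<in> carrier (direct_sum [T1, Y1])" "i z = y" by blast
    from z(1) obtain a c where a: "a \<in> carrier T1" "c \<in> carrier Y1" "z = [a, c]" unfolding pair_direct_sum(1) by blast
    from epi_homD(2)[OF g a(1)] obtain b where "b \<in> carrier T0" "g b = a" by blast
    then show "\<exists>x\<in>carrier ?B. ?q x = y" using a z(2) by (intro bexI[of _ "[b, c]"]) (simp_all add: pair_direct_sum del: direct_sum_simps)
  qed
  have kq: "a_kernel ?B (module_power T n) ?q = {[f r, \<zero>\<^bsub>Y1\<^esub>] | r. r \<in> carrier R}"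
  proof -
    have "i z = \<zero>\<^bsub>module_power T n\<^esub> \<longleftrightarrow> z = \<zero>\<^bsub>direct_sum [T1, Y1]\<^esub>" if "z \<in> carrier (direct_sum [T1, Y1])" for z
      using inj_onD[OF i(3), of z "\<zero>\<^bsub>direct_sum [T1, Y1]\<^esub>"] Hom_zero[OF i(1) LD(3) is_powerD(2)[OF W]] that
        abelian_monoid.zero_closed[OF left_moduleD(3)[OF LD(3)]] by auto
    then have "xs \<in> a_kernel ?B (module_power T n) ?q \<longleftrightarrow>
        xs \<in> carrier ?B \<and> [g (xs ! 0), xs ! 1] = \<zero>\<^bsub>direct_sum [T1, Y1]\<^esub>" for xs
      using HomD(1)[OF gq, of xs] by (auto simp: kernel_iff simp del: direct_sum_simps)
    also have "\<dots> xs \<longleftrightarrow> (\<exists>b \<in> a_kernel T0 T1 g. xs = [b, \<zero>\<^bsub>Y1\<^esub>])" for xs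
      by (auto simp: pair_direct_sum kernel_iff simp del: direct_sum_simps)
    finally show ?thesis unfolding exact[symmetric] by auto
  qed
  have fgB: "fg_module R ?B" by (rule fg_direct_sum[OF is_ring]) (use fgT Y1 in auto)
  note extB = extends_from_kernel_power[OF W T fgB LY q P ext]
  show ?thesis
    unfolding generated_by_def
  proof (intro conjI allI impI Y subsetI)
    fix U y assume U: "submodule U R Y" "\<forall>f\<in>Hom R T Y. f ` carrier T \<subseteq> U" and y: "y \<in> carrier Y"
    have fK: "f \<in> Hom R (regular_module R) (Ker T0 T1 g)"
      by (rule Hom_into_sub[OF f1(1)]) (use exact in blast)
    obtain f' where f': "f' \<in> Hom R (Ker T0 T1 g) (regular_module R)"
      "\<And>x. x \<in> carrier (regular_module R) \<Longrightarrow> f' (f x) = x"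
      by (rule Hom_inv[OF LR fK f1(2)]) (use exact in simp, rule that)
    \<comment> \<open>\<open>y\<close> is the value of this map at one. Once the map is extended to
      \<open>H\<close>, \<open>y\<close> is the image of an element of \<open>T0\<close>.\<close>
    have ry: "(\<lambda>r. r \<odot>\<^bsub>Y\<^esub> y) \<in> Hom R (regular_module R) Y"
      using y by (intro HomI) (auto simp: Y.smult_l_distr Y.smult_assoc)
    have n0: "(\<lambda>xs. xs ! 0) \<in> Hom R ?B T0" using Hom_nth[of 0 "[T0, Y1]" R] by simp
    have "(\<lambda>xs. xs ! 0) \<in> Hom R (Ker ?B (module_power T n) ?q) (Ker T0 T1 g)"
      by (rule Hom_into_sub[OF Hom_from_Ker[OF n0]]) (use kq exact in auto)
    note h = Hom_comp[OF Hom_comp[OF this f'(1)] ry]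
    obtain H where H: "H \<in> Hom R ?B Y"
      "\<And>xs. xs \<in> a_kernel ?B (module_power T n) ?q \<Longrightarrow> H xs = f' (xs ! 0) \<odot>\<^bsub>Y\<^esub> y"
      by (rule extends_fromE[OF extB h]) (rule that)
    have one: "\<one>\<^bsub>R\<^esub> \<in> carrier R" using Y.R.one_closed .
    have Hy: "H [f \<one>\<^bsub>R\<^esub>, \<zero>\<^bsub>Y1\<^esub>] = y"
      using H(2)[of "[f \<one>\<^bsub>R\<^esub>, \<zero>\<^bsub>Y1\<^esub>]"] kq one f'(2) y by auto
    have e: "(\<lambda>b. [b, \<zero>\<^bsub>Y1\<^esub>]) \<in> Hom R T0 ?B"
      by (rule HomI) (auto simp: pair_direct_sum Y1.smult_zero_right simp del: direct_sum_simps)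
    \<comment> \<open>\<open>T0\<close> is a quotient of a power of \<open>T\<close>, so its image
      under \<open>H\<close> lies in every submodule that contains all images of
      \<open>T\<close>.\<close>
    obtain j0 where j0: "j0 \<in> Hom R (module_power T m) (direct_sum [T0, Y0])"
      "\<And>x. x \<in> carrier (direct_sum [T0, Y0]) \<Longrightarrow> j0 (i0 x) = x"
      by (rule Hom_inv[OF LD(2) i0]) (rule that)
    have n0': "(\<lambda>xs. xs ! 0) \<in> Hom R (direct_sum [T0, Y0]) T0" using Hom_nth[of 0 "[T0, Y0]" R] by simp
    have \<Phi>: "(\<lambda>z. H [j0 z ! 0, \<zero>\<^bsub>Y1\<^esub>]) \<in> Hom R (module_power T m) Y"
      by (rule Hom_comp[OF Hom_comp[OF j0(1) n0'] Hom_comp[OF e H(1)]])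
    obtain \<iota>' where W': "is_power R T m (module_power T m) \<iota>' (\<lambda>j xs. xs ! j)"
      by (rule is_power_module_power[OF LT])
    let ?V = "{z \<in> carrier (module_power T m). H [j0 z ! 0, \<zero>\<^bsub>Y1\<^esub>] \<in> U}"
    have "submodule ?V R (module_power T m)" by (rule submodule_vimage[OF is_powerD(2)[OF W'] LY \<Phi> U(1)])
    moreover have "\<forall>k\<in>Hom R T (module_power T m). k ` carrier T \<subseteq> ?V"
    proof
      fix k assume k: "k \<in> Hom R T (module_power T m)"
      have "(\<lambda>t. H [j0 (k t) ! 0, \<zero>\<^bsub>Y1\<^esub>]) ` carrier T \<subseteq> U" by (rule bspec[OF U(2) Hom_comp[OF k \<Phi>]])
      then show "k ` carrier T \<subseteq> ?V" using HomD(1)[OF k] by (auto simp del: direct_sum_simps)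
    qed
    ultimately have V: "carrier (module_power T m) \<subseteq> ?V"
      by (rule generated_byD[OF generated_by_power[OF W' T]])
    have c: "[f \<one>\<^bsub>R\<^esub>, \<zero>\<^bsub>Y0\<^esub>] \<in> carrier (direct_sum [T0, Y0])"
      using HomD(1)[OF f1(1)] one by (simp add: pair_direct_sum del: direct_sum_simps)
    have "H [j0 (i0 [f \<one>\<^bsub>R\<^esub>, \<zero>\<^bsub>Y0\<^esub>]) ! 0, \<zero>\<^bsub>Y1\<^esub>] \<in> U"
      using V HomD(1)[OF i0(1) c] by blast
    then show "y \<in> U" unfolding j0(2)[OF c] using Hy by simp
  qed
qed

end

section \<open>The functor represented by a module\<close>

text \<open>Precomposition is a right action of the endomorphisms, hence a left action of the
  opposite ring. Maps are extensional so that equality in the module is equality on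
  \<open>T\<close>.\<close>

definition Hom_module ::
    "('a, 'x) ring_scheme \<Rightarrow> ('a, 't) module \<Rightarrow> ('a, 'm) module \<Rightarrow> ('t \<Rightarrow> 't, 't \<Rightarrow> 'm) module" where
  "Hom_module R T X = \<lparr>carrier = Hom R T X \<inter> extensional (carrier T), mult = undefined,
     one = undefined, zero = (\<lambda>t\<in>carrier T. \<zero>\<^bsub>X\<^esub>), add = (\<lambda>f g. \<lambda>t\<in>carrier T. f t \<oplus>\<^bsub>X\<^esub> g t),
     smult = (\<lambda>b f. compose (carrier T) f b)\<rparr>"

lemma Hom_module_simps [simp]:
  "carrier (Hom_module R T X) = Hom R T X \<inter> extensional (carrier T)"
  "\<zero>\<^bsub>Hom_module R T X\<^esub> = (\<lambda>t\<in>carrier T. \<zero>\<^bsub>X\<^esub>)"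
  "f \<oplus>\<^bsub>Hom_module R T X\<^esub> g = (\<lambda>t\<in>carrier T. f t \<oplus>\<^bsub>X\<^esub> g t)"
  "b \<odot>\<^bsub>Hom_module R T X\<^esub> f = compose (carrier T) f b"
  by (simp_all add: Hom_module_def)

abbreviation End_op :: "('a, 'x) ring_scheme \<Rightarrow> ('a, 't) module \<Rightarrow> ('t \<Rightarrow> 't) ring" where
  "End_op R T \<equiv> op_ring (End_ring R T)"

lemma End_op_simps [simp]:
  "carrier (End_op R T) = Hom R T T \<inter> extensional (carrier T)"
  "\<zero>\<^bsub>End_op R T\<^esub> = (\<lambda>t\<in>carrier T. \<zero>\<^bsub>T\<^esub>)" "\<one>\<^bsub>End_op R T\<^esub> = (\<lambda>t\<in>carrier T. t)"
  "f \<oplus>\<^bsub>End_op R T\<^esub> g = (\<lambda>t\<in>carrier T. f t \<oplus>\<^bsub>T\<^esub> g t)"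
  "f \<otimes>\<^bsub>End_op R T\<^esub> g = compose (carrier T) g f"
  by (simp_all add: op_ring_def End_ring_def)

lemma ring_End_op: "left_module R T \<Longrightarrow> ring (End_op R T)"
  by (rule ring_op_ring[OF ring_End_ring])

lemma compose_mem:
  assumes "left_module R T" "f \<in> Hom R T X" "g \<in> Hom R X Y"
  shows "compose (carrier T) g f \<in> Hom R T Y \<inter> extensional (carrier T)"
  using Hom_cong[OF Hom_comp[OF assms(2,3)] _ assms(1), of "compose (carrier T) g f"]
  by (auto simp: compose_def)

lemma restrict_mem:
  assumes "left_module R T" "f \<in> Hom R T X"
  shows "restrict f (carrier T) \<in> Hom R T X \<inter> extensional (carrier T)"
  using Hom_cong[OF assms(2) _ assms(1), of "restrict f (carrier T)"] by auto

lemma Hom_module_eqI: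
  "\<lbrakk>f \<in> extensional (carrier T); g \<in> extensional (carrier T); \<And>t. t \<in> carrier T \<Longrightarrow> f t = g t\<rbrakk> \<Longrightarrow> f = g"
  by (rule extensionalityI[of _ "carrier T"])

text \<open>The \<open>mult\<close> and \<open>one\<close> fields of a module record have no
  meaning, so they may differ.\<close>

lemma left_module_cong:
  assumes "left_module R M" "carrier N = carrier M" "add N = add M" "\<zero>\<^bsub>N\<^esub> = \<zero>\<^bsub>M\<^esub>" "smult N = smult M"
  shows "left_module R N"
proof -
  interpret left_module R M by fact
  show ?thesis
    apply (intro left_module.intro left_module_axioms.intro)
        apply (rule R.ring_axioms)
       apply (rule abelian_groupI)
    subgoal by (simp add: assms)
    subgoal by (simp add: assms)
    subgoal by (simp add: assms M.a_assoc)
    subgoal by (simp add: assms M.a_comm)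
    subgoal by (simp add: assms)
    subgoal for x by (rule bexI[of _ "\<ominus>\<^bsub>M\<^esub> x"]) (auto simp: assms M.l_neg)
    by (simp_all add: assms(2-) smult_l_distr smult_r_distr smult_assoc)
qed

lemma left_module_Hom_module:
  fixes T :: "('a, 't) module" and X :: "('a, 'm) module"
  assumes T: "left_module R T" and X: "left_module R X"
  shows "left_module (End_op R T) (Hom_module R T X)"
proof -
  interpret X: left_module R X by (rule X)
  interpret T: left_module R T by (rule T)
  have A: "abelian_group (Hom_module R T X)"
  proof (rule abelian_groupI)
    fix f g assume f: "f \<in> carrier (Hom_module R T X)" and g: "g \<in> carrier (Hom_module R T X)"
    show "f \<oplus>\<^bsub>Hom_module R T X\<^esub> g \<in> carrier (Hom_module R T X)"
      using f g restrict_mem[OF T Hom_plus[OF X, of f T g]] by simp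
    show "f \<oplus>\<^bsub>Hom_module R T X\<^esub> g = g \<oplus>\<^bsub>Hom_module R T X\<^esub> f"
      by (rule Hom_module_eqI[of _ T]) (use f g in \<open>auto simp: X.M.a_comm HomD(1)\<close>)
  next
    fix f g h assume "f \<in> carrier (Hom_module R T X)" "g \<in> carrier (Hom_module R T X)" "h \<in> carrier (Hom_module R T X)"
    then show "f \<oplus>\<^bsub>Hom_module R T X\<^esub> g \<oplus>\<^bsub>Hom_module R T X\<^esub> h = f \<oplus>\<^bsub>Hom_module R T X\<^esub> (g \<oplus>\<^bsub>Hom_module R T X\<^esub> h)"
      by (intro Hom_module_eqI[of _ T]) (auto simp: X.M.a_assoc HomD(1))
  next
    show "\<zero>\<^bsub>Hom_module R T X\<^esub> \<in> carrier (Hom_module R T X)"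
      using restrict_mem[OF T Hom_const_zero[OF X]] by simp
  next
    fix f assume f: "f \<in> carrier (Hom_module R T X)"
    show "\<zero>\<^bsub>Hom_module R T X\<^esub> \<oplus>\<^bsub>Hom_module R T X\<^esub> f = f"
      by (rule Hom_module_eqI[of _ T]) (use f in \<open>auto simp: HomD(1)\<close>)
    have "(\<lambda>t. \<zero>\<^bsub>X\<^esub> \<ominus>\<^bsub>X\<^esub> f t) \<in> Hom R T X"
      using f by (intro Hom_diff[OF X Hom_const_zero[OF X]]) simp
    from restrict_mem[OF T this]
    show "\<exists>g\<in>carrier (Hom_module R T X). g \<oplus>\<^bsub>Hom_module R T X\<^esub> f = \<zero>\<^bsub>Hom_module R T X\<^esub>"
      by (intro bexI[of _ "\<lambda>t\<in>carrier T. \<zero>\<^bsub>X\<^esub> \<ominus>\<^bsub>X\<^esub> f t"] Hom_module_eqI[of _ T])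
        (use f in \<open>auto simp: HomD(1) X.M.minus_add_cancel\<close>)
  qed
  show ?thesis
  proof (intro left_module.intro left_module_axioms.intro A ring_End_op[OF T])
    fix b f assume b: "b \<in> carrier (End_op R T)" and f: "f \<in> carrier (Hom_module R T X)"
    show "b \<odot>\<^bsub>Hom_module R T X\<^esub> f \<in> carrier (Hom_module R T X)"
      using b f compose_mem[OF T, of b T f X] by simp
  next
    fix b c f assume "b \<in> carrier (End_op R T)" "c \<in> carrier (End_op R T)" "f \<in> carrier (Hom_module R T X)"
    then show "(b \<oplus>\<^bsub>End_op R T\<^esub> c) \<odot>\<^bsub>Hom_module R T X\<^esub> f =
        b \<odot>\<^bsub>Hom_module R T X\<^esub> f \<oplus>\<^bsub>Hom_module R T X\<^esub> c \<odot>\<^bsub>Hom_module R T X\<^esub> f"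
      "b \<otimes>\<^bsub>End_op R T\<^esub> c \<odot>\<^bsub>Hom_module R T X\<^esub> f = b \<odot>\<^bsub>Hom_module R T X\<^esub> (c \<odot>\<^bsub>Hom_module R T X\<^esub> f)"
      by (auto intro!: Hom_module_eqI[of _ T] simp: compose_def HomD)
  next
    fix b f g assume "b \<in> carrier (End_op R T)" "f \<in> carrier (Hom_module R T X)" "g \<in> carrier (Hom_module R T X)"
    then show "b \<odot>\<^bsub>Hom_module R T X\<^esub> (f \<oplus>\<^bsub>Hom_module R T X\<^esub> g) =
        b \<odot>\<^bsub>Hom_module R T X\<^esub> f \<oplus>\<^bsub>Hom_module R T X\<^esub> b \<odot>\<^bsub>Hom_module R T X\<^esub> g"
      by (auto intro!: Hom_module_eqI[of _ T] simp: compose_def HomD)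
  next
    fix f assume "f \<in> carrier (Hom_module R T X)"
    then show "\<one>\<^bsub>End_op R T\<^esub> \<odot>\<^bsub>Hom_module R T X\<^esub> f = f"
      by (auto intro!: Hom_module_eqI[of _ T] simp: compose_def)
  qed
qed

lemma Hom_module_finsum:
  assumes T: "left_module R T" and X: "left_module R X" and "finite A"
    and "\<And>a. a \<in> A \<Longrightarrow> f a \<in> carrier (Hom_module R T X)" and t: "t \<in> carrier T"
  shows "(\<Oplus>\<^bsub>Hom_module R T X\<^esub>a\<in>A. f a) t = (\<Oplus>\<^bsub>X\<^esub>a\<in>A. f a t)"
  using assms(3,4)
proof (induction A)
  case empty
  interpret X: left_module R X by (rule X)
  interpret F: left_module "End_op R T" "Hom_module R T X" by (rule left_module_Hom_module[OF T X])
  show ?case using t by (simp only: F.M.finsum_empty X.M.finsum_empty Hom_module_simps(2) restrict_apply if_True)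
next
  case (insert a A)
  interpret X: left_module R X by (rule X)
  interpret F: left_module "End_op R T" "Hom_module R T X" by (rule left_module_Hom_module[OF T X])
  have c: "f b t \<in> carrier X" if "b \<in> insert a A" for b using insert.prems[OF that] HomD(1)[OF _ t] by auto
  have "(\<Oplus>\<^bsub>Hom_module R T X\<^esub>a\<in>insert a A. f a) t = (f a \<oplus>\<^bsub>Hom_module R T X\<^esub> (\<Oplus>\<^bsub>Hom_module R T X\<^esub>a\<in>A. f a)) t"
    using insert.hyps insert.prems by (subst F.M.finsum_insert) (auto simp del: Hom_module_simps)
  also have "\<dots> = f a t \<oplus>\<^bsub>X\<^esub> (\<Oplus>\<^bsub>X\<^esub>a\<in>A. f a t)" using insert.IH insert.prems t by simp
  also have "\<dots> = (\<Oplus>\<^bsub>X\<^esub>a\<in>insert a A. f a t)" using insert.hyps c by (subst X.M.finsum_insert) auto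
  finally show ?case .
qed

lemma Hom_module_map:
  assumes "left_module R T" "f \<in> Hom R X Y"
  shows "compose (carrier T) f \<in> Hom (End_op R T) (Hom_module R T X) (Hom_module R T Y)"
proof (rule HomI)
  show "compose (carrier T) f h \<in> carrier (Hom_module R T Y)" if "h \<in> carrier (Hom_module R T X)" for h
    using that compose_mem[OF assms(1) _ assms(2)] by simp
qed (use HomD[OF assms(2)] in \<open>auto intro!: Hom_module_eqI[of _ T] simp: compose_def HomD(1)\<close>)

text \<open>Hom(T, _) is additive and sends \<open>T\<close> to the regular module of the opposite
  endomorphism ring, so it turns powers of \<open>T\<close> into free modules. Hom(T, T) and the
  regular module differ only in record fields without meaning.\<close>

lemma is_power_Hom_module:
  fixes T :: "('a, 't) module" and W :: "('a, 'w) module"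
  assumes W: "is_power R T c W \<iota> \<pi>"
  shows "is_power (End_op R T) (regular_module (End_op R T)) c (Hom_module R T W)
    (\<lambda>j. compose (carrier T) (\<iota> j)) (\<lambda>j. compose (carrier T) (\<pi> j))"
proof -
  note W' = is_powerD[OF W]
  note LF = left_module_Hom_module[OF W'(1)]
  have eq: "f \<in> Hom (End_op R T) (regular_module (End_op R T)) (Hom_module R T W) \<longleftrightarrow>
      f \<in> Hom (End_op R T) (Hom_module R T T) (Hom_module R T W)"
    "g \<in> Hom (End_op R T) (Hom_module R T W) (regular_module (End_op R T)) \<longleftrightarrow>
      g \<in> Hom (End_op R T) (Hom_module R T W) (Hom_module R T T)" for f g
    unfolding left_module_hom_def hom_def by simp_all
  show ?thesis
    unfolding is_power_def
  proof (intro conjI allI impI ballI left_module_regular ring_End_op[OF W'(1)] LF[OF W'(2)])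
    fix j assume j: "j < c"
    show "compose (carrier T) (\<iota> j) \<in> Hom (End_op R T) (regular_module (End_op R T)) (Hom_module R T W)"
      unfolding eq by (rule Hom_module_map[OF W'(1) W'(3)[OF j]])
    show "compose (carrier T) (\<pi> j) \<in> Hom (End_op R T) (Hom_module R T W) (regular_module (End_op R T))"
      unfolding eq by (rule Hom_module_map[OF W'(1) W'(4)[OF j]])
  next
    fix j k b assume "j < c" "k < c" "b \<in> carrier (regular_module (End_op R T))"
    then show "compose (carrier T) (\<pi> j) (compose (carrier T) (\<iota> k) b) =
        (if j = k then b else \<zero>\<^bsub>regular_module (End_op R T)\<^esub>)"
      using W'(5) by (auto intro!: Hom_module_eqI[of _ T] simp: compose_def HomD(1))
  next
    fix w assume w: "w \<in> carrier (Hom_module R T W)"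
    have c: "compose (carrier T) (\<iota> j) (compose (carrier T) (\<pi> j) w) \<in> carrier (Hom_module R T W)" if "j < c" for j
      using HomD(1)[OF Hom_module_map[OF W'(1) W'(3)[OF that]] HomD(1)[OF Hom_module_map[OF W'(1) W'(4)[OF that]] w]] .
    interpret F: left_module "End_op R T" "Hom_module R T W" by (rule LF[OF W'(2)])
    let ?s = "\<Oplus>\<^bsub>Hom_module R T W\<^esub>j\<in>{..<c}. compose (carrier T) (\<iota> j) (compose (carrier T) (\<pi> j) w)"
    have "?s \<in> carrier (Hom_module R T W)" using c by (intro F.M.finsum_closed) auto
    moreover have "?s t = w t" if t: "t \<in> carrier T" for t
    proof -
      have "?s t = (\<Oplus>\<^bsub>W\<^esub>j\<in>{..<c}. compose (carrier T) (\<iota> j) (compose (carrier T) (\<pi> j) w) t)"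
        by (rule Hom_module_finsum[OF W'(1,2) _ _ t]) (use c in auto)
      also have "\<dots> = (\<Oplus>\<^bsub>W\<^esub>j\<in>{..<c}. \<iota> j (\<pi> j (w t)))" using t by (simp add: compose_def)
      also have "\<dots> = w t" using w t by (intro W'(6)) (auto simp: HomD(1))
      finally show ?thesis .
    qed
    ultimately show "?s = w" using w by (intro Hom_module_eqI[of _ T]) auto
  qed
qed

text \<open>The coordinate injections form a basis of the free module Hom(T, W), so \<open>h\<close>
  is determined by their images \<open>f j\<close>, and these assemble to a map on
  \<open>W\<close>.\<close>

lemma Hom_module_full:
  assumes W: "is_power R T c W \<iota> \<pi>" and X: "left_module R X"
    and h: "h \<in> Hom (End_op R T) (Hom_module R T W) (Hom_module R T X)"
  obtains g where "g \<in> Hom R W X" "\<And>w. w \<in> carrier (Hom_module R T W) \<Longrightarrow> h w = compose (carrier T) g w"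
proof -
  note W' = is_powerD[OF W]
  note LF = left_module_Hom_module[OF W'(1)]
  define f where "f j = h (restrict (\<iota> j) (carrier T))" for j
  have \<iota>: "restrict (\<iota> j) (carrier T) \<in> carrier (Hom_module R T W)" if "j < c" for j
    using restrict_mem[OF W'(1) W'(3)[OF that]] by simp
  have f: "f j \<in> Hom R T X" "f j \<in> carrier (Hom_module R T X)" if "j < c" for j
    using HomD(1)[OF h \<iota>[OF that]] by (auto simp: f_def)
  define g where "g w = (\<Oplus>\<^bsub>X\<^esub>j\<in>{..<c}. f j (\<pi> j w))" for w
  have "g \<in> Hom R W X" unfolding g_def by (rule power_hom(1)[OF W X f(1)])
  moreover have "h w = compose (carrier T) g w" if w: "w \<in> carrier (Hom_module R T W)" for w
  proof (rule Hom_module_eqI[of _ T])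
    show "h w \<in> extensional (carrier T)" using HomD(1)[OF h w] by simp
    show "compose (carrier T) g w \<in> extensional (carrier T)" by (simp add: compose_extensional)
    fix t assume t: "t \<in> carrier T"
    have p: "compose (carrier T) (\<pi> j) w \<in> carrier (End_op R T)" if "j < c" for j
      using HomD(1)[OF Hom_module_map[OF W'(1) W'(4)[OF that]] w] by simp
    \<comment> \<open>The j-th summand of \<open>w\<close> is the multiple of the j-th basis element
      by the endomorphism \<open>\<pi> j w\<close>, so linearity of \<open>h\<close> over the
      endomorphism ring applies.\<close>
    have e: "h (compose (carrier T) (\<iota> j) (compose (carrier T) (\<pi> j) w)) = compose (carrier T) (f j) (compose (carrier T) (\<pi> j) w)"
      if j: "j < c" for j
    proof -
      have "compose (carrier T) (\<iota> j) (compose (carrier T) (\<pi> j) w) =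
          compose (carrier T) (\<pi> j) w \<odot>\<^bsub>Hom_module R T W\<^esub> restrict (\<iota> j) (carrier T)"
        using HomD(1)[OF W'(4)[OF j]] HomD(1)[of w R T W] w
        by (intro Hom_module_eqI[of _ T]) (auto simp: compose_def)
      then show ?thesis using HomD(3)[OF h p[OF j] \<iota>[OF j]] by (simp add: f_def)
    qed
    have c: "h (compose (carrier T) (\<iota> j) (compose (carrier T) (\<pi> j) w)) \<in> carrier (Hom_module R T X)" if "j < c" for j
      using HomD(1)[OF h HomD(1)[OF Hom_module_map[OF W'(1) W'(3)[OF that]]
            HomD(1)[OF Hom_module_map[OF W'(1) W'(4)[OF that]] w]]] .
    have "h w t = (\<Oplus>\<^bsub>Hom_module R T X\<^esub>j\<in>{..<c}. h (compose (carrier T) (\<iota> j) (compose (carrier T) (\<pi> j) w))) t"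
      using power_hom_eq[OF is_power_Hom_module[OF W] LF[OF X] h w] by (rule arg_cong)
    also have "\<dots> = (\<Oplus>\<^bsub>X\<^esub>j\<in>{..<c}. h (compose (carrier T) (\<iota> j) (compose (carrier T) (\<pi> j) w)) t)"
      by (rule Hom_module_finsum[OF W'(1) X _ _ t]) (use c in auto)
    also have "\<dots> = (\<Oplus>\<^bsub>X\<^esub>j\<in>{..<c}. f j (\<pi> j (w t)))"
    proof -
      interpret X: left_module R X by (rule X)
      have "h (compose (carrier T) (\<iota> j) (compose (carrier T) (\<pi> j) w)) t = f j (\<pi> j (w t))" if "j < c" for j
        unfolding e[OF that] using t by (simp add: compose_def)
      then show ?thesis
        using t w HomD(1)[OF f(1)] HomD(1)[OF W'(4)] HomD(1)[of w R T W]
        by (intro X.M.finsum_cong') auto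
    qed
    finally show "h w t = compose (carrier T) g w t" using t by (simp add: compose_def g_def)
  qed
  ultimately show thesis by (rule that)
qed

section \<open>The endomorphism algebra and right approximations\<close>

context artin_alg
begin

text \<open>The structure map of the endomorphism algebra over \<open>K\<close>; its values are
  linear because \<open>\<phi> c\<close> is central.\<close>

definition End_scalar :: "('a, 't) module \<Rightarrow> 'k \<Rightarrow> 't \<Rightarrow> 't" where
  "End_scalar T c = (\<lambda>t\<in>carrier T. \<phi> c \<odot>\<^bsub>T\<^esub> t)"

lemma artinD:
  "cring K" "ring K" "\<phi> \<in> ring_hom K R" "artinian_cring K"
  "\<lbrakk>c \<in> carrier K; a \<in> carrier R\<rbrakk> \<Longrightarrow> \<phi> c \<otimes>\<^bsub>R\<^esub> a = a \<otimes>\<^bsub>R\<^esub> \<phi> c"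
  using artin by (auto simp: artin_algebra_def artinian_cring_def cring_def)

lemma End_scalar_mem:
  assumes "left_module R T" "c \<in> carrier K"
  shows "End_scalar T c \<in> carrier (End_op R T)"
proof -
  interpret T: left_module R T by fact
  have c: "\<phi> c \<in> carrier R" by (rule ring_hom_memE(1)[OF artinD(3) assms(2)])
  have "(\<lambda>t. \<phi> c \<odot>\<^bsub>T\<^esub> t) \<in> Hom R T T"
    using c artinD(5)[OF assms(2)] by (intro HomI) (auto simp: T.smult_r_distr T.smult_assoc[symmetric])
  from restrict_mem[OF assms(1) this] show ?thesis by (simp add: End_scalar_def)
qed

lemma End_scalar_ring_hom:
  assumes "left_module R T" shows "End_scalar T \<in> ring_hom K (End_op R T)"
proof (rule ring_hom_memI)
  interpret T: left_module R T by fact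
  interpret K: cring K by (rule artinD(1))
  note \<phi> = ring_hom_memE[OF artinD(3)]
  show "End_scalar T c \<in> carrier (End_op R T)" if "c \<in> carrier K" for c by (rule End_scalar_mem[OF assms that])
  show "End_scalar T (c \<otimes>\<^bsub>K\<^esub> d) = End_scalar T c \<otimes>\<^bsub>End_op R T\<^esub> End_scalar T d"
    if "c \<in> carrier K" "d \<in> carrier K" for c d
    using that by (subst K.m_comm) (auto intro!: Hom_module_eqI[of _ T] simp: End_scalar_def compose_def \<phi> T.smult_assoc)
  show "End_scalar T (c \<oplus>\<^bsub>K\<^esub> d) = End_scalar T c \<oplus>\<^bsub>End_op R T\<^esub> End_scalar T d"
    if "c \<in> carrier K" "d \<in> carrier K" for c d
    using that by (auto intro!: Hom_module_eqI[of _ T] simp: End_scalar_def \<phi> T.smult_l_distr)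
  show "End_scalar T \<one>\<^bsub>K\<^esub> = \<one>\<^bsub>End_op R T\<^esub>"
    by (auto intro!: Hom_module_eqI[of _ T] simp: End_scalar_def \<phi>)
qed

text \<open>Evaluation at finitely many generators of \<open>T\<close> embeds \<open>Hom(T, X)\<close> into a power of \<open>X\<close>.\<close>

lemma Hom_module_noetherian:
  fixes T :: "('a, 't) module" and X :: "('a, 'm) module"
  assumes T: "fg_module R T" and X: "fg_module R X"
  shows "noetherian_module K (restrict_scalars (End_scalar T) (Hom_module R T X))"
  unfolding noetherian_module_def
proof (intro allI impI)
  note LT = fg_moduleD[OF T] and LX = fg_moduleD[OF X]
  interpret T: left_module R T by (rule LT)
  interpret X: left_module R X by (rule LX)
  let ?F = "restrict_scalars (End_scalar T) (Hom_module R T X)" and ?X = "restrict_scalars \<phi> X"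
  have LF: "left_module K ?F"
    by (rule left_module_restrict_scalars[OF artinD(2) End_scalar_ring_hom[OF LT] left_module_Hom_module[OF LT LX]])
  have LK: "left_module K ?X" by (rule left_module_restrict_scalars[OF artinD(2,3) LX])
  have ev: "(\<lambda>f. f t) \<in> Hom K ?F ?X" if "t \<in> carrier T" for t
    using that ring_hom_memE(1)[OF artinD(3)] by (intro HomI) (auto simp: HomD End_scalar_def compose_def)
  fix S assume S: "submodule S K ?F"
  \<comment> \<open>Generators of \<open>T\<close> are evaluated one at a time: the values form a
    submodule of \<open>X\<close>, which is noetherian over \<open>K\<close>, and the maps vanishing
    at the generator are left to the next one.\<close>
  have step: "fgen K ?F S" if "finite A" "A \<subseteq> carrier T" "submodule S K ?F" "fgen K ?F {f \<in> S. \<forall>t\<in>A. f t = \<zero>\<^bsub>X\<^esub>}" for A S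
    using that
  proof (induction A arbitrary: S)
    case (insert a A)
    have a: "a \<in> carrier T" using insert.prems(1) by simp
    have eS: "a_kernel ?F ?X (\<lambda>f. f a) \<inter> S = {f \<in> S. f a = \<zero>\<^bsub>X\<^esub>}"
      using submoduleD(1)[OF insert.prems(2)] by (auto simp: kernel_iff)
    have S': "submodule {f \<in> S. f a = \<zero>\<^bsub>X\<^esub>} K ?F"
      using submodule_inter[OF submodule_kernel[OF LF LK ev[OF a]] insert.prems(2)] unfolding eS .
    have "{f \<in> {f \<in> S. f a = \<zero>\<^bsub>X\<^esub>}. \<forall>t\<in>A. f t = \<zero>\<^bsub>X\<^esub>} = {f \<in> S. \<forall>t\<in>insert a A. f t = \<zero>\<^bsub>X\<^esub>}" by auto
    then have "fgen K ?F {f \<in> S. f a = \<zero>\<^bsub>X\<^esub>}" using insert.IH[OF _ S'] insert.prems(1,3) by simp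
    moreover have "fgen K ?X ((\<lambda>f. f a) ` S)"
      using artin_algebra_noetherian[OF artin X] submodule_image[OF LF LK ev[OF a] insert.prems(2)]
      by (simp add: noetherian_module_def)
    ultimately show ?case by (intro fgen_extension[OF LF LK ev[OF a] insert.prems(2)]) simp_all
  qed simp
  obtain A where A: "finite A" "A \<subseteq> carrier T" "\<And>U. submodule U R T \<Longrightarrow> A \<subseteq> U \<Longrightarrow> carrier T \<subseteq> U"
    using T by (auto simp: fg_module_iff_fgen fgen_def)
  have z: "f = \<zero>\<^bsub>?F\<^esub>" if f: "f \<in> S" "\<forall>t\<in>A. f t = \<zero>\<^bsub>X\<^esub>" for f
  proof -
    have fH: "f \<in> Hom R T X" "f \<in> extensional (carrier T)" using f(1) submoduleD(1)[OF S] by auto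
    have "carrier T \<subseteq> a_kernel T X f"
      by (rule A(3)[OF submodule_kernel[OF LT LX fH(1)]]) (use f(2) A(2) in \<open>auto simp: kernel_iff\<close>)
    then show ?thesis using fH(2) by (auto intro!: Hom_module_eqI[of _ T] simp: kernel_iff)
  qed
  then have "{f \<in> S. \<forall>t\<in>A. f t = \<zero>\<^bsub>X\<^esub>} = {\<zero>\<^bsub>?F\<^esub>}"
    using submoduleD(2)[OF S] A(2) by auto
  then show "fgen K ?F S" using fgen_zero[OF LF] by (intro step[OF A(1,2) S]) simp
qed

text \<open>Finitely many elements generate over \<open>K\<close> already, and \<open>K\<close> acts
  through the endomorphism ring.\<close>

lemma Hom_module_fg:
  assumes T: "fg_module R T" and X: "fg_module R X"
  shows "fg_module (End_op R T) (Hom_module R T X)"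
proof -
  note LT = fg_moduleD[OF T] and LX = fg_moduleD[OF X]
  note LF = left_module_Hom_module[OF LT LX]
  have "fgen K (restrict_scalars (End_scalar T) (Hom_module R T X)) (carrier (Hom_module R T X))"
    using Hom_module_noetherian[OF T X]
      submodule_restrict_scalars[OF End_scalar_ring_hom[OF LT] submodule_carrier[OF LF] LF artinD(2)]
    by (simp add: noetherian_module_def del: Hom_module_simps)
  from fgen_restrict_scalarsD[OF End_scalar_ring_hom[OF LT] LF artinD(2) this] LF
  show ?thesis by (simp add: fg_module_iff_fgen)
qed

text \<open>Needed to present modules over the endomorphism ring: the kernel of a free cover is then
  finitely generated and has a free cover itself.\<close>

lemma artin_algebra_End_op:
  fixes T :: "('a, 't) module"
  assumes T: "fg_module R T"
  shows "artin_algebra K (End_scalar T) (End_op R T)"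
  unfolding artin_algebra_def
proof (intro conjI ballI artinD(4) ring_End_op End_scalar_ring_hom fg_moduleD[OF T])
  note LT = fg_moduleD[OF T]
  interpret T: left_module R T by (rule LT)
  fix c b assume "c \<in> carrier K" "b \<in> carrier (End_op R T)"
  then show "End_scalar T c \<otimes>\<^bsub>End_op R T\<^esub> b = b \<otimes>\<^bsub>End_op R T\<^esub> End_scalar T c"
    using ring_hom_memE(1)[OF artinD(3)]
    by (auto intro!: Hom_module_eqI[of _ T] simp: compose_def End_scalar_def HomD)
next
  note LT = fg_moduleD[OF T]
  note LF = left_module_Hom_module[OF LT LT]
  let ?F = "restrict_scalars (End_scalar T) (Hom_module R T T)"
  have "fgen K ?F (carrier ?F)"
    using Hom_module_noetherian[OF T T] submodule_carrier[OF
      left_module_restrict_scalars[OF artinD(2) End_scalar_ring_hom[OF LT] LF]]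
    by (simp add: noetherian_module_def del: Hom_module_simps)
  then have F: "fg_module K ?F"
    using left_module_restrict_scalars[OF artinD(2) End_scalar_ring_hom[OF LT] LF] by (simp add: fg_module_iff_fgen)
  have "left_module K (scalar_module (End_scalar T) (End_op R T))"
    by (rule left_module_cong[OF fg_moduleD[OF F]]) (auto simp: scalar_module_def fun_eq_iff)
  moreover have "(\<lambda>x. x) \<in> epi_hom K ?F (scalar_module (End_scalar T) (End_op R T))"
    by (rule epi_homI, rule HomI) (auto simp: scalar_module_def)
  ultimately show "fg_module K (scalar_module (End_scalar T) (End_op R T))" by (rule fg_epi[OF F])
qed

text \<open>\<open>W\<close> has one copy of \<open>T\<close> for each member of a finite generating
  set of Hom(T, X) over the endomorphism ring. The maps that lift through \<open>q\<close> form a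
  submodule containing these generators, so all maps lift; then \<open>q\<close> is surjective
  because \<open>T\<close> generates \<open>X\<close>.\<close>

lemma right_approximation:
  fixes T :: "('a, 't) module" and X :: "('a, 'm) module"
  assumes T: "fg_module R T" and X: "generated_by R T X"
  obtains c and W :: "'a fgmod" and \<iota> \<pi> q where "is_power R T c W \<iota> \<pi>" "fg_module R W" "q \<in> epi_hom R W X"
    "\<And>f. f \<in> Hom R T X \<Longrightarrow> \<exists>f'\<in>Hom R T W. \<forall>t\<in>carrier T. q (f' t) = f t"
proof -
  have fgX: "fg_module R X" using X by (simp add: generated_by_def)
  note LT = fg_moduleD[OF T] and LX = fg_moduleD[OF fgX]
  interpret X: left_module R X by (rule LX)
  note LF = left_module_Hom_module[OF LT]
  obtain A where A: "finite A" "A \<subseteq> carrier (Hom_module R T X)"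
    "\<And>U. submodule U (End_op R T) (Hom_module R T X) \<Longrightarrow> A \<subseteq> U \<Longrightarrow> carrier (Hom_module R T X) \<subseteq> U"
    using Hom_module_fg[OF T fgX] unfolding fg_module_iff_fgen fgen_def by blast
  obtain as where as: "set as = A" using finite_list[OF A(1)] by blast
  let ?c = "length as"
  obtain W :: "'a fgmod" and \<iota> \<pi> where W: "is_power R T ?c W \<iota> \<pi>" "fg_module R W"
    by (rule power_exists[OF T]) (rule that)
  note W' = is_powerD[OF W(1)]
  interpret W: left_module R W by (rule W'(2))
  have asH: "as ! j \<in> Hom R T X" "as ! j \<in> extensional (carrier T)" if "j < ?c" for j
    using A(2) as nth_mem[OF that] by auto
  define q where "q w = (\<Oplus>\<^bsub>X\<^esub>j\<in>{..<?c}. (as ! j) (\<pi> j w))" for w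
  have q: "q \<in> Hom R W X" unfolding q_def by (rule power_hom(1)[OF W(1) LX asH(1)])
  have q\<iota>: "q (\<iota> k t) = (as ! k) t" if "k < ?c" "t \<in> carrier T" for k t
    unfolding q_def by (rule power_hom(2)[OF W(1) LX asH(1) that])
  let ?U = "compose (carrier T) q ` carrier (Hom_module R T W)"
  have "A \<subseteq> ?U"
  proof
    fix a assume "a \<in> A"
    then obtain k where k: "k < ?c" "as ! k = a" using as by (auto simp: in_set_conv_nth)
    have "a = compose (carrier T) q (restrict (\<iota> k) (carrier T))"
      using asH(2)[OF k(1)] k q\<iota>[OF k(1)] by (intro Hom_module_eqI[of _ T]) (auto simp: compose_def)
    then show "a \<in> ?U" using restrict_mem[OF LT W'(3)[OF k(1)]] by simp
  qed
  then have U: "carrier (Hom_module R T X) \<subseteq> ?U"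
    by (intro A(3) submodule_image[OF LF[OF W'(2)] LF[OF LX] Hom_module_map[OF LT q]]
        submodule_carrier[OF LF[OF W'(2)]])
  have lift: "\<exists>f'\<in>Hom R T W. \<forall>t\<in>carrier T. q (f' t) = f t" if f: "f \<in> Hom R T X" for f
  proof -
    have "restrict f (carrier T) \<in> ?U" using U restrict_mem[OF LT f] by auto
    then obtain f' where f': "f' \<in> carrier (Hom_module R T W)" "restrict f (carrier T) = compose (carrier T) q f'" by blast
    have "q (f' t) = f t" if "t \<in> carrier T" for t
      using fun_cong[OF f'(2), of t] that by (simp add: compose_def)
    then show ?thesis using f'(1) by auto
  qed
  have "carrier X \<subseteq> q ` carrier W"
  proof (rule generated_byD[OF X submodule_image[OF W'(2) LX q submodule_carrier[OF W'(2)]]], rule ballI)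
    fix f assume "f \<in> Hom R T X"
    from lift[OF this] obtain f' where f': "f' \<in> Hom R T W" "\<forall>t\<in>carrier T. q (f' t) = f t" by blast
    then show "f ` carrier T \<subseteq> q ` carrier W" using HomD(1)[OF f'(1)] by (auto simp: image_iff) metis
  qed
  then have "q \<in> epi_hom R W X" using q by (intro epi_homI) auto
  from that[OF W this lift] show thesis .
qed

end

section \<open>Projective dimension\<close>

text \<open>Defined by syzygies, since the bounds are built up one kernel at a time.\<close>

primrec pd_le :: "('a, 'x) ring_scheme \<Rightarrow> nat \<Rightarrow> 'a fgmod \<Rightarrow> bool" where
  "pd_le R 0 = (\<lambda>M. projective_module R M)"
| "pd_le R (Suc k) = (\<lambda>M. \<exists>(P :: 'a fgmod) p. projective_module R P \<and> p \<in> epi_hom R P M \<and>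
     pd_le R k (Ker P M p))"

text \<open>The cover of \<open>M\<close> is spliced in front of a resolution of its kernel.\<close>

lemma pd_le_resolution:
  assumes "pd_le R k M"
  shows "\<exists>P \<epsilon> d. projective_resolution R M P \<epsilon> d \<and> (\<forall>i>k. is_zero_module (P i))"
  using assms
proof (induction k arbitrary: M)
  case (0 M)
  then have M: "projective_module R M" by simp
  note LM = projectiveD(2)[OF M]
  interpret M: left_module R M by (rule LM)
  let ?Z = "M\<lparr>carrier := {\<zero>\<^bsub>M\<^esub>}\<rparr>"
  \<comment> \<open>With the zero modules realised inside \<open>M\<close>, the identity function
    serves as augmentation and as every differential.\<close>
  let ?P = "\<lambda>i :: nat. if i = 0 then M else ?Z"
  have Z: "projective_module R ?Z" by (rule zero_submodule_projective[OF LM])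
  have "projective_resolution R M ?P (\<lambda>x. x) (\<lambda>i x. x)"
    unfolding projective_resolution_def
  proof (intro conjI allI)
    show "(\<lambda>x. x) \<in> epi_hom R (?P 0) M" by (simp add: epi_hom_def Hom_id)
    show "(\<lambda>x. x) \<in> left_module_hom R (?P (Suc i)) (?P i)" for i
      by (rule HomI) auto
    show "(\<lambda>x. x) ` carrier (?P 1) = a_kernel (?P 0) M (\<lambda>x. x)" by (auto simp: kernel_iff)
    show "(\<lambda>x. x) ` carrier (?P (Suc (Suc i))) = a_kernel (?P (Suc i)) (?P i) (\<lambda>x. x)" for i
      by (auto simp: kernel_iff)
  qed (use M Z in auto)
  moreover have "\<forall>i>0. is_zero_module (?P i)" by (auto simp: is_zero_module_def)
  ultimately show ?case by blast
next
  case (Suc k M)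
  obtain P :: "'a fgmod" and p where P: "projective_module R P" "p \<in> epi_hom R P M" "pd_le R k (Ker P M p)"
    using Suc.prems by auto
  obtain Q \<epsilon> d where Q: "projective_resolution R (Ker P M p) Q \<epsilon> d" "\<forall>i>k. is_zero_module (Q i)"
    using Suc.IH[OF P(3)] by blast
  note Q' = Q(1)[unfolded projective_resolution_def]
  let ?P = "case_nat P Q" and ?d = "case_nat \<epsilon> d"
  have \<epsilon>: "\<epsilon> \<in> Hom R (Q 0) (Ker P M p)" "\<epsilon> ` carrier (Q 0) = a_kernel P M p"
    using Q' by (auto simp: epi_hom_def)
  have \<epsilon>P: "\<epsilon> \<in> Hom R (Q 0) P" by (rule Hom_from_sub[OF \<epsilon>(1)]) (auto simp: kernel_iff)
  have "projective_resolution R M ?P p ?d"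
    unfolding projective_resolution_def
  proof (intro conjI allI)
    show "projective_module R (?P i)" for i using P Q' by (cases i) auto
    show "p \<in> epi_hom R (?P 0) M" using P by simp
    show "?d i \<in> left_module_hom R (?P (Suc i)) (?P i)" for i using \<epsilon>P Q' by (cases i) auto
    show "?d 0 ` carrier (?P 1) = a_kernel (?P 0) M p" using \<epsilon>(2) by simp
    show "?d (Suc i) ` carrier (?P (Suc (Suc i))) = a_kernel (?P (Suc i)) (?P i) (?d i)" for i
      using Q' by (cases i) (auto simp: a_kernel_def')
  qed
  moreover have "\<forall>i>Suc k. is_zero_module (?P i)" using Q(2) by (auto split: nat.split)
  ultimately show ?case by blast
qed

lemma projdim_le: "pd_le R k M \<Longrightarrow> projdim R M \<le> enat k"
  unfolding projdim_def by (rule Inf_lower) (use pd_le_resolution in blast)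

lemma projdim_leE:
  assumes "projdim R M \<le> enat n"
  obtains P \<epsilon> d where "projective_resolution R M P \<epsilon> d" "\<And>i. i > n \<Longrightarrow> is_zero_module (P i)"
proof -
  \<comment> \<open>A strict bound on the infimum yields a resolution of some actual length below
    it.\<close>
  have "projdim R M < enat (Suc n)" using assms by (metis enat_ord_simps(2) le_less_trans lessI)
  then obtain k where "enat k < enat (Suc n)"
    "\<exists>P \<epsilon> d. projective_resolution R M P \<epsilon> d \<and> (\<forall>i>k. is_zero_module (P i))"
    unfolding projdim_def Inf_less_iff by blast
  then obtain P \<epsilon> d where k: "k \<le> n" and P: "projective_resolution R M P \<epsilon> d" "\<forall>i>k. is_zero_module (P i)"
    by auto
  show thesis by (rule that[OF P(1)]) (use k P(2) in auto)
qed

text \<open>Relates modules of different element types, such as Hom(T, X) and its copies in the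
  universe of modules over the endomorphism ring, with both maps at hand.\<close>

definition iso_modules :: "('a, 'x) ring_scheme \<Rightarrow> ('a, 'm) module \<Rightarrow> ('a, 'n) module \<Rightarrow> bool" where
  "iso_modules R M N \<longleftrightarrow> (\<exists>f g. f \<in> Hom R M N \<and> g \<in> Hom R N M \<and>
     (\<forall>x\<in>carrier M. g (f x) = x) \<and> (\<forall>y\<in>carrier N. f (g y) = y))"

lemma iso_modulesE:
  assumes "iso_modules R M N"
  obtains f g where "f \<in> Hom R M N" "g \<in> Hom R N M"
    "\<And>x. x \<in> carrier M \<Longrightarrow> g (f x) = x" "\<And>y. y \<in> carrier N \<Longrightarrow> f (g y) = y"
  using assms unfolding iso_modules_def by blast

lemma iso_modulesI:
  "\<lbrakk>f \<in> Hom R M N; g \<in> Hom R N M; \<And>x. x \<in> carrier M \<Longrightarrow> g (f x) = x;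
    \<And>y. y \<in> carrier N \<Longrightarrow> f (g y) = y\<rbrakk> \<Longrightarrow> iso_modules R M N"
  unfolding iso_modules_def by blast

lemma iso_modules_trans:
  assumes "iso_modules R L M" "iso_modules R M N"
  shows "iso_modules R L N"
proof -
  obtain f g where f: "f \<in> Hom R L M" "g \<in> Hom R M L" "\<And>x. x \<in> carrier L \<Longrightarrow> g (f x) = x"
    "\<And>y. y \<in> carrier M \<Longrightarrow> f (g y) = y"
    by (rule iso_modulesE[OF assms(1)]) (rule that)
  obtain f' g' where f': "f' \<in> Hom R M N" "g' \<in> Hom R N M" "\<And>x. x \<in> carrier M \<Longrightarrow> g' (f' x) = x"
    "\<And>y. y \<in> carrier N \<Longrightarrow> f' (g' y) = y"
    by (rule iso_modulesE[OF assms(2)]) (rule that)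
  show ?thesis
    by (rule iso_modulesI[OF Hom_comp[OF f(1) f'(1)] Hom_comp[OF f'(2) f(2)]])
      (simp_all add: f f' HomD(1)[OF f(1)] HomD(1)[OF f'(2)])
qed

text \<open>Both modules are the quotient of \<open>P\<close> by the same submodule.\<close>

lemma iso_modules_epi:
  assumes P: "left_module R P" and M: "left_module R M" "left_module R N"
    and p: "p \<in> epi_hom R P M" and q: "q \<in> epi_hom R P N"
    and k: "\<And>x. x \<in> carrier P \<Longrightarrow> p x = \<zero>\<^bsub>M\<^esub> \<longleftrightarrow> q x = \<zero>\<^bsub>N\<^esub>"
  shows "iso_modules R M N"
proof -
  obtain f where f: "f \<in> Hom R M N" "\<And>x. x \<in> carrier P \<Longrightarrow> f (p x) = q x"
    by (rule Hom_factor[OF P M p epi_homD(1)[OF q]]) (simp add: k, rule that)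
  obtain g where g: "g \<in> Hom R N M" "\<And>x. x \<in> carrier P \<Longrightarrow> g (q x) = p x"
    by (rule Hom_factor[OF P M(2,1) q epi_homD(1)[OF p]]) (simp add: k, rule that)
  show ?thesis
  proof (rule iso_modulesI[OF f(1) g(1)])
    fix x assume "x \<in> carrier M"
    from epi_homD(2)[OF p this] obtain z where "z \<in> carrier P" "p z = x" by blast
    then show "g (f x) = x" using f(2) g(2) by auto
  next
    fix y assume "y \<in> carrier N"
    from epi_homD(2)[OF q this] obtain z where "z \<in> carrier P" "q z = y" by blast
    then show "f (g y) = y" using f(2) g(2) by auto
  qed
qed

text \<open>\<open>pd_le\<close> asks for a projective module in \<open>'a fgmod\<close>, so
  \<open>P\<close> is replaced by a copy. The kernel is then known only up to isomorphism, hence the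
  quantification over all \<open>A\<close>.\<close>

lemma pd_le_Suc:
  fixes P :: "('a, 'p) module" and H :: "'a fgmod"
  assumes P: "projective_module R P" and H: "left_module R H" and p: "p \<in> epi_hom R P H"
    and k: "\<And>A :: 'a fgmod. \<lbrakk>left_module R A; iso_modules R (Ker P H p) A\<rbrakk> \<Longrightarrow> pd_le R k A"
  shows "pd_le R (Suc k) H"
proof -
  obtain P' :: "'a fgmod" and f g where P': "fg_module R P'" "f \<in> Hom R P P'" "g \<in> Hom R P' P"
    "\<And>x. x \<in> carrier P \<Longrightarrow> g (f x) = x" "\<And>y. y \<in> carrier P' \<Longrightarrow> f (g y) = y"
    by (rule fg_copy[OF projectiveD(1)[OF P]]) (rule that)
  have "projective_module R P'" by (rule projective_retract[OF P P'(1,3,2,5)])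
  moreover have pg: "(\<lambda>x. p (g x)) \<in> epi_hom R P' H"
  proof (rule epi_homI[OF Hom_comp[OF P'(3) epi_homD(1)[OF p]]])
    fix y assume "y \<in> carrier H"
    from epi_homD(2)[OF p this] obtain x where "x \<in> carrier P" "p x = y" by blast
    then show "\<exists>x\<in>carrier P'. p (g x) = y" using HomD(1)[OF P'(2)] P'(4) by (intro bexI[of _ "f x"]) auto
  qed
  moreover have "pd_le R k (Ker P' H (\<lambda>x. p (g x)))"
  proof (rule k[OF left_module_Ker[OF fg_moduleD[OF P'(1)] H epi_homD(1)[OF pg]]], rule iso_modulesI)
    show "f \<in> Hom R (Ker P H p) (Ker P' H (\<lambda>x. p (g x)))"
      using P'(4) by (intro Hom_to_Ker Hom_from_Ker P'(2)) (auto simp: kernel_iff)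
    show "g \<in> Hom R (Ker P' H (\<lambda>x. p (g x))) (Ker P H p)"
      by (intro Hom_to_Ker Hom_from_Ker P'(3)) (auto simp: kernel_iff)
  qed (use P'(4,5) in \<open>auto simp: kernel_iff\<close>)
  ultimately show ?thesis by auto
qed

section \<open>Tilting modules generated by projective-injective modules\<close>

text \<open>Fixes the witnesses behind the properties of \<open>T\<close>: the presentation by
  \<open>P0\<close> stands for projective dimension at most one, \<open>ext0\<close> for Ext^1(T, T)
  = 0, and \<open>q0\<close> for generation by injective modules.\<close>

locale tilting_in_C = artin_alg K \<phi> R
  for K :: "'k ring" and \<phi> :: "'k \<Rightarrow> 'a" and R :: "'a ring" +
  fixes T :: "('a, 't) module" and P0 :: "'a fgmod" and p0 and T0 T1 :: "'a fgmod" and f0 g0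
    and Xs :: "'a fgmod list" and m q0
  assumes fgT: "fg_module R T"
    and P0: "projective_module R P0" "p0 \<in> epi_hom R P0 T" "projective_module R (Ker P0 T p0)"
    and ext0: "extends_from R P0 (a_kernel P0 T p0) T"
    and T01: "in_add R T T0" "in_add R T T1" "f0 \<in> mono_hom R (regular_module R) T0"
      "g0 \<in> epi_hom R T0 T1" "f0 ` carrier (regular_module R) = a_kernel T0 T1 g0"
    and Xs: "\<And>X. X \<in> set Xs \<Longrightarrow> injective_module R X" "q0 \<in> epi_hom R (module_power (direct_sum Xs) m) T"
begin

abbreviation "B \<equiv> End_op R T"

lemma LT: "left_module R T" by (rule fg_moduleD[OF fgT])

lemma generated_fg: "generated_by R T X \<Longrightarrow> fg_module R X"
  by (simp add: generated_by_def)

text \<open>Extension passes from \<open>T\<close> to its powers componentwise, and to their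
  quotients because \<open>N\<close> is projective. It serves twice: for Ext^1(T, Y) = 0, and for
  the vanishing of the top Ext.\<close>

lemma extends_to_generated:
  fixes Y :: "('a, 'y) module"
  assumes "generated_by R T Y" "extends_from R P N T" "projective_module R (P\<lparr>carrier := N\<rparr>)" "left_module R P"
  shows "extends_from R P N Y"
proof -
  obtain c and W :: "'a fgmod" and \<iota> \<pi> q where W: "is_power R T c W \<iota> \<pi>" "fg_module R W" "q \<in> epi_hom R W Y"
    by (rule right_approximation[OF fgT assms(1)]) (rule that)
  show ?thesis
    by (rule extends_from_epi[OF extends_from_power[OF assms(2) W(1) assms(4)] assms(3) W(2)
          generated_fg[OF assms(1)] W(3)])
qed

text \<open>This reads Ext^1(T, Y) = 0, since \<open>P0\<close> presents \<open>T\<close>.\<close>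

lemma extends_syzygy: "generated_by R T Y \<Longrightarrow> extends_from R P0 (a_kernel P0 T p0) Y"
  by (rule extends_to_generated[OF _ ext0 P0(3) projectiveD(2)[OF P0(1)]])

text \<open>Maps to injective modules always extend, and projectivity of \<open>N\<close> carries
  this to their quotient \<open>T\<close> and on to \<open>Y\<close>. Applied to the end of a
  projective resolution it gives the vanishing of the top Ext.\<close>

lemma extends_projective:
  assumes "generated_by R T Y" "projective_module R P" "submodule N R P" "projective_module R (P\<lparr>carrier := N\<rparr>)"
  shows "extends_from R P N Y"
proof -
  have NP: "N \<subseteq> carrier P" by (rule submoduleD(1)[OF assms(3)])
  have "extends_from R P N X" if "X \<in> set Xs" for X
    by (rule extends_from_injective[OF Xs(1)[OF that] projectiveD(1)[OF assms(2)] assms(3) projectiveD(1)[OF assms(4)]])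
  then have "extends_from R P N (direct_sum Xs)" by (rule extends_from_direct_sum[OF _ NP])
  then have Q: "extends_from R P N (module_power (direct_sum Xs) m)"
    by (intro extends_from_direct_sum[OF _ NP]) auto
  have "fg_module R (direct_sum Xs)"
    by (rule fg_direct_sum[OF is_ring]) (use Xs(1) in \<open>auto simp: injective_module_def\<close>)
  then have "fg_module R (module_power (direct_sum Xs) m)"
    by (intro fg_direct_sum[OF is_ring]) auto
  from extends_from_epi[OF Q assms(4) this fgT Xs(2)] show ?thesis
    by (rule extends_to_generated[OF assms(1) _ assms(4) projectiveD(2)[OF assms(2)]])
qed

text \<open>\<open>Ext\<^sup>1(T, ker q) = 0\<close> for a right approximation \<open>q\<close>, so its kernel is again generated by \<open>T\<close>.\<close>

lemma generated_kernel:
  fixes W :: "('a, 'w) module" and X :: "('a, 'm) module"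
  assumes W: "generated_by R T W" and X: "fg_module R X" and q: "q \<in> Hom R W X"
    and lift: "\<And>f. f \<in> Hom R T X \<Longrightarrow> \<exists>f'\<in>Hom R T W. \<forall>t\<in>carrier T. q (f' t) = f t"
  shows "generated_by R T (Ker W X q)"
proof (rule generated_by_of_extends[OF fgT _ P0(1,2) _ T01])
  note fgW = generated_fg[OF W]
  note LW = fg_moduleD[OF fgW] and LX = fg_moduleD[OF X] and LP = projectiveD(2)[OF P0(1)]
  note p01 = epi_homD(1)[OF P0(2)]
  interpret W: left_module R W by (rule LW)
  interpret X: left_module R X by (rule LX)
  show "fg_module R (Ker W X q)" by (rule fg_Ker[OF fgW LX q])
  show "extends_from R P0 (a_kernel P0 T p0) (Ker W X q)"
    unfolding extends_from_def
  proof
    fix h assume h: "h \<in> Hom R (Ker P0 T p0) (Ker W X q)"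
    have hW: "h \<in> Hom R (Ker P0 T p0) W" by (rule Hom_from_sub[OF h]) (auto simp: kernel_iff)
    obtain g where g: "g \<in> Hom R P0 W" "\<And>x. x \<in> a_kernel P0 T p0 \<Longrightarrow> g x = h x"
      by (rule extends_fromE[OF extends_syzygy[OF W] hW]) (rule that)
    have "q (g x) = \<zero>\<^bsub>X\<^esub>" if "x \<in> carrier P0" "p0 x = \<zero>\<^bsub>T\<^esub>" for x
      using g(2)[of x] HomD(1)[OF h, of x] that by (simp add: kernel_iff)
    \<comment> \<open>The extension \<open>g\<close> has values in \<open>W\<close> only. Its
      composition with \<open>q\<close> descends to a map \<open>k\<close> on \<open>T\<close>;
      subtracting a lift of \<open>k\<close> moves the values into the kernel and changes nothing on
      the kernel of \<open>p0\<close>.\<close>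
    then obtain k where k: "k \<in> Hom R T X" "\<And>x. x \<in> carrier P0 \<Longrightarrow> k (p0 x) = q (g x)"
      using Hom_factor[OF LP LT LX P0(2) Hom_comp[OF g(1) q]] by metis
    obtain k' where k': "k' \<in> Hom R T W" "\<forall>t\<in>carrier T. q (k' t) = k t" using lift[OF k(1)] by blast
    let ?G = "\<lambda>x. g x \<ominus>\<^bsub>W\<^esub> k' (p0 x)"
    have kp: "(\<lambda>x. k' (p0 x)) \<in> Hom R P0 W" by (rule Hom_comp[OF p01 k'(1)])
    have "?G \<in> Hom R P0 (Ker W X q)"
    proof (rule Hom_to_Ker[OF Hom_diff[OF LW g(1) kp]])
      fix x assume x: "x \<in> carrier P0"
      have "q (?G x) = q (g x) \<ominus>\<^bsub>X\<^esub> q (k' (p0 x))"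
        by (rule Hom_minus[OF q LW LX HomD(1)[OF g(1) x] HomD(1)[OF kp x]])
      also have "q (k' (p0 x)) = q (g x)" using k'(2) k(2)[OF x] HomD(1)[OF p01 x] by simp
      finally show "q (?G x) = \<zero>\<^bsub>X\<^esub>" using X.M.minus_self[OF HomD(1)[OF q HomD(1)[OF g(1) x]]] by simp
    qed
    moreover have "?G x = h x" if x: "x \<in> a_kernel P0 T p0" for x
    proof -
      have "k' (p0 x) = \<zero>\<^bsub>W\<^esub>" using x Hom_zero[OF k'(1) LT LW] by (simp add: kernel_iff)
      then show ?thesis using g(2)[OF x] W.M.minus_zero_right[of "h x"] HomD(1)[OF hW, of x] x by simp
    qed
    ultimately show "\<exists>g\<in>Hom R P0 (Ker W X q). \<forall>x\<in>a_kernel P0 T p0. g x = h x" by (intro bexI[of _ ?G]) auto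
  qed
qed

text \<open>Ext^1(T, ker q) = 0 makes Hom(T, W) -> Hom(T, X) surjective. Concretely, a lift
  \<open>u\<close> of \<open>f p0\<close> is corrected by extending its restriction to the kernel of
  \<open>p0\<close>; the difference descends to \<open>T\<close>.\<close>

lemma lift_to_quotient:
  fixes W :: "('a, 'w) module" and X :: "('a, 'm) module"
  assumes W: "fg_module R W" and X: "fg_module R X" and q: "q \<in> epi_hom R W X"
    and ker: "generated_by R T (Ker W X q)" and f: "f \<in> Hom R T X"
  shows "\<exists>f'\<in>Hom R T W. \<forall>t\<in>carrier T. q (f' t) = f t"
proof -
  note LW = fg_moduleD[OF W] and LX = fg_moduleD[OF X] and LP = projectiveD(2)[OF P0(1)]
  note p01 = epi_homD(1)[OF P0(2)] and q1 = epi_homD(1)[OF q]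
  interpret W: left_module R W by (rule LW)
  interpret X: left_module R X by (rule LX)
  obtain u where u: "u \<in> Hom R P0 W" "\<And>x. x \<in> carrier P0 \<Longrightarrow> q (u x) = f (p0 x)"
    by (rule projective_lift[OF P0(1) W X q Hom_comp[OF p01 f]]) (rule that)
  have "u \<in> Hom R (Ker P0 T p0) (Ker W X q)"
    using u(2) Hom_zero[OF f LT LX] by (intro Hom_to_Ker Hom_from_Ker u(1)) (simp add: kernel_iff)
  from extends_fromE[OF extends_syzygy[OF ker] this] obtain g where
    g: "g \<in> Hom R P0 (Ker W X q)" "\<And>x. x \<in> a_kernel P0 T p0 \<Longrightarrow> g x = u x" by metis
  have gW: "g \<in> Hom R P0 W" by (rule Hom_from_sub[OF g(1)]) (auto simp: kernel_iff)
  have z: "u x \<ominus>\<^bsub>W\<^esub> g x = \<zero>\<^bsub>W\<^esub>" if "x \<in> carrier P0" "p0 x = \<zero>\<^bsub>T\<^esub>" for x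
    using g(2)[of x] that HomD(1)[OF u(1), of x] by (simp add: kernel_iff W.M.minus_self)
  obtain f' where f': "f' \<in> Hom R T W" "\<And>x. x \<in> carrier P0 \<Longrightarrow> f' (p0 x) = u x \<ominus>\<^bsub>W\<^esub> g x"
    by (rule Hom_factor[OF LP LT LW P0(2) Hom_diff[OF LW u(1) gW]]) (rule z, assumption+, rule that)
  have "q (f' t) = f t" if t: "t \<in> carrier T" for t
  proof -
    from epi_homD(2)[OF P0(2) t] obtain x where x: "x \<in> carrier P0" "p0 x = t" by blast
    have "q (f' t) = q (u x) \<ominus>\<^bsub>X\<^esub> q (g x)"
      using f'(2)[OF x(1)] x Hom_minus[OF q1 LW LX HomD(1)[OF u(1) x(1)] HomD(1)[OF gW x(1)]] by simp
    also have "q (g x) = \<zero>\<^bsub>X\<^esub>" using HomD(1)[OF g(1) x(1)] by (simp add: kernel_iff)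
    finally show ?thesis using u(2)[OF x(1)] x HomD(1)[OF f t] by (simp add: X.M.minus_zero_right)
  qed
  with f'(1) show ?thesis by blast
qed

text \<open>Copies of the presentation of \<open>T\<close> by \<open>P0\<close> are added up. The
  result supplies the projective syzygy of \<open>W\<close> and the vanishing of Ext^1(W, Y) that
  the dimension shift asks for.\<close>

lemma power_presentation:
  fixes W :: "'a fgmod"
  assumes W: "is_power R T c W \<iota> \<pi>"
  obtains P :: "'a fgmod" and r where "projective_module R P" "r \<in> epi_hom R P W" "projective_module R (Ker P W r)"
    "\<And>Y :: 'a fgmod. generated_by R T Y \<Longrightarrow> extends_from R P (a_kernel P W r) Y"
proof -
  note W' = is_powerD[OF W] and LP0 = projectiveD(2)[OF P0(1)]
  note p01 = epi_homD(1)[OF P0(2)]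
  interpret W: left_module R W by (rule W'(2))
  interpret T: left_module R T by (rule LT)
  obtain P :: "'a fgmod" and \<iota>' \<pi>' where P: "is_power R P0 c P \<iota>' \<pi>'" "fg_module R P"
    by (rule power_exists[OF projectiveD(1)[OF P0(1)]]) (rule that)
  note P' = is_powerD[OF P(1)]
  interpret P: left_module R P by (rule P'(2))
  have projP: "projective_module R P" by (rule projective_power[OF P(1) P0(1)])
  have f: "(\<lambda>x. \<iota> j (p0 x)) \<in> Hom R P0 W" if "j < c" for j by (rule Hom_comp[OF p01 W'(3)[OF that]])
  define r where "r x = (\<Oplus>\<^bsub>W\<^esub>j\<in>{..<c}. \<iota> j (p0 (\<pi>' j x)))" for x
  have r: "r \<in> Hom R P W" unfolding r_def by (rule power_hom(1)[OF P(1) W'(2) f])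
  have r\<iota>: "r (\<iota>' k x) = \<iota> k (p0 x)" if "k < c" "x \<in> carrier P0" for k x
    unfolding r_def by (rule power_hom(2)[OF P(1) W'(2) f that])
  have \<pi>r: "\<pi> k (r x) = p0 (\<pi>' k x)" if k: "k < c" and x: "x \<in> carrier P" for k x
  proof -
    have c: "p0 (\<pi>' j x) \<in> carrier T" if "j < c" for j using HomD(1)[OF p01 HomD(1)[OF P'(4)[OF that] x]] .
    have "\<pi> k (r x) = (\<Oplus>\<^bsub>T\<^esub>j\<in>{..<c}. \<pi> k (\<iota> j (p0 (\<pi>' j x))))"
      unfolding r_def using c HomD(1)[OF W'(3)] by (intro left_module_hom_finsum[OF W'(2) LT W'(4)[OF k]]) auto
    also have "\<dots> = (\<Oplus>\<^bsub>T\<^esub>j\<in>{..<c}. if k = j then p0 (\<pi>' j x) else \<zero>\<^bsub>T\<^esub>)"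
      using c k by (intro T.M.finsum_cong') (auto simp: W'(5))
    also have "\<dots> = p0 (\<pi>' k x)" using c k by (intro T.M.finsum_singleton) auto
    finally show ?thesis .
  qed
  have epi: "r \<in> epi_hom R P W"
  proof (rule epi_homI[OF r])
    fix w assume w: "w \<in> carrier W"
    have "\<exists>x. x \<in> carrier P0 \<and> p0 x = \<pi> j w" if "j < c" for j
      using epi_homD(2)[OF P0(2) HomD(1)[OF W'(4)[OF that] w]] by blast
    then obtain x where x: "\<And>j. j < c \<Longrightarrow> x j \<in> carrier P0 \<and> p0 (x j) = \<pi> j w" by metis
    have c: "\<iota>' j (x j) \<in> carrier P" if "j < c" for j using HomD(1)[OF P'(3)[OF that]] x[OF that] by blast
    let ?x = "\<Oplus>\<^bsub>P\<^esub>j\<in>{..<c}. \<iota>' j (x j)"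
    have "r ?x = (\<Oplus>\<^bsub>W\<^esub>j\<in>{..<c}. r (\<iota>' j (x j)))"
      using c by (intro left_module_hom_finsum[OF P'(2) W'(2) r]) auto
    also have "\<dots> = (\<Oplus>\<^bsub>W\<^esub>j\<in>{..<c}. \<iota> j (\<pi> j w))"
      using x HomD(1)[OF W'(3)] HomD(1)[OF W'(4)] w by (intro W.M.finsum_cong') (auto simp: r\<iota>)
    also have "\<dots> = w" by (rule W'(6)[OF w])
    finally have "r ?x = w" .
    moreover have "?x \<in> carrier P" using c by (intro P.M.finsum_closed) auto
    ultimately show "\<exists>x\<in>carrier P. r x = w" by blast
  qed
  let ?N0 = "Ker P0 T p0" and ?N = "Ker P W r"
  have LN: "left_module R (Ker P0 T p0)" "left_module R (Ker P W r)"
    using left_module_Ker[OF LP0 LT p01] left_module_Ker[OF P'(2) W'(2) r] by auto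
  have \<iota>K: "\<iota>' j \<in> Hom R (Ker P0 T p0) (Ker P W r)" if j: "j < c" for j
  proof (rule Hom_to_Ker[OF Hom_from_Ker[OF P'(3)[OF j]]])
    fix z assume "z \<in> carrier (Ker P0 T p0)"
    then show "r (\<iota>' j z) = \<zero>\<^bsub>W\<^esub>" using r\<iota>[OF j, of z] Hom_zero[OF W'(3)[OF j] LT W'(2)] by (simp add: kernel_iff)
  qed
  have \<pi>K: "\<pi>' j \<in> Hom R (Ker P W r) (Ker P0 T p0)" if j: "j < c" for j
  proof (rule Hom_to_Ker[OF Hom_from_Ker[OF P'(4)[OF j]]])
    fix z assume "z \<in> carrier (Ker P W r)"
    then show "p0 (\<pi>' j z) = \<zero>\<^bsub>T\<^esub>" using \<pi>r[OF j, of z] Hom_zero[OF W'(4)[OF j] W'(2) LT] by (simp add: kernel_iff)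
  qed
  \<comment> \<open>The kernel of \<open>r\<close> is the corresponding power of the kernel of
    \<open>p0\<close>, with the same injections and projections; this gives its projectivity and the
    extension of maps from it.\<close>
  have K: "is_power R (Ker P0 T p0) c (Ker P W r) \<iota>' \<pi>'"
    unfolding is_power_def
  proof (intro conjI allI impI ballI LN \<iota>K \<pi>K)
    fix j k x assume "j < c" "k < c" "x \<in> carrier (Ker P0 T p0)"
    then show "\<pi>' j (\<iota>' k x) = (if j = k then x else \<zero>\<^bsub>Ker P0 T p0\<^esub>)" using P'(5) by (simp add: kernel_iff)
  next
    fix w assume w: "w \<in> carrier (Ker P W r)"
    have c: "\<iota>' j (\<pi>' j w) \<in> carrier (Ker P W r)" if "j < c" for j
      using HomD(1)[OF \<iota>K[OF that] HomD(1)[OF \<pi>K[OF that] w]] .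
    have "(\<Oplus>\<^bsub>Ker P W r\<^esub>j\<in>{..<c}. \<iota>' j (\<pi>' j w)) = (\<Oplus>\<^bsub>P\<^esub>j\<in>{..<c}. \<iota>' j (\<pi>' j w))"
      using c by (intro left_module_hom_finsum[OF LN(2) P'(2) Ker_id]) auto
    also have "\<dots> = w" using w by (intro P'(6)) (simp add: kernel_iff)
    finally show "(\<Oplus>\<^bsub>Ker P W r\<^esub>j\<in>{..<c}. \<iota>' j (\<pi>' j w)) = w" .
  qed
  have "extends_from R P (a_kernel P W r) Y" if Y: "generated_by R T Y" for Y :: "'a fgmod"
    unfolding extends_from_def
  proof
    note LY = fg_moduleD[OF generated_fg[OF Y]]
    interpret Y: left_module R Y by (rule LY)
    fix h assume h: "h \<in> Hom R (Ker P W r) Y"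
    have "\<exists>g. g \<in> Hom R P0 Y \<and> (\<forall>x\<in>a_kernel P0 T p0. g x = h (\<iota>' j x))" if "j < c" for j
      using extends_fromE[OF extends_syzygy[OF Y] Hom_comp[OF \<iota>K[OF that] h]] by metis
    then obtain g where g: "\<And>j. j < c \<Longrightarrow> g j \<in> Hom R P0 Y \<and> (\<forall>x\<in>a_kernel P0 T p0. g j x = h (\<iota>' j x))" by metis
    have g1: "g j \<in> Hom R P0 Y" if "j < c" for j using g[OF that] by blast
    have "(\<Oplus>\<^bsub>Y\<^esub>j\<in>{..<c}. g j (\<pi>' j x)) = h x" if x: "x \<in> a_kernel P W r" for x
    proof -
      have xK: "x \<in> carrier (Ker P W r)" using x by simp
      have c: "\<pi>' j x \<in> a_kernel P0 T p0" if "j < c" for j using HomD(1)[OF \<pi>K[OF that] xK] by simp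
      have "(\<Oplus>\<^bsub>Y\<^esub>j\<in>{..<c}. g j (\<pi>' j x)) = (\<Oplus>\<^bsub>Y\<^esub>j\<in>{..<c}. h (\<iota>' j (\<pi>' j x)))"
        using c g HomD(1)[OF h HomD(1)[OF \<iota>K HomD(1)[OF \<pi>K xK]]] by (intro Y.M.finsum_cong') auto
      also have "\<dots> = h x" by (rule power_hom_eq[OF K LY h xK, symmetric])
      finally show ?thesis .
    qed
    then show "\<exists>g\<in>Hom R P Y. \<forall>x\<in>a_kernel P W r. g x = h x"
      by (intro bexI[OF _ power_hom(1)[OF P(1) LY g1]]) auto
  qed
  with that[OF projP epi projective_power[OF K P0(3)]] show thesis by blast
qed

section \<open>Projective dimension over the opposite endomorphism algebra\<close>

sublocale B: artin_alg K "End_scalar T" B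
  by unfold_locales (rule artin_algebra_End_op[OF fgT])

lemma projective_Hom_module:
  assumes "is_power R T c W \<iota> \<pi>"
  shows "projective_module B (Hom_module R T W)"
  by (rule projective_power[OF is_power_Hom_module[OF assms] projective_regular[OF B.is_ring]])

lemma Hom_module_map_epi:
  assumes q: "q \<in> Hom R W X" and lift: "\<And>f. f \<in> Hom R T X \<Longrightarrow> \<exists>f'\<in>Hom R T W. \<forall>t\<in>carrier T. q (f' t) = f t"
  shows "compose (carrier T) q \<in> epi_hom B (Hom_module R T W) (Hom_module R T X)"
proof (rule epi_homI[OF Hom_module_map[OF LT q]])
  fix f assume f: "f \<in> carrier (Hom_module R T X)"
  then obtain f' where f': "f' \<in> Hom R T W" "\<forall>t\<in>carrier T. q (f' t) = f t" using lift[of f] by auto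
  show "\<exists>w\<in>carrier (Hom_module R T W). compose (carrier T) q w = f"
  proof (rule bexI)
    show "restrict f' (carrier T) \<in> carrier (Hom_module R T W)" using restrict_mem[OF LT f'(1)] by simp
    show "compose (carrier T) q (restrict f' (carrier T)) = f"
      using f f'(2) by (intro Hom_module_eqI[of _ T]) (auto simp: compose_def)
  qed
qed

lemma Hom_module_map_zero:
  assumes "w \<in> carrier (Hom_module R T W)"
  shows "compose (carrier T) q w = \<zero>\<^bsub>Hom_module R T X\<^esub> \<longleftrightarrow> (\<forall>t\<in>carrier T. q (w t) = \<zero>\<^bsub>X\<^esub>)"
  by (auto simp: compose_def fun_eq_iff restrict_def)

text \<open>\<open>Hom(T, _)\<close> maps a resolution of \<open>X\<close> by right approximations to a projective resolution, which
  stops when an approximation splits.\<close>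

lemma pd_le_Hom_module:
  fixes X :: "'a fgmod" and H :: "('t \<Rightarrow> 't) fgmod"
  assumes "generated_by R T X" "\<And>Y :: 'a fgmod. generated_by R T Y \<Longrightarrow> Ext_zero R Y k X"
    and "iso_modules B (Hom_module R T X) H" "left_module B H"
  shows "pd_le B k H"
  using assms
proof (induction k arbitrary: X H)
  case (0 X H)
  note fgX = generated_fg[OF 0(1)]
  note LX = fg_moduleD[OF fgX]
  obtain c and W :: "'a fgmod" and \<iota> \<pi> q where W: "is_power R T c W \<iota> \<pi>" "fg_module R W" "q \<in> epi_hom R W X"
    and lift: "\<And>f. f \<in> Hom R T X \<Longrightarrow> \<exists>f'\<in>Hom R T W. \<forall>t\<in>carrier T. q (f' t) = f t"
    by (rule right_approximation[OF fgT 0(1)]) (rule that)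
  note LW = fg_moduleD[OF W(2)] and q1 = epi_homD(1)[OF W(3)]
  have gK: "generated_by R T (Ker W X q)"
    by (rule generated_kernel[OF generated_by_power[OF W(1) fgT] fgX q1 lift])
  note LK = fg_moduleD[OF generated_fg[OF gK]]
  obtain P :: "'a fgmod" and p where P: "projective_module R P" "p \<in> epi_hom R P X"
    "extends_from R P (a_kernel P X p) (Ker W X q)" using 0(2)[OF gK] by auto
  \<comment> \<open>The kernel of \<open>q\<close> is itself generated by \<open>T\<close>, so
    Ext^1(X, ker q) = 0. Extending the identity of the kernel to \<open>W\<close> splits
    \<open>q\<close>, and Hom(T, X) becomes a retract of the free module Hom(T, W).\<close>
  have "extends_from R W (a_kernel W X q) (Ker W X q)"
    by (rule extends_from_kernel[OF fgX W(2) LK W(3) P])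
  from extends_fromE[OF this Hom_id] obtain e where e: "e \<in> Hom R W (Ker W X q)"
    "\<And>x. x \<in> a_kernel W X q \<Longrightarrow> e x = x" by metis
  have eW: "e \<in> Hom R W W" by (rule Hom_from_sub[OF e(1)]) (auto simp: kernel_iff)
  have qe: "q (e x) = \<zero>\<^bsub>X\<^esub>" if "x \<in> carrier W" for x
    using HomD(1)[OF e(1) that] by (simp add: kernel_iff)
  have e': "e x = x" if "x \<in> carrier W" "q x = \<zero>\<^bsub>X\<^esub>" for x
    using e(2)[of x] that by (simp add: kernel_iff)
  obtain s where s: "s \<in> Hom R X W" "\<And>y. y \<in> carrier X \<Longrightarrow> q (s y) = y"
    by (rule split_epi[OF LX LW W(3) eW qe e']) (assumption | rule that)+
  obtain f g where fg: "f \<in> Hom B (Hom_module R T X) H" "g \<in> Hom B H (Hom_module R T X)"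
    "\<And>y. y \<in> carrier H \<Longrightarrow> f (g y) = y"
    by (rule iso_modulesE[OF 0(3)]) (rule that)
  have "(\<lambda>y. compose (carrier T) s (g y)) \<in> Hom B H (Hom_module R T W)"
    by (rule Hom_comp[OF fg(2) Hom_module_map[OF LT s(1)]])
  moreover have "(\<lambda>w. f (compose (carrier T) q w)) \<in> Hom B (Hom_module R T W) H"
    by (rule Hom_comp[OF Hom_module_map[OF LT q1] fg(1)])
  moreover have "f (compose (carrier T) q (compose (carrier T) s (g y))) = y" if y: "y \<in> carrier H" for y
  proof -
    have gy: "g y \<in> carrier (Hom_module R T X)" by (rule HomD(1)[OF fg(2) y])
    have "compose (carrier T) q (compose (carrier T) s (g y)) = g y"
      using gy s(2) by (intro Hom_module_eqI[of _ T]) (auto simp: compose_def HomD(1))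
    then show ?thesis using fg(3)[OF y] by simp
  qed
  moreover have "fg_module B H"
    using fg_epi[OF Hom_module_fg[OF fgT fgX] 0(4) epi_homI[OF fg(1)]] fg(3) HomD(1)[OF fg(2)] by blast
  ultimately have "projective_module B H"
    by (intro projective_retract[OF projective_Hom_module[OF W(1)]])
  then show ?case by simp
next
  case (Suc k X H)
  note fgX = generated_fg[OF Suc(2)]
  note LX = fg_moduleD[OF fgX]
  obtain c and W :: "'a fgmod" and \<iota> \<pi> q where W: "is_power R T c W \<iota> \<pi>" "fg_module R W" "q \<in> epi_hom R W X"
    and lift: "\<And>f. f \<in> Hom R T X \<Longrightarrow> \<exists>f'\<in>Hom R T W. \<forall>t\<in>carrier T. q (f' t) = f t"
    by (rule right_approximation[OF fgT Suc(2)]) (rule that)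
  note LW = fg_moduleD[OF W(2)] and q1 = epi_homD(1)[OF W(3)]
  have gK: "generated_by R T (Ker W X q)"
    by (rule generated_kernel[OF generated_by_power[OF W(1) fgT] fgX q1 lift])
  note LK = fg_moduleD[OF generated_fg[OF gK]]
  obtain P :: "'a fgmod" and r where P: "projective_module R P" "r \<in> epi_hom R P W" "projective_module R (Ker P W r)"
    and extP: "\<And>Y :: 'a fgmod. generated_by R T Y \<Longrightarrow> extends_from R P (a_kernel P W r) Y"
    by (rule power_presentation[OF W(1)]) (rule that)
  \<comment> \<open>One degree of Ext is traded for one step of the resolution by
    approximations.\<close>
  have ext: "Ext_zero R Y k (Ker W X q)" if Y: "generated_by R T Y" for Y :: "'a fgmod"
    by (rule Ext_zero_shift[OF fg_moduleD[OF generated_fg[OF Y]] Suc(3)[OF Y] fgX W(2,3) P extP[OF Y]])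
  obtain f g where fg: "f \<in> Hom B (Hom_module R T X) H" "g \<in> Hom B H (Hom_module R T X)"
    "\<And>x. x \<in> carrier (Hom_module R T X) \<Longrightarrow> g (f x) = x" "\<And>y. y \<in> carrier H \<Longrightarrow> f (g y) = y"
    by (rule iso_modulesE[OF Suc(4)]) (rule that)
  note LF = left_module_Hom_module[OF LT]
  let ?p = "\<lambda>w. f (compose (carrier T) q w)"
  have "f \<in> epi_hom B (Hom_module R T X) H"
    using fg(4) HomD(1)[OF fg(2)] by (intro epi_homI[OF fg(1)]) blast
  from Hom_module_map_epi[OF q1 lift] this
  have p: "?p \<in> epi_hom B (Hom_module R T W) H" by (rule epi_comp)
  \<comment> \<open>Left exactness of Hom(T, _), as an equality of carriers.\<close>
  have kp: "a_kernel (Hom_module R T W) H ?p = carrier (Hom_module R T (Ker W X q))"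
  proof -
    have "w \<in> a_kernel (Hom_module R T W) H ?p \<longleftrightarrow> w \<in> carrier (Hom_module R T W) \<and> (\<forall>t\<in>carrier T. q (w t) = \<zero>\<^bsub>X\<^esub>)" for w
    proof -
      have "f (compose (carrier T) q w) = \<zero>\<^bsub>H\<^esub> \<longleftrightarrow> compose (carrier T) q w = \<zero>\<^bsub>Hom_module R T X\<^esub>"
        if w: "w \<in> carrier (Hom_module R T W)"
      proof -
        have c: "compose (carrier T) q w \<in> carrier (Hom_module R T X)" by (rule HomD(1)[OF Hom_module_map[OF LT q1] w])
        have "f \<zero>\<^bsub>Hom_module R T X\<^esub> = \<zero>\<^bsub>H\<^esub>" by (rule Hom_zero[OF fg(1) LF[OF LX] Suc(5)])
        moreover have "g \<zero>\<^bsub>H\<^esub> = \<zero>\<^bsub>Hom_module R T X\<^esub>" by (rule Hom_zero[OF fg(2) Suc(5) LF[OF LX]])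
        ultimately show ?thesis using fg(3)[OF c] by metis
      qed
      then show ?thesis using Hom_module_map_zero[of w W q X] unfolding kernel_iff by blast
    qed
    moreover have "w \<in> carrier (Hom_module R T (Ker W X q)) \<longleftrightarrow>
        w \<in> carrier (Hom_module R T W) \<and> (\<forall>t\<in>carrier T. q (w t) = \<zero>\<^bsub>X\<^esub>)" for w
    proof
      assume w: "w \<in> carrier (Hom_module R T (Ker W X q))"
      then have "w \<in> Hom R T W" by (intro Hom_from_sub[where S = "a_kernel W X q" and N = W]) (auto simp: kernel_iff)
      then show "w \<in> carrier (Hom_module R T W) \<and> (\<forall>t\<in>carrier T. q (w t) = \<zero>\<^bsub>X\<^esub>)"
        using w HomD(1)[of w R T "Ker W X q"] by (auto simp: kernel_iff)
    next
      assume "w \<in> carrier (Hom_module R T W) \<and> (\<forall>t\<in>carrier T. q (w t) = \<zero>\<^bsub>X\<^esub>)"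
      then show "w \<in> carrier (Hom_module R T (Ker W X q))" by (auto intro: Hom_to_Ker)
    qed
    ultimately show ?thesis by blast
  qed
  have iso: "iso_modules B (Hom_module R T (Ker W X q)) (Ker (Hom_module R T W) H ?p)"
    unfolding kp by (rule iso_modulesI[of "\<lambda>x. x" _ _ _ "\<lambda>x. x"]; (rule HomI)?) auto
  show ?case
  proof (rule pd_le_Suc[OF projective_Hom_module[OF W(1)] Suc(5) p])
    fix A :: "('t \<Rightarrow> 't) fgmod"
    assume A: "left_module B A" "iso_modules B (Ker (Hom_module R T W) H ?p) A"
    show "pd_le B k A"
      by (rule Suc(1)[OF gK ext iso_modules_trans[OF iso A(2)] A(1)])
  qed
qed

text \<open>Free modules are taken in the form Hom(T, W), because by \<open>Hom_module_full\<close>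
  the maps between them come from maps of \<open>R\<close>-modules.\<close>

lemma free_cover:
  fixes M :: "('t \<Rightarrow> 't, 'm) module"
  assumes "fg_module B M"
  obtains c and W :: "'a fgmod" and \<iota> \<pi> p where "is_power R T c W \<iota> \<pi>" "fg_module R W"
    "p \<in> epi_hom B (Hom_module R T W) M"
proof -
  obtain c where c: "\<And>(P :: ('t \<Rightarrow> 't, 't \<Rightarrow> 'a list set) module) \<iota> \<pi>.
      is_power B (regular_module B) c P \<iota> \<pi> \<Longrightarrow> \<exists>p. p \<in> epi_hom B P M"
    by (rule power_regular_epi[OF assms]) (rule that)
  obtain W :: "'a fgmod" and \<iota> \<pi> where W: "is_power R T c W \<iota> \<pi>" "fg_module R W"
    by (rule power_exists[OF fgT]) (rule that)
  from c[OF is_power_Hom_module[OF W(1)]] obtain p where "p \<in> epi_hom B (Hom_module R T W) M" by blast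
  with W show thesis by (rule that)
qed

text \<open>All terms after \<open>P 0\<close> vanish, so the augmentation has zero kernel; the zero
  map is then the projection onto the kernel that \<open>split_epi\<close> asks for.\<close>

lemma projective_of_projdim_zero:
  fixes X :: "'a fgmod"
  assumes X: "fg_module R X" and "projdim R X \<le> enat 0"
  shows "projective_module R X"
proof -
  obtain P \<epsilon> d where res: "projective_resolution R X P \<epsilon> d" and z: "\<And>i. i > 0 \<Longrightarrow> is_zero_module (P i)"
    by (rule projdim_leE[OF assms(2)]) (rule that)
  have P: "projective_module R (P i)" and \<epsilon>: "\<epsilon> \<in> epi_hom R (P 0) X" and d: "d 0 \<in> Hom R (P (Suc 0)) (P 0)"
    and k: "d 0 ` carrier (P 1) = a_kernel (P 0) X \<epsilon>" for i
    using res by (auto simp: projective_resolution_def)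
  note LP = projectiveD(2)[OF P] and LX = fg_moduleD[OF X]
  interpret P0: left_module R "P 0" by (rule LP)
  have kz: "a_kernel (P 0) X \<epsilon> = {\<zero>\<^bsub>P 0\<^esub>}"
    using k z[of 1] Hom_zero[OF d LP LP] by (simp add: is_zero_module_def)
  obtain s where s: "s \<in> Hom R X (P 0)" "\<And>y. y \<in> carrier X \<Longrightarrow> \<epsilon> (s y) = y"
  proof (rule split_epi[OF LX LP \<epsilon> Hom_const_zero[OF LP]])
    show "\<epsilon> \<zero>\<^bsub>P 0\<^esub> = \<zero>\<^bsub>X\<^esub>" by (rule Hom_zero[OF epi_homD(1)[OF \<epsilon>] LP LX])
    show "\<zero>\<^bsub>P 0\<^esub> = x" if "x \<in> carrier (P 0)" "\<epsilon> x = \<zero>\<^bsub>X\<^esub>" for x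
      using that kz by (auto simp: a_kernel_def')
  qed (rule that)
  show ?thesis by (rule projective_retract[OF P X s(1) epi_homD(1)[OF \<epsilon>] s(2)])
qed

text \<open>Two free covers present \<open>M\<close> by a map that comes from some \<open>g\<close>
  between powers of \<open>T\<close>, so the syzygy \<open>?N\<close> can be described over
  \<open>R\<close>. The argument bounds \<open>?N\<close> by one less than \<open>n\<close>, which
  makes sense for positive \<open>n\<close> only; hence the case distinction.\<close>

lemma pd_le_End_op:
  fixes M :: "('t \<Rightarrow> 't) fgmod"
  assumes n: "\<And>X :: 'a fgmod. fg_module R X \<Longrightarrow> projdim R X \<le> enat n" and M: "fg_module B M"
  shows "pd_le B n M"
proof -
  note LF = left_module_Hom_module[OF LT] and LM = fg_moduleD[OF M]
  obtain b and W :: "'a fgmod" and \<iota> \<pi> p where W: "is_power R T b W \<iota> \<pi>" "fg_module R W"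
    and p: "p \<in> epi_hom B (Hom_module R T W) M"
    by (rule free_cover[OF M]) (rule that)
  note LW = fg_moduleD[OF W(2)] and p1 = epi_homD(1)[OF p]
  interpret W: left_module R W by (rule LW)
  let ?N = "Ker (Hom_module R T W) M p"
  have fgN: "fg_module B ?N" by (rule B.fg_Ker[OF Hom_module_fg[OF fgT W(2)] LM p1])
  note LN = fg_moduleD[OF fgN]
  obtain a and V :: "'a fgmod" and \<iota>' \<pi>' r where V: "is_power R T a V \<iota>' \<pi>'" "fg_module R V"
    and r: "r \<in> epi_hom B (Hom_module R T V) ?N"
    by (rule free_cover[OF fgN]) (rule that)
  note LV = fg_moduleD[OF V(2)] and r1 = epi_homD(1)[OF r]
  have rW: "r \<in> Hom B (Hom_module R T V) (Hom_module R T W)"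
    by (rule Hom_from_sub[OF r1]) (auto simp: kernel_iff)
  obtain g where g: "g \<in> Hom R V W" "\<And>v. v \<in> carrier (Hom_module R T V) \<Longrightarrow> r v = compose (carrier T) g v"
    by (rule Hom_module_full[OF V(1) LW rW]) (rule that)
  show ?thesis
  proof (cases n)
    case 0
    \<comment> \<open>All finitely generated modules are projective here, so the image of
      \<open>g\<close> is a direct summand of \<open>W\<close> and \<open>V\<close> has a section
      over it.\<close>
    have proj: "projective_module R X" if "fg_module R X" for X :: "'a fgmod"
      using projective_of_projdim_zero[OF that] n[OF that] 0 by simp
    let ?I = "g ` carrier V"
    have I: "submodule ?I R W" by (rule submodule_image[OF LV LW g(1) submodule_carrier[OF LV]])
    have IW: "?I \<subseteq> carrier W" by (rule submoduleD(1)[OF I])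
    obtain X :: "'a fgmod" and q where X: "fg_module R X" "q \<in> epi_hom R W X" "a_kernel W X q = ?I"
      by (rule quotient_fgmod[OF W(2) I])
    note LX = fg_moduleD[OF X(1)] and q1 = epi_homD(1)[OF X(2)]
    interpret X: left_module R X by (rule LX)
    obtain s where s: "s \<in> Hom R X W" "\<And>x. x \<in> carrier X \<Longrightarrow> q (s x) = x"
      by (rule projective_section[OF proj[OF X(1)] W(2) X(2)]) (rule that)
    have gI: "g \<in> epi_hom R V (W\<lparr>carrier := ?I\<rparr>)"
      by (rule epi_homI[OF Hom_into_sub[OF g(1)]]) auto
    obtain \<sigma> where \<sigma>: "\<sigma> \<in> Hom R (W\<lparr>carrier := ?I\<rparr>) V" "\<And>x. x \<in> carrier (W\<lparr>carrier := ?I\<rparr>) \<Longrightarrow> g (\<sigma> x) = x"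
      by (rule projective_section[OF proj[OF fg_submodule[OF W(2) I]] V(2) gI]) (rule that)
    \<comment> \<open>The projection of \<open>W\<close> onto the image of \<open>g\<close>, with
      kernel the image of \<open>s\<close>. Composition with it is a projection of Hom(T, W) onto
      the kernel of \<open>p\<close>, so \<open>p\<close> splits.\<close>
    define \<rho> where "\<rho> w = w \<ominus>\<^bsub>W\<^esub> s (q w)" for w
    have \<rho>: "\<rho> \<in> Hom R W W" unfolding \<rho>_def by (intro Hom_diff[OF LW] Hom_id Hom_comp[OF q1 s(1)])
    have \<rho>I: "\<rho> w \<in> ?I" if w: "w \<in> carrier W" for w
    proof -
      have qw: "q w \<in> carrier X" "s (q w) \<in> carrier W" using HomD(1)[OF q1 w] HomD(1)[OF s(1)] by auto
      have "q (\<rho> w) = \<zero>\<^bsub>X\<^esub>"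
        using qw s(2) by (simp add: \<rho>_def Hom_minus[OF q1 LW LX w] X.M.minus_self)
      then show ?thesis using HomD(1)[OF \<rho> w] unfolding X(3)[symmetric] kernel_iff by blast
    qed
    have \<rho>id: "\<rho> w = w" if w: "w \<in> ?I" for w
    proof -
      have "q w = \<zero>\<^bsub>X\<^esub>" using w unfolding X(3)[symmetric] kernel_iff by blast
      then show ?thesis using Hom_zero[OF s(1) LX LW] w IW by (auto simp: \<rho>_def W.M.minus_zero_right)
    qed
    have \<rho>H: "\<rho> \<in> Hom R W (W\<lparr>carrier := ?I\<rparr>)" by (rule Hom_into_sub[OF \<rho> \<rho>I])
    obtain t where t: "t \<in> Hom B M (Hom_module R T W)" "\<And>y. y \<in> carrier M \<Longrightarrow> p (t y) = y"
    proof (rule split_epi[OF LM LF[OF LW] p Hom_module_map[OF LT \<rho>]])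
      fix w assume w: "w \<in> carrier (Hom_module R T W)"
      have wH: "w \<in> Hom R T W" using w by simp
      have v: "restrict (\<lambda>t. \<sigma> (\<rho> (w t))) (carrier T) \<in> carrier (Hom_module R T V)"
        using restrict_mem[OF LT Hom_comp[OF Hom_comp[OF wH \<rho>H] \<sigma>(1)]] by simp
      \<comment> \<open>Maps into the image of \<open>g\<close> factor through \<open>V\<close> by
        \<open>\<sigma>\<close>, so they lie in the image of \<open>r\<close>, on which
        \<open>p\<close> vanishes.\<close>
      have "r (restrict (\<lambda>t. \<sigma> (\<rho> (w t))) (carrier T)) = compose (carrier T) \<rho> w"
        unfolding g(2)[OF v] using \<sigma>(2) \<rho>I HomD(1)[OF wH]
        by (intro Hom_module_eqI[of _ T]) (auto simp: compose_def)
      then show "p (compose (carrier T) \<rho> w) = \<zero>\<^bsub>M\<^esub>"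
        using HomD(1)[OF r1 v] by (simp add: kernel_iff)
    next
      fix w assume w: "w \<in> carrier (Hom_module R T W)" "p w = \<zero>\<^bsub>M\<^esub>"
      then have "w \<in> carrier ?N" by (simp add: kernel_iff)
      from epi_homD(2)[OF r this] obtain v where v: "v \<in> carrier (Hom_module R T V)" "r v = w" by blast
      have wv: "w = compose (carrier T) g v" using g(2)[OF v(1)] v(2) by simp
      have "w t \<in> ?I" if "t \<in> carrier T" for t
        using v(1) that HomD(1)[of v R T V] unfolding wv by (simp add: compose_def)
      then show "compose (carrier T) \<rho> w = w"
        using w(1) \<rho>id by (intro Hom_module_eqI[of _ T]) (auto simp: compose_def)
    qed (rule that)
    have "projective_module B M" by (rule projective_retract[OF projective_Hom_module[OF W(1)] M t(1) p1]) (rule t(2))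
    then show ?thesis using 0 by simp
  next
    case (Suc k)
    \<comment> \<open>\<open>\<Inter>\<U>\<close> is the trace of \<open>T\<close> in \<open>ker g\<close>.\<close>
    define \<U> where "\<U> = {U. submodule U R V \<and> (\<forall>f\<in>Hom R T V. (\<forall>t\<in>carrier T. g (f t) = \<zero>\<^bsub>W\<^esub>) \<longrightarrow> f ` carrier T \<subseteq> U)}"
    have L: "a_kernel V W g \<in> \<U>"
      using submodule_kernel[OF LV LW g(1)] by (auto simp: \<U>_def kernel_iff HomD(1))
    let ?S = "\<Inter>\<U>"
    have S: "submodule ?S R V"
    proof (rule submoduleI'[OF LV])
      note U = submoduleD[of _ R V]
      show "?S \<subseteq> carrier V" using L by (auto simp: kernel_iff)
      show "\<zero>\<^bsub>V\<^esub> \<in> ?S" using U(2) by (auto simp: \<U>_def)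
      show "x \<oplus>\<^bsub>V\<^esub> y \<in> ?S" if "x \<in> ?S" "y \<in> ?S" for x y using that U(3) by (auto simp: \<U>_def)
      show "c \<odot>\<^bsub>V\<^esub> x \<in> ?S" if "c \<in> carrier R" "x \<in> ?S" for c x using that U(4) by (auto simp: \<U>_def)
    qed
    have SV: "?S \<subseteq> carrier V" by (rule submoduleD(1)[OF S])
    have SL: "g x = \<zero>\<^bsub>W\<^esub>" if "x \<in> ?S" for x using that L by (auto simp: kernel_iff)
    have trace: "f t \<in> ?S" if "f \<in> Hom R T V" "\<And>t. t \<in> carrier T \<Longrightarrow> g (f t) = \<zero>\<^bsub>W\<^esub>" "t \<in> carrier T" for f t
    proof (rule InterI)
      fix U assume "U \<in> \<U>"
      then have "\<forall>f\<in>Hom R T V. (\<forall>t\<in>carrier T. g (f t) = \<zero>\<^bsub>W\<^esub>) \<longrightarrow> f ` carrier T \<subseteq> U" by (simp add: \<U>_def)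
      from bspec[OF this that(1)] show "f t \<in> U" using that(2,3) by blast
    qed
    have gS: "generated_by R T (V\<lparr>carrier := ?S\<rparr>)"
      unfolding generated_by_def
    proof (intro conjI allI impI fg_submodule[OF V(2) S])
      fix U assume U: "submodule U R (V\<lparr>carrier := ?S\<rparr>)" "\<forall>f\<in>Hom R T (V\<lparr>carrier := ?S\<rparr>). f ` carrier T \<subseteq> U"
      have US: "U \<subseteq> ?S" using submoduleD(1)[OF U(1)] by simp
      have UV: "submodule U R V" using submodule_of_sub[OF S US LV] U(1) by blast
      have "f ` carrier T \<subseteq> U" if f: "f \<in> Hom R T V" "\<forall>t\<in>carrier T. g (f t) = \<zero>\<^bsub>W\<^esub>" for f
      proof (rule bspec[OF U(2)])
        show "f \<in> Hom R T (V\<lparr>carrier := ?S\<rparr>)" by (rule Hom_into_sub[OF f(1)]) (use trace f in blast)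
      qed
      with UV have "U \<in> \<U>" by (auto simp: \<U>_def)
      then show "carrier (V\<lparr>carrier := ?S\<rparr>) \<subseteq> U" by auto
    qed
    obtain X :: "'a fgmod" and q where X: "fg_module R X" "q \<in> epi_hom R V X" "a_kernel V X q = ?S"
      by (rule quotient_fgmod[OF V(2) S])
    note LX = fg_moduleD[OF X(1)] and q1 = epi_homD(1)[OF X(2)]
    have gX: "generated_by R T X" by (rule generated_by_epi[OF generated_by_power[OF V(1) fgT] LX X(2)])
    have gK: "generated_by R T (Ker V X q)" using gS unfolding X(3) .
    \<comment> \<open>Maps from \<open>T\<close> to the kernel of \<open>g\<close> land in the trace
      \<open>?S\<close>, so Hom(T, V) -> Hom(T, X) and \<open>r\<close> have the same kernel. The
      former is surjective because the kernel of \<open>q\<close> is generated by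
      \<open>T\<close>.\<close>
    have iso: "iso_modules B (Hom_module R T X) ?N"
    proof (rule iso_modules_epi[OF LF[OF LV] LF[OF LX] LN Hom_module_map_epi[OF q1 lift_to_quotient[OF V(2) X(1,2) gK]] r])
      fix v assume v: "v \<in> carrier (Hom_module R T V)"
      have vH: "v \<in> Hom R T V" using v by simp
      have "(\<forall>t\<in>carrier T. q (v t) = \<zero>\<^bsub>X\<^esub>) \<longleftrightarrow> (\<forall>t\<in>carrier T. v t \<in> ?S)"
        using HomD(1)[OF vH] unfolding X(3)[symmetric] by (auto simp: kernel_iff)
      also have "\<dots> \<longleftrightarrow> (\<forall>t\<in>carrier T. g (v t) = \<zero>\<^bsub>W\<^esub>)"
        using SL trace[OF vH] by blast
      finally show "compose (carrier T) q v = \<zero>\<^bsub>Hom_module R T X\<^esub> \<longleftrightarrow> r v = \<zero>\<^bsub>?N\<^esub>"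
        unfolding g(2)[OF v] using Hom_module_map_zero[OF v, of q X] Hom_module_map_zero[OF v, of g W] by simp
    qed
    \<comment> \<open>\<open>X\<close> has projective dimension at most \<open>Suc k\<close>, and
      still Ext^(k+1)(X, Y) = 0: here the degree spent on the first syzygy of \<open>M\<close> is
      regained.\<close>
    have ext: "Ext_zero R Y k X" if Y: "generated_by R T Y" for Y :: "'a fgmod"
    proof -
      obtain P \<epsilon> d where res: "projective_resolution R X P \<epsilon> d" "\<And>i. i > Suc k \<Longrightarrow> is_zero_module (P i)"
        using projdim_leE[OF n[OF X(1)]] Suc by metis
      show ?thesis by (rule Ext_zero_resolution[OF extends_projective[OF Y] X(1) res])
    qed
    have "pd_le B (Suc k) M"
    proof (rule pd_le_Suc[OF projective_Hom_module[OF W(1)] LM p])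
      fix A :: "('t \<Rightarrow> 't) fgmod"
      assume A: "left_module B A" "iso_modules B ?N A"
      show "pd_le B k A" by (rule pd_le_Hom_module[OF gX ext iso_modules_trans[OF iso A(2)] A(1)])
    qed
    then show ?thesis using Suc by simp
  qed
qed

end

text \<open>\<open>Ext1_vanishes\<close> provides some resolution, possibly not the presentation at
  hand. On that resolution the claim is a reformulation of the equality of cocycles and
  coboundaries, and \<open>Ext_zero_all\<close> changes the presentation.\<close>

lemma (in artin_alg) extends_from_Ext1_vanishes:
  fixes T :: "('a, 't) module" and P :: "'a fgmod"
  assumes T: "fg_module R T" and ext: "Ext1_vanishes R T T"
    and P: "projective_module R P" "p \<in> epi_hom R P T"
  shows "extends_from R P (a_kernel P T p) T"
proof -
  note LT = fg_moduleD[OF T]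
  obtain Q \<epsilon> d where res: "projective_resolution R T Q \<epsilon> d" and eq: "Ext1_cocycles R Q d T = Ext1_coboundaries R Q d T"
    using ext by (auto simp: Ext1_vanishes_def)
  have Q: "projective_module R (Q i)" and \<epsilon>: "\<epsilon> \<in> epi_hom R (Q 0) T" and d: "d i \<in> Hom R (Q (Suc i)) (Q i)"
    and k0: "d 0 ` carrier (Q 1) = a_kernel (Q 0) T \<epsilon>"
    and k1: "d (Suc i) ` carrier (Q (Suc (Suc i))) = a_kernel (Q (Suc i)) (Q i) (d i)" for i
    using res by (auto simp: projective_resolution_def)
  note LQ = projectiveD(2)[OF Q] and \<epsilon>1 = epi_homD(1)[OF \<epsilon>]
  have extQ: "extends_from R (Q 0) (a_kernel (Q 0) T \<epsilon>) T"
    unfolding extends_from_def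
  proof
    fix h assume h: "h \<in> Hom R (Ker (Q 0) T \<epsilon>) T"
    have dK: "d 0 \<in> Hom R (Q 1) (Ker (Q 0) T \<epsilon>)" using k0 d[of 0] by (intro Hom_into_sub) auto
    have hd: "(\<lambda>x. h (d 0 x)) \<in> Hom R (Q 1) T" by (rule Hom_comp[OF dK h])
    have "h (d 0 (d 1 x)) = \<zero>\<^bsub>T\<^esub>" if x: "x \<in> carrier (Q 2)" for x
    proof -
      have "d 1 x \<in> a_kernel (Q 1) (Q 0) (d 0)" using k1[of 0] x by (auto simp: numeral_2_eq_2)
      then have "d 0 (d 1 x) = \<zero>\<^bsub>Q 0\<^esub>" by (simp add: kernel_iff)
      then show ?thesis using Hom_zero[OF h left_module_Ker[OF LQ LT \<epsilon>1] LT] by simp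
    qed
    \<comment> \<open>A map on the first syzygy becomes a cocycle after composition with
      \<open>d 0\<close>; writing it as a coboundary is the same as extending it to
      \<open>Q 0\<close>.\<close>
    then have "(\<lambda>x. h (d 0 x)) \<in> Ext1_coboundaries R Q d T"
      unfolding eq[symmetric] Ext1_cocycles_def using hd by blast
    then obtain g where g: "g \<in> Hom R (Q 0) T" "\<forall>x\<in>carrier (Q 1). h (d 0 x) = g (d 0 x)"
      by (auto simp: Ext1_coboundaries_def)
    have "g x = h x" if "x \<in> a_kernel (Q 0) T \<epsilon>" for x using that g(2) unfolding k0[symmetric] by auto
    with g(1) show "\<exists>g\<in>Hom R (Q 0) T. \<forall>x\<in>a_kernel (Q 0) T \<epsilon>. g x = h x" by blast
  qed
  \<comment> \<open>\<open>Ext_zero\<close> speaks about modules in \<open>'a fgmod\<close>, so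
    \<open>T\<close> is replaced by a copy, which leaves the kernels unchanged.\<close>
  obtain T' :: "'a fgmod" and f g where T': "fg_module R T'" "f \<in> Hom R T T'" "g \<in> Hom R T' T"
    "\<And>x. x \<in> carrier T \<Longrightarrow> g (f x) = x" "\<And>y. y \<in> carrier T' \<Longrightarrow> f (g y) = y"
    by (rule fg_copy[OF T]) (rule that)
  have fepi: "f \<in> epi_hom R T T'" using T'(5) HomD(1)[OF T'(3)] by (intro epi_homI[OF T'(2)]) blast
  have z: "f x = \<zero>\<^bsub>T'\<^esub> \<longleftrightarrow> x = \<zero>\<^bsub>T\<^esub>" if "x \<in> carrier T" for x
    using T'(4)[OF that] Hom_zero[OF T'(2) LT fg_moduleD[OF T'(1)]] Hom_zero[OF T'(3) fg_moduleD[OF T'(1)] LT] by metis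
  have ker: "a_kernel A T' (\<lambda>x. f (h x)) = a_kernel A T h" if "h \<in> Hom R A T" for A :: "'a fgmod" and h
    unfolding a_kernel_def' using z[OF HomD(1)[OF that]] by blast
  have "extends_from R (Q 0) (a_kernel (Q 0) T' (\<lambda>x. f (\<epsilon> x))) T" using extQ ker[OF \<epsilon>1] by simp
  then have "Ext_zero R T 0 T'"
    unfolding Ext_zero.simps(1) using Q epi_comp[OF \<epsilon> fepi] by (intro exI conjI)
  from Ext_zero_all[OF LT this T'(1) P(1) epi_comp[OF P(2) fepi]] ker[OF epi_homD(1)[OF P(2)]]
  show ?thesis by simp
qed

theorem corollary3p2p5:
  fixes K :: "'k ring" and \<phi> :: "'k \<Rightarrow> 'a" and \<Gamma> :: "'a ring" and T :: "('a, 't) module"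
  assumes "artin_algebra K \<phi> \<Gamma>"
    and "domdim \<Gamma> \<ge> 2"
    and "tilting_module \<Gamma> T"
    and "in_C \<Gamma> T"
  shows "gldim (op_ring (End_ring \<Gamma> T)) \<le> gldim \<Gamma>"
proof (cases "gldim \<Gamma>")
  case (enat n)
  interpret artin_alg K \<phi> \<Gamma> by unfold_locales (rule assms(1))
  have fgT: "fg_module \<Gamma> T" using assms(3) by (simp add: tilting_module_def basic_module_def)
  have "projdim \<Gamma> T \<le> enat 1" using assms(3) by (simp add: tilting_module_def one_enat_def)
  then obtain P \<epsilon> d where res: "projective_resolution \<Gamma> T P \<epsilon> d" "\<And>i. i > 1 \<Longrightarrow> is_zero_module (P i)"
    by (rule projdim_leE) (rule that)
  have P: "projective_module \<Gamma> (P 0)" "\<epsilon> \<in> epi_hom \<Gamma> (P 0) T" using res(1) by (auto simp: projective_resolution_def)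
  have ker: "projective_module \<Gamma> (Ker (P 0) T \<epsilon>)" by (rule projective_syzygy[OF fgT res])
  \<comment> \<open>Ext^1(T, T) = 0 is transferred to the presentation that comes from the bound on
    the projective dimension.\<close>
  have ext: "extends_from \<Gamma> (P 0) (a_kernel (P 0) T \<epsilon>) T"
    by (rule extends_from_Ext1_vanishes[OF fgT _ P]) (use assms(3) in \<open>simp add: tilting_module_def\<close>)
  obtain T0 T1 :: "'a fgmod" and f g where T01: "in_add \<Gamma> T T0" "in_add \<Gamma> T T1"
    "f \<in> mono_hom \<Gamma> (regular_module \<Gamma>) T0" "g \<in> epi_hom \<Gamma> T0 T1"
    "f ` carrier (regular_module \<Gamma>) = a_kernel T0 T1 g"
    using assms(3) by (auto simp: tilting_module_def)
  obtain Xs m q where Xs: "proj_inj_representatives \<Gamma> Xs" and q: "q \<in> epi_hom \<Gamma> (module_power (direct_sum Xs) m) T"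
    using assms(4) by (auto simp: in_C_def in_Gen_def)
  interpret tilting_in_C K \<phi> \<Gamma> T "P 0" \<epsilon> T0 T1 f g Xs m q
    by unfold_locales (use fgT P ker ext T01 Xs q in \<open>auto simp: proj_inj_representatives_def\<close>)
  have le: "projdim \<Gamma> X \<le> enat n" if "fg_module \<Gamma> X" for X :: "'a fgmod"
    unfolding enat[symmetric] gldim_def by (rule Sup_upper) (use that in blast)
  have "projdim (End_op \<Gamma> T) M \<le> enat n" if "fg_module (End_op \<Gamma> T) M" for M :: "('t \<Rightarrow> 't) fgmod"
    by (rule projdim_le[OF pd_le_End_op[OF le that]])
  then show ?thesis unfolding enat gldim_def[of "End_op \<Gamma> T"] by (intro Sup_least) auto
qed simp

end
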